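(* Let $(\mathcal C^c,\between,\mathcal A)$ be a type of generalized bialgebras over a field $\mathbb K$ of characteristic zero (with $\between$ denoting its compatibility relations). Suppose that: (H0) any pair $(\delta,\mu)$ of a cooperation and an operation satisfies a distributive compatibility relation; (H1) the free $\mathcal A$-algebra $\mathcal A(V)$ is equipped with a $\mathcal C^c\text{-}\mathcal A$-bialgebra structure which is functorial in $V$. Then the Schur functor $\mathcal P$ given by $\mathcal P(V):=(\mathrm{Prim}_{\mathcal C}\mathcal A)(V)$ is a suboperad of $\mathcal A$. Moreover, for any $\mathcal C^c\text{-}\mathcal A$-bialgebra $\mathcal H$ the space $\mathrm{Prim}\,\mathcal H$ is a $\mathcal P$-algebra and the inclusion $\mathrm{Prim}\,\mathcal H\hookrightarrow\mathcal H$ is a morphism of $\mathcal P$-algebras.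
   Context: Operads are algebraic (symmetric) operads over $\mathbb K$; the free $\mathcal A$-algebra on $V$ is $\mathcal A(V)=\bigoplus_{n\ge1}\mathcal A(n)\otimes_{S_n}V^{\otimes n}$. Both $\mathcal A$ and $\mathcal C$ have finitely many generating operations in each arity, $\mathcal A(0)=\mathcal C(0)=0$, $\mathcal A(1)=\mathcal C(1)=\mathbb K\,\mathrm{id}$. A $\mathcal C$-coalgebra is a vector space $C$ with $S_n$-equivariant maps $\mathcal C(n)\otimes C\to C^{\otimes n}$, $\delta\otimes c\mapsto\delta(c)$, compatible with the operad structure; elements of $\mathcal C(n)$ are called $n$-ary cooperations. A type of generalized bialgebras consists of operads $\mathcal A,\mathcal C$ and a set $\between$ of compatibility relations between operations of $\mathcal A$ and cooperations of $\mathcal C$; a $\mathcal C^c\text{-}\mathcal A$-bialgebra is a vector space that is an $\mathcal A$-algebra and a $\mathcal C$-coalgebra whose operations and cooperations satisfy these relations. A distributive compatibility relation for $\mu\in\mathcal A(n)$, $\delta\in\mathcal C(m)$ is one of the form $\delta\circ\mu=\sum_i(\mu^i_1\otimes\cdots\otimes\mu^i_m)\circ\omega^i\circ(\delta^i_1\otimes\cdots\otimes\delta^i_n)$ with $\mu^i_j\in\mathcal A(k_j)$, $\delta^i_j\in\mathcal C(l_j)$, $\sum_j k_j=\sum_j l_j=r_i$, $\omega^i\in\mathbb K[S_{r_i}]$. The primitive part of a bialgebra $\mathcal H$ is $\mathrm{Prim}\,\mathcal H=\{x\in\mathcal H:\delta(x)=0\text{ for all }\delta\in\mathcal C(n),\,n\ge2\}$.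 An operation $\mu\in\mathcal A(n)$ is primitive if, for independent variables $x_1,\dots,x_n$, the element $\mu(x_1,\dots,x_n)\in\mathcal A(\mathbb Kx_1\oplus\cdots\oplus\mathbb Kx_n)$ is primitive. $(\mathrm{Prim}_{\mathcal C}\mathcal A)(n)\subset\mathcal A(n)$ is the $S_n$-submodule of primitive operations, and $\mathrm{Prim}_{\mathcal C}\mathcal A$ is the corresponding Schur functor, a subfunctor of $\mathcal A$. *)

theory Defs
  imports Complex_Main "HOL-Library.Poly_Mapping" "HOL-Combinatorics.Permutations"
begin

section \<open>Vector spaces, quotients and tensor powers\<close>

text \<open>
  A vector space over the field \<open>'k\<close> is a subspace \<open>H\<close> of some ambient vector space
  \<open>vector_space s\<close> of type \<open>'h\<close>.  The free vector space on a type \<open>'b\<close> is \<open>'b \<Rightarrow>\<^sub>0 'k\<close>, with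
  basis vectors \<^term>\<open>Poly_Mapping.single b 1\<close>.
\<close>

definition fscale :: "'k::field \<Rightarrow> ('b \<Rightarrow>\<^sub>0 'k) \<Rightarrow> ('b \<Rightarrow>\<^sub>0 'k)" where
  "fscale a p = Poly_Mapping.map (\<lambda>b. a * b) p"

definition fsum :: "('b \<Rightarrow> ('c \<Rightarrow>\<^sub>0 'k)) \<Rightarrow> ('b \<Rightarrow>\<^sub>0 'k::field) \<Rightarrow> ('c \<Rightarrow>\<^sub>0 'k)" where
  \<comment> \<open>the linear extension of \<open>f\<close> from basis vectors to the free vector space\<close>
  "fsum f p = (\<Sum>b\<in>Poly_Mapping.keys p. fscale (Poly_Mapping.lookup p b) (f b))"

lemma lookup_fscale: "Poly_Mapping.lookup (fscale a p) b = a * Poly_Mapping.lookup p b"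
  by (simp add: fscale_def Poly_Mapping.map.rep_eq when_def)

lemma vector_space_fscale: "vector_space (fscale :: 'k::field \<Rightarrow> _ \<Rightarrow> ('b \<Rightarrow>\<^sub>0 'k))"
  by unfold_locales (auto intro!: poly_mapping_eqI simp: lookup_fscale lookup_add algebra_simps)

definition linear_between ::
  "('k \<Rightarrow> 'u \<Rightarrow> 'u) \<Rightarrow> 'u set \<Rightarrow> ('k \<Rightarrow> 'w \<Rightarrow> 'w) \<Rightarrow> 'w set \<Rightarrow> ('u::ab_group_add \<Rightarrow> 'w::ab_group_add) \<Rightarrow> bool"
where
  "linear_between s U s' W f \<longleftrightarrow> f ` U \<subseteq> W \<and>
     (\<forall>x\<in>U. \<forall>y\<in>U. f (x + y) = f x + f y) \<and> (\<forall>a. \<forall>x\<in>U. f (s a x) = s' a (f x))"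

definition multilinear_on ::
  "('k \<Rightarrow> 'u \<Rightarrow> 'u) \<Rightarrow> 'u set list \<Rightarrow> ('k \<Rightarrow> 'w \<Rightarrow> 'w) \<Rightarrow> ('u::ab_group_add list \<Rightarrow> 'w::ab_group_add) \<Rightarrow> bool"
where
  "multilinear_on s Us s' f \<longleftrightarrow>
     (\<forall>xs\<in>listset Us. \<forall>i<length Us. \<forall>y\<in>Us ! i. \<forall>a.
        f (xs[i := xs ! i + y]) = f xs + f (xs[i := y]) \<and>
        f (xs[i := s a (xs ! i)]) = s' a (f xs))"

text \<open>
  The quotient \<open>E / N\<close> of a vector space by a subspace is realised inside \<open>E\<close>, by a linear choice
  of one representative for each coset \<open>x + N\<close>: see \<open>quot_rep\<close> and \<open>quot_rep_eq_iff\<close> below.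
\<close>

definition quot_rep :: "('k::field \<Rightarrow> 'e \<Rightarrow> 'e) \<Rightarrow> 'e::ab_group_add set \<Rightarrow> 'e \<Rightarrow> 'e" where
  "quot_rep s N = (SOME p. Vector_Spaces.linear s s p \<and> (\<forall>x. p x - x \<in> N) \<and> (\<forall>x\<in>N. p x = 0))"

lemma quot_rep:
  assumes "vector_space s" "module.subspace s N"
  shows "Vector_Spaces.linear s s (quot_rep s N) \<and> (\<forall>x. quot_rep s N x - x \<in> N) \<and>
         (\<forall>x\<in>N. quot_rep s N x = 0)"
proof -
  interpret vector_space s by fact
  interpret vector_space_pair s s by unfold_locales
  obtain g where g: "range g \<subseteq> N" "Vector_Spaces.linear s s g" "\<forall>v\<in>N. g (id v) = v"
    using linear_exists_left_inverse_on[OF linear_id assms(2)] by auto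
  have "Vector_Spaces.linear s s (\<lambda>x. x - g x)"
    using g(2) linear_id by (intro linear_compose_sub) (auto simp: linear_ident)
  moreover have "\<forall>x. (x - g x) - x \<in> N"
    using g(1) assms(2) by (auto intro: subspace_neg)
  moreover have "\<forall>x\<in>N. x - g x = 0" using g(3) by simp
  ultimately show ?thesis
    unfolding quot_rep_def by - (rule someI[where x = "\<lambda>x. x - g x"], blast)
qed

lemma quot_rep_eq_iff:
  assumes "vector_space s" "module.subspace s N"
  shows "quot_rep s N x = quot_rep s N y \<longleftrightarrow> x - y \<in> N"
proof -
  interpret vector_space s by fact
  interpret p: Vector_Spaces.linear s s "quot_rep s N" using quot_rep[OF assms] by blast
  have eq: "quot_rep s N x = quot_rep s N y \<longleftrightarrow> quot_rep s N (x - y) = 0"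
    by (simp add: p.diff)
  have "z \<in> N" if "quot_rep s N z = 0" for z
  proof -
    have "quot_rep s N z - z \<in> N" using quot_rep[OF assms] by blast
    thus ?thesis using that subspace_neg[OF assms(2), of "- z"] by simp
  qed
  thus ?thesis using eq quot_rep[OF assms] by blast
qed

text \<open>
  The tensor powers \<open>H\<^sup>\<otimes>\<^sup>n\<close> are the usual quotients: an element is represented by a formal linear
  combination of words of length \<open>n\<close> over \<open>H\<close>, the word \<open>[x\<^sub>1, \<dots>, x\<^sub>n]\<close> standing for
  \<open>x\<^sub>1 \<otimes> \<dots> \<otimes> x\<^sub>n\<close>, and two combinations represent the same tensor (\<open>tensor_eq\<close>) iff their
  difference lies in the span \<open>tensor_null\<close> of the multilinearity relations.  Maps into a tensor
  power are given by maps into the representatives.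
\<close>

definition tensor_reps :: "'h set \<Rightarrow> nat \<Rightarrow> ('h list \<Rightarrow>\<^sub>0 'k::field) set" where
  "tensor_reps H n = {t. \<forall>w\<in>Poly_Mapping.keys t. length w = n \<and> set w \<subseteq> H}"

definition tensor_null :: "('k::field \<Rightarrow> 'h \<Rightarrow> 'h) \<Rightarrow> 'h::ab_group_add set \<Rightarrow> ('h list \<Rightarrow>\<^sub>0 'k) set" where
  "tensor_null s H = module.span fscale
     ({Poly_Mapping.single (us @ (x + y) # ws) 1 - Poly_Mapping.single (us @ x # ws) 1
         - Poly_Mapping.single (us @ y # ws) 1 | us x y ws.
         set us \<subseteq> H \<and> x \<in> H \<and> y \<in> H \<and> set ws \<subseteq> H} \<union>
      {Poly_Mapping.single (us @ s a x # ws) 1 - Poly_Mapping.single (us @ x # ws) a | us a x ws.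
         set us \<subseteq> H \<and> x \<in> H \<and> set ws \<subseteq> H})"

definition tensor_eq ::
  "('k::field \<Rightarrow> 'h \<Rightarrow> 'h) \<Rightarrow> 'h::ab_group_add set \<Rightarrow> ('h list \<Rightarrow>\<^sub>0 'k) \<Rightarrow> ('h list \<Rightarrow>\<^sub>0 'k) \<Rightarrow> bool" where
  "tensor_eq s H t u \<longleftrightarrow> t - u \<in> tensor_null s H"

definition tensor_mult :: "('h list \<Rightarrow>\<^sub>0 'k::field) \<Rightarrow> ('h list \<Rightarrow>\<^sub>0 'k) \<Rightarrow> ('h list \<Rightarrow>\<^sub>0 'k)" where
  \<comment> \<open>\<open>H\<^sup>\<otimes>\<^sup>m \<otimes> H\<^sup>\<otimes>\<^sup>n \<rightarrow> H\<^sup>\<otimes>\<^sup>m\<^sup>+\<^sup>n\<close>\<close>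
  "tensor_mult t u = fsum (\<lambda>v. fsum (\<lambda>w. Poly_Mapping.single (v @ w) 1) u) t"

definition tensor_prod :: "('h list \<Rightarrow>\<^sub>0 'k::field) list \<Rightarrow> ('h list \<Rightarrow>\<^sub>0 'k)" where
  "tensor_prod ts = foldr tensor_mult ts (Poly_Mapping.single [] 1)"

definition tensor_perm :: "(nat \<Rightarrow> nat) \<Rightarrow> ('h list \<Rightarrow>\<^sub>0 'k::field) \<Rightarrow> ('h list \<Rightarrow>\<^sub>0 'k)" where
  \<comment> \<open>the left action \<open>\<sigma> \<cdot> (x\<^sub>1 \<otimes> \<dots> \<otimes> x\<^sub>n) = x\<^bsub>\<sigma>\<inverse>(1)\<^esub> \<otimes> \<dots> \<otimes> x\<^bsub>\<sigma>\<inverse>(n)\<^esub>\<close> of the symmetric group\<close>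
  "tensor_perm \<sigma> = fsum (\<lambda>w. Poly_Mapping.single (permute_list (inv \<sigma>) w) 1)"

definition tensor_map :: "('h \<Rightarrow> 'g) \<Rightarrow> ('h list \<Rightarrow>\<^sub>0 'k::field) \<Rightarrow> ('g list \<Rightarrow>\<^sub>0 'k)" where
  "tensor_map f = fsum (\<lambda>w. Poly_Mapping.single (map f w) 1)"


section \<open>Operads\<close>

text \<open>
  Symmetric operads over \<open>'k\<close> in terms of their spaces of operations.  \<open>ops A n\<close> is the space of
  \<open>n\<close>-ary operations, \<open>ocomp A [k\<^sub>1, \<dots>, k\<^sub>n] \<mu> [\<nu>\<^sub>1, \<dots>, \<nu>\<^sub>n]\<close> is the full composite
  \<open>\<gamma>(\<mu>; \<nu>\<^sub>1, \<dots>, \<nu>\<^sub>n)\<close> with \<open>\<nu>\<^sub>i\<close> of arity \<open>k\<^sub>i\<close>, and \<open>oact A n \<sigma> \<mu>\<close> is a left action of the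
  permutations of \<open>{..<n}\<close>, corresponding to \<open>(\<sigma> \<cdot> \<mu>)(x\<^sub>1, \<dots>, x\<^sub>n) = \<mu>(x\<^bsub>\<sigma>(1)\<^esub>, \<dots>, x\<^bsub>\<sigma>(n)\<^esub>)\<close>, i.e. the
  action by \<open>\<sigma>\<inverse>\<close> in the customary right module structure.  The spaces for different arities all
  sit in one type and may overlap there, which is why the arities are arguments of these functions.
\<close>

record ('k, 'a) operad_data =
  oscale :: "'k \<Rightarrow> 'a \<Rightarrow> 'a"
  ops :: "nat \<Rightarrow> 'a set"
  oact :: "nat \<Rightarrow> (nat \<Rightarrow> nat) \<Rightarrow> 'a \<Rightarrow> 'a"
  ocomp :: "nat list \<Rightarrow> 'a \<Rightarrow> 'a list \<Rightarrow> 'a"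
  oone :: 'a

definition perm_of :: "nat list \<Rightarrow> nat \<Rightarrow> nat" where
  "perm_of p = (\<lambda>i. if i < length p then p ! i else i)"

definition blocks :: "nat list \<Rightarrow> nat list list" where
  \<comment> \<open>the consecutive intervals of lengths \<open>k\<^sub>1, \<dots>, k\<^sub>n\<close>\<close>
  "blocks ks = map (\<lambda>j. [sum_list (take j ks) ..< sum_list (take (Suc j) ks)]) [0..<length ks]"

definition block_perm :: "nat list \<Rightarrow> (nat \<Rightarrow> nat) \<Rightarrow> nat \<Rightarrow> nat" where
  "block_perm ks \<sigma> = perm_of (concat (permute_list \<sigma> (blocks ks)))"

definition sum_perm :: "nat list \<Rightarrow> (nat \<Rightarrow> nat) list \<Rightarrow> nat \<Rightarrow> nat" where
  "sum_perm ks \<tau>s = perm_of (concat (map2 permute_list \<tau>s (blocks ks)))"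

text \<open>
  The two permutations are characterised by their effect on a list cut into pieces of the
  prescribed lengths: one permutes the pieces, the other one permutes inside the pieces.
\<close>

lemma map_nth_blocks: "map (map ((!) (concat bs))) (blocks (map length bs)) = bs"
proof (rule nth_equalityI)
  show "length (map (map ((!) (concat bs))) (blocks (map length bs))) = length bs"
    by (simp add: blocks_def)
next
  fix j assume "j < length (map (map ((!) (concat bs))) (blocks (map length bs)))"
  hence j: "j < length bs" by (simp add: blocks_def)
  have split: "concat bs = concat (take j bs) @ bs ! j @ concat (drop (Suc j) bs)"
    by (metis append_assoc concat.simps(2) concat_append id_take_nth_drop j)
  have len: "length (concat (take i bs)) = sum_list (take i (map length bs))" for i
    by (simp add: length_concat take_map)
  have suc: "sum_list (take (Suc j) (map length bs))
      = sum_list (take j (map length bs)) + length (bs ! j)"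
    using j by (simp add: take_Suc_conv_app_nth)
  show "map (map ((!) (concat bs))) (blocks (map length bs)) ! j = bs ! j"
  proof (rule nth_equalityI)
    show "length (map (map ((!) (concat bs))) (blocks (map length bs)) ! j) = length (bs ! j)"
      using j suc by (simp add: blocks_def)
  next
    fix i assume "i < length (map (map ((!) (concat bs))) (blocks (map length bs)) ! j)"
    hence i: "i < length (bs ! j)" using j suc by (simp add: blocks_def)
    have "concat bs ! (sum_list (take j (map length bs)) + i) = bs ! j ! i"
      using i by (subst split) (simp add: nth_append flip: len)
    thus "map (map ((!) (concat bs))) (blocks (map length bs)) ! j ! i = bs ! j ! i"
      using j i suc by (simp add: blocks_def)
  qed
qed

lemma permute_list_perm_of:
  "length p = length xs \<Longrightarrow> permute_list (perm_of p) xs = map ((!) xs) p"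
  by (auto simp: permute_list_def perm_of_def intro!: nth_equalityI)

lemma permute_list_block_perm:
  assumes "\<sigma> permutes {..<length bs}"
  shows "permute_list (block_perm (map length bs) \<sigma>) (concat bs) = concat (permute_list \<sigma> bs)"
proof -
  have len: "length (blocks (map length bs)) = length bs" by (simp add: blocks_def)
  have *: "map (map ((!) (concat bs))) (permute_list \<sigma> (blocks (map length bs))) = permute_list \<sigma> bs"
    using assms by (subst permute_list_map[symmetric]) (simp_all add: len map_nth_blocks)
  have "length (concat (permute_list \<sigma> (blocks (map length bs)))) = length (concat (permute_list \<sigma> bs))"
    by (metis * length_map map_concat)
  also have "\<dots> = size (\<Sum>x\<in>#mset (permute_list \<sigma> bs). mset x)"
    by (simp only: mset_map[symmetric] sum_mset_sum_list mset_concat size_mset[symmetric])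
  also have "\<dots> = length (concat bs)"
    by (simp only: mset_permute_list[OF assms] mset_map[symmetric] sum_mset_sum_list
        mset_concat size_mset[symmetric])
  finally have "permute_list (block_perm (map length bs) \<sigma>) (concat bs) =
      map ((!) (concat bs)) (concat (permute_list \<sigma> (blocks (map length bs))))"
    unfolding block_perm_def by (rule permute_list_perm_of)
  thus ?thesis by (simp only: map_concat *)
qed

lemma permute_list_sum_perm:
  assumes "length \<tau>s = length bs" "\<And>i. i < length bs \<Longrightarrow> \<tau>s ! i permutes {..<length (bs ! i)}"
  shows "permute_list (sum_perm (map length bs) \<tau>s) (concat bs) = concat (map2 permute_list \<tau>s bs)"
proof -
  let ?B = "blocks (map length bs)"
  have len: "length ?B = length bs" by (simp add: blocks_def)
  have nth: "map ((!) (concat bs)) (?B ! i) = bs ! i" if "i < length bs" for i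
    using that map_nth_blocks[of bs] len by (metis nth_map)
  hence nth': "length (?B ! i) = length (bs ! i)" if "i < length bs" for i
    using that by (metis length_map)
  have *: "map (map ((!) (concat bs))) (map2 permute_list \<tau>s ?B) = map2 permute_list \<tau>s bs"
  proof (rule nth_equalityI)
    fix i assume "i < length (map (map ((!) (concat bs))) (map2 permute_list \<tau>s ?B))"
    hence i: "i < length bs" by (simp add: len assms(1))
    have "map ((!) (concat bs)) (permute_list (\<tau>s ! i) (?B ! i)) = permute_list (\<tau>s ! i) (bs ! i)"
      using permute_list_map[of "\<tau>s ! i" "?B ! i" "(!) (concat bs)"] assms(2)[OF i]
      by (simp only: nth[OF i] nth'[OF i])
    thus "map (map ((!) (concat bs))) (map2 permute_list \<tau>s ?B) ! i = map2 permute_list \<tau>s bs ! i"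
      using i by (simp add: len assms(1))
  qed (simp add: len assms(1))
  have "map length (map2 permute_list \<tau>s ?B) = map length bs"
  proof (rule nth_equalityI)
    fix i assume "i < length (map length (map2 permute_list \<tau>s ?B))"
    hence i: "i < length bs" by (simp add: len assms(1))
    thus "map length (map2 permute_list \<tau>s ?B) ! i = map length bs ! i"
      using nth'[OF i] by (simp add: len assms(1))
  qed (simp add: len assms(1))
  hence "length (concat (map2 permute_list \<tau>s ?B)) = length (concat bs)"
    by (simp only: length_concat)
  hence "permute_list (sum_perm (map length bs) \<tau>s) (concat bs) =
      map ((!) (concat bs)) (concat (map2 permute_list \<tau>s ?B))"
    unfolding sum_perm_def by (rule permute_list_perm_of)
  thus ?thesis by (simp only: map_concat *)
qed

locale operad =
  fixes A :: "('k::field, 'a::ab_group_add) operad_data"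
  assumes vector_space: "vector_space (oscale A)"
    and subspace: "module.subspace (oscale A) (ops A n)"
    and one_mem: "oone A \<in> ops A 1"
    and act_linear: "\<sigma> permutes {..<n} \<Longrightarrow>
      linear_between (oscale A) (ops A n) (oscale A) (ops A n) (oact A n \<sigma>)"
    and act_id: "\<mu> \<in> ops A n \<Longrightarrow> oact A n id \<mu> = \<mu>"
    and act_comp: "\<lbrakk>\<sigma> permutes {..<n}; \<tau> permutes {..<n}; \<mu> \<in> ops A n\<rbrakk> \<Longrightarrow>
      oact A n (\<sigma> \<circ> \<tau>) \<mu> = oact A n \<sigma> (oact A n \<tau> \<mu>)"
    and comp_mem: "\<lbrakk>\<mu> \<in> ops A (length ks); \<nu>s \<in> listset (map (ops A) ks)\<rbrakk> \<Longrightarrow>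
      ocomp A ks \<mu> \<nu>s \<in> ops A (sum_list ks)"
    and comp_linear: "\<nu>s \<in> listset (map (ops A) ks) \<Longrightarrow>
      linear_between (oscale A) (ops A (length ks)) (oscale A) (ops A (sum_list ks))
        (\<lambda>\<mu>. ocomp A ks \<mu> \<nu>s)"
    and comp_multilinear: "\<mu> \<in> ops A (length ks) \<Longrightarrow>
      multilinear_on (oscale A) (map (ops A) ks) (oscale A) (ocomp A ks \<mu>)"
    and comp_one_left: "\<mu> \<in> ops A n \<Longrightarrow> ocomp A [n] (oone A) [\<mu>] = \<mu>"
    and comp_one_right: "\<mu> \<in> ops A n \<Longrightarrow> ocomp A (replicate n 1) \<mu> (replicate n (oone A)) = \<mu>"
    and comp_assoc: "\<lbrakk>\<mu> \<in> ops A (length kss); \<nu>s \<in> listset (map (\<lambda>ks. ops A (length ks)) kss);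
        length \<xi>ss = length kss; \<And>i. i < length kss \<Longrightarrow> \<xi>ss ! i \<in> listset (map (ops A) (kss ! i))\<rbrakk> \<Longrightarrow>
      ocomp A (concat kss) (ocomp A (map length kss) \<mu> \<nu>s) (concat \<xi>ss) =
      ocomp A (map sum_list kss) \<mu>
        (map (\<lambda>i. ocomp A (kss ! i) (\<nu>s ! i) (\<xi>ss ! i)) [0..<length kss])"
    and comp_act_outer: "\<lbrakk>\<sigma> permutes {..<length ks}; \<mu> \<in> ops A (length ks);
        \<nu>s \<in> listset (map (ops A) ks)\<rbrakk> \<Longrightarrow>
      ocomp A ks (oact A (length ks) \<sigma> \<mu>) \<nu>s =
      oact A (sum_list ks) (block_perm ks \<sigma>)
        (ocomp A (permute_list \<sigma> ks) \<mu> (permute_list \<sigma> \<nu>s))"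
    and comp_act_inner: "\<lbrakk>\<mu> \<in> ops A (length ks); \<nu>s \<in> listset (map (ops A) ks);
        length \<tau>s = length ks; \<And>i. i < length ks \<Longrightarrow> \<tau>s ! i permutes {..<ks ! i}\<rbrakk> \<Longrightarrow>
      ocomp A ks \<mu> (map (\<lambda>i. oact A (ks ! i) (\<tau>s ! i) (\<nu>s ! i)) [0..<length ks]) =
      oact A (sum_list ks) (sum_perm ks \<tau>s) (ocomp A ks \<mu> \<nu>s)"

abbreviation restrict_ops ::
  "('k, 'a) operad_data \<Rightarrow> (nat \<Rightarrow> 'a set) \<Rightarrow> ('k, 'a) operad_data" where
  "restrict_ops A P \<equiv> A\<lparr>ops := P\<rparr>"

definition suboperad ::
  "(nat \<Rightarrow> 'a set) \<Rightarrow> ('k::field, 'a::ab_group_add) operad_data \<Rightarrow> bool" where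
  "suboperad P A \<longleftrightarrow> (\<forall>n. P n \<subseteq> ops A n) \<and> operad (restrict_ops A P)"

definition finitely_generated_by_arity :: "('k::field, 'a::ab_group_add) operad_data \<Rightarrow> bool" where
  "finitely_generated_by_arity A \<longleftrightarrow>
     (\<exists>G. (\<forall>n. finite (G n) \<and> G n \<subseteq> ops A n) \<and>
          (\<forall>Q. suboperad Q A \<and> (\<forall>n. G n \<subseteq> Q n) \<longrightarrow> Q = ops A))"

definition connected_operad :: "('k::field, 'a::ab_group_add) operad_data \<Rightarrow> bool" where
  "connected_operad A \<longleftrightarrow> operad A \<and> finitely_generated_by_arity A \<and>
     ops A 0 = {0} \<and> ops A 1 = module.span (oscale A) {oone A} \<and> oone A \<noteq> 0"


section \<open>Algebras and coalgebras\<close>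

text \<open>\<open>opn \<mu> [x\<^sub>1, \<dots>, x\<^sub>n]\<close> is \<open>\<mu>(x\<^sub>1, \<dots>, x\<^sub>n)\<close> for \<open>\<mu> \<in> A(n)\<close>; the arity is the length of the list.\<close>

locale operad_algebra = operad A
  for A :: "('k::field, 'a::ab_group_add) operad_data" +
  fixes s :: "'k \<Rightarrow> 'h::ab_group_add \<Rightarrow> 'h" and H :: "'h set" and opn :: "'a \<Rightarrow> 'h list \<Rightarrow> 'h"
  assumes alg_vector_space: "vector_space s"
    and alg_subspace: "module.subspace s H"
    and opn_linear: "set xs \<subseteq> H \<Longrightarrow>
      linear_between (oscale A) (ops A (length xs)) s H (\<lambda>\<mu>. opn \<mu> xs)"
    and opn_multilinear: "\<mu> \<in> ops A n \<Longrightarrow> multilinear_on s (replicate n H) s (opn \<mu>)"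
    and opn_one: "x \<in> H \<Longrightarrow> opn (oone A) [x] = x"
    and opn_act: "\<lbrakk>set xs \<subseteq> H; \<sigma> permutes {..<length xs}; \<mu> \<in> ops A (length xs)\<rbrakk> \<Longrightarrow>
      opn (oact A (length xs) \<sigma> \<mu>) xs = opn \<mu> (permute_list \<sigma> xs)"
    and opn_comp: "\<lbrakk>\<mu> \<in> ops A (length xss); \<nu>s \<in> listset (map (\<lambda>xs. ops A (length xs)) xss);
        \<And>xs. xs \<in> set xss \<Longrightarrow> set xs \<subseteq> H\<rbrakk> \<Longrightarrow>
      opn (ocomp A (map length xss) \<mu> \<nu>s) (concat xss) = opn \<mu> (map2 opn \<nu>s xss)"

text \<open>\<open>coop n \<delta> x\<close> is \<open>\<delta>(x) \<in> H\<^sup>\<otimes>\<^sup>n\<close> for \<open>\<delta> \<in> C(n)\<close>, given by a representative.\<close>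

locale operad_coalgebra = operad C
  for C :: "('k::field, 'c::ab_group_add) operad_data" +
  fixes s :: "'k \<Rightarrow> 'h::ab_group_add \<Rightarrow> 'h" and H :: "'h set"
    and coop :: "nat \<Rightarrow> 'c \<Rightarrow> 'h \<Rightarrow> ('h list \<Rightarrow>\<^sub>0 'k)"
  assumes coalg_vector_space: "vector_space s"
    and coalg_subspace: "module.subspace s H"
    and coop_mem: "\<lbrakk>\<delta> \<in> ops C n; x \<in> H\<rbrakk> \<Longrightarrow> coop n \<delta> x \<in> tensor_reps H n"
    and coop_add_left: "\<lbrakk>\<delta> \<in> ops C n; \<epsilon> \<in> ops C n; x \<in> H\<rbrakk> \<Longrightarrow>
      tensor_eq s H (coop n (\<delta> + \<epsilon>) x) (coop n \<delta> x + coop n \<epsilon> x)"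
    and coop_scale_left: "\<lbrakk>\<delta> \<in> ops C n; x \<in> H\<rbrakk> \<Longrightarrow>
      tensor_eq s H (coop n (oscale C a \<delta>) x) (fscale a (coop n \<delta> x))"
    and coop_add_right: "\<lbrakk>\<delta> \<in> ops C n; x \<in> H; y \<in> H\<rbrakk> \<Longrightarrow>
      tensor_eq s H (coop n \<delta> (x + y)) (coop n \<delta> x + coop n \<delta> y)"
    and coop_scale_right: "\<lbrakk>\<delta> \<in> ops C n; x \<in> H\<rbrakk> \<Longrightarrow>
      tensor_eq s H (coop n \<delta> (s a x)) (fscale a (coop n \<delta> x))"
    and coop_one: "x \<in> H \<Longrightarrow> tensor_eq s H (coop 1 (oone C) x) (Poly_Mapping.single [x] 1)"
    and coop_act: "\<lbrakk>\<sigma> permutes {..<n}; \<delta> \<in> ops C n; x \<in> H\<rbrakk> \<Longrightarrow>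
      tensor_eq s H (coop n (oact C n \<sigma> \<delta>) x) (tensor_perm \<sigma> (coop n \<delta> x))"
    and coop_comp: "\<lbrakk>\<delta> \<in> ops C (length ks); \<epsilon>s \<in> listset (map (ops C) ks); x \<in> H\<rbrakk> \<Longrightarrow>
      tensor_eq s H (coop (sum_list ks) (ocomp C ks \<delta> \<epsilon>s) x)
        (fsum (\<lambda>w. tensor_prod (map (\<lambda>i. coop (ks ! i) (\<epsilon>s ! i) (w ! i)) [0..<length ks]))
              (coop (length ks) \<delta> x))"

definition algebra_hom where
  "algebra_hom A s X opX s' Y opY f \<longleftrightarrow>
     operad_algebra A s X opX \<and> operad_algebra A s' Y opY \<and> linear_between s X s' Y f \<and>
     (\<forall>xs. \<forall>\<mu>\<in>ops A (length xs). set xs \<subseteq> X \<longrightarrow> f (opX \<mu> xs) = opY \<mu> (map f xs))"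

definition coalgebra_hom where
  "coalgebra_hom C s X coX s' Y coY f \<longleftrightarrow>
     operad_coalgebra C s X coX \<and> operad_coalgebra C s' Y coY \<and> linear_between s X s' Y f \<and>
     (\<forall>n. \<forall>\<delta>\<in>ops C n. \<forall>x\<in>X. tensor_eq s' Y (tensor_map f (coX n \<delta> x)) (coY n \<delta> (f x)))"

definition primitive_part ::
  "('k::field, 'c::ab_group_add) operad_data \<Rightarrow> ('k \<Rightarrow> 'h \<Rightarrow> 'h) \<Rightarrow> 'h::ab_group_add set \<Rightarrow>
   (nat \<Rightarrow> 'c \<Rightarrow> 'h \<Rightarrow> ('h list \<Rightarrow>\<^sub>0 'k)) \<Rightarrow> 'h set" where
  "primitive_part C s H coop =
     {x\<in>H. \<forall>n\<ge>2. \<forall>\<delta>\<in>ops C n. tensor_eq s H (coop n \<delta> x) 0}"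


section \<open>Compatibility relations and generalized bialgebras\<close>

text \<open>
  Formal composites of operations and cooperations.  An expression with source \<open>m\<close> and target \<open>n\<close>
  denotes a linear map \<open>H\<^sup>\<otimes>\<^sup>m \<rightarrow> H\<^sup>\<otimes>\<^sup>n\<close> for each \<open>H\<close> with operations and cooperations.  A
  compatibility relation is an equation between two such expressions.
\<close>

datatype ('k, 'a, 'c) expr =
    Oper nat 'a
  | Coop nat 'c
  | Perm nat "nat \<Rightarrow> nat"
  | Tens "('k, 'a, 'c) expr" "('k, 'a, 'c) expr"
  | Comp "('k, 'a, 'c) expr" "('k, 'a, 'c) expr"
  | Zero nat nat
  | Add "('k, 'a, 'c) expr" "('k, 'a, 'c) expr"
  | Scale 'k "('k, 'a, 'c) expr"

fun source :: "('k, 'a, 'c) expr \<Rightarrow> nat" where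
  "source (Oper n \<mu>) = n"
| "source (Coop n \<delta>) = 1"
| "source (Perm n \<sigma>) = n"
| "source (Tens e f) = source e + source f"
| "source (Comp e f) = source f"
| "source (Zero m n) = m"
| "source (Add e f) = source e"
| "source (Scale a e) = source e"

fun target :: "('k, 'a, 'c) expr \<Rightarrow> nat" where
  "target (Oper n \<mu>) = 1"
| "target (Coop n \<delta>) = n"
| "target (Perm n \<sigma>) = n"
| "target (Tens e f) = target e + target f"
| "target (Comp e f) = target e"
| "target (Zero m n) = n"
| "target (Add e f) = target e"
| "target (Scale a e) = target e"

fun well_formed ::
  "('k::field, 'a) operad_data \<Rightarrow> ('k, 'c) operad_data \<Rightarrow> ('k, 'a, 'c) expr \<Rightarrow> bool" where
  "well_formed A C (Oper n \<mu>) \<longleftrightarrow> \<mu> \<in> ops A n"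
| "well_formed A C (Coop n \<delta>) \<longleftrightarrow> \<delta> \<in> ops C n"
| "well_formed A C (Perm n \<sigma>) \<longleftrightarrow> \<sigma> permutes {..<n}"
| "well_formed A C (Tens e f) \<longleftrightarrow> well_formed A C e \<and> well_formed A C f"
| "well_formed A C (Comp e f) \<longleftrightarrow> well_formed A C e \<and> well_formed A C f \<and> source e = target f"
| "well_formed A C (Zero m n) \<longleftrightarrow> True"
| "well_formed A C (Add e f) \<longleftrightarrow> well_formed A C e \<and> well_formed A C f \<and>
     source e = source f \<and> target e = target f"
| "well_formed A C (Scale a e) \<longleftrightarrow> well_formed A C e"

definition compatibility_relation ::
  "('k::field, 'a) operad_data \<Rightarrow> ('k, 'c) operad_data \<Rightarrow>
   ('k, 'a, 'c) expr \<times> ('k, 'a, 'c) expr \<Rightarrow> bool" where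
  "compatibility_relation A C r \<longleftrightarrow>
     (case r of (e, f) \<Rightarrow> well_formed A C e \<and> well_formed A C f \<and>
        source e = source f \<and> target e = target f)"

fun interp ::
  "('a \<Rightarrow> 'h list \<Rightarrow> 'h) \<Rightarrow> (nat \<Rightarrow> 'c \<Rightarrow> 'h \<Rightarrow> ('h list \<Rightarrow>\<^sub>0 'k)) \<Rightarrow>
   ('k::field, 'a, 'c) expr \<Rightarrow> 'h list \<Rightarrow> ('h list \<Rightarrow>\<^sub>0 'k)" where
  "interp opn coop (Oper n \<mu>) w = Poly_Mapping.single [opn \<mu> w] 1"
| "interp opn coop (Coop n \<delta>) w = coop n \<delta> (hd w)"
| "interp opn coop (Perm n \<sigma>) w = tensor_perm \<sigma> (Poly_Mapping.single w 1)"
| "interp opn coop (Tens e f) w =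
     tensor_mult (interp opn coop e (take (source e) w)) (interp opn coop f (drop (source e) w))"
| "interp opn coop (Comp e f) w = fsum (interp opn coop e) (interp opn coop f w)"
| "interp opn coop (Zero m n) w = 0"
| "interp opn coop (Add e f) w = interp opn coop e w + interp opn coop f w"
| "interp opn coop (Scale a e) w = fscale a (interp opn coop e w)"

definition satisfies where
  "satisfies s H opn coop r \<longleftrightarrow>
     (case r of (e, f) \<Rightarrow> \<forall>w. length w = source e \<and> set w \<subseteq> H \<longrightarrow>
        tensor_eq s H (interp opn coop e w) (interp opn coop f w))"

definition bialgebra where
  "bialgebra A C R s H opn coop \<longleftrightarrow>
     operad_algebra A s H opn \<and> operad_coalgebra C s H coop \<and>
     (\<forall>r\<in>R. satisfies s H opn coop r)"

definition bialgebra_hom where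
  "bialgebra_hom A C R s X opX coX s' Y opY coY f \<longleftrightarrow>
     bialgebra A C R s X opX coX \<and> bialgebra A C R s' Y opY coY \<and>
     algebra_hom A s X opX s' Y opY f \<and> coalgebra_hom C s X coX s' Y coY f"

definition bialgebra_type ::
  "('k::field, 'a::ab_group_add) operad_data \<Rightarrow> ('k, 'c::ab_group_add) operad_data \<Rightarrow>
   (('k, 'a, 'c) expr \<times> ('k, 'a, 'c) expr) set \<Rightarrow> bool" where
  "bialgebra_type A C R \<longleftrightarrow> connected_operad A \<and> connected_operad C \<and>
     (\<forall>r\<in>R. compatibility_relation A C r)"

definition Tens_list :: "('k::field, 'a, 'c) expr list \<Rightarrow> ('k, 'a, 'c) expr" where
  "Tens_list es = foldr Tens es (Perm 0 id)"

definition Sum_list :: "nat \<Rightarrow> nat \<Rightarrow> ('k, 'a, 'c) expr list \<Rightarrow> ('k, 'a, 'c) expr" where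
  "Sum_list m n es = foldr Add es (Zero m n)"

text \<open>Expressions for the elements of the group algebra of the permutations of \<open>{..<r}\<close>.\<close>

definition group_algebra :: "nat \<Rightarrow> ('k::field, 'a, 'c) expr set" where
  "group_algebra r =
     {Sum_list r r (map (\<lambda>(a, \<sigma>). Scale a (Perm r \<sigma>)) as) | as.
       \<forall>(a, \<sigma>)\<in>set as. \<sigma> permutes {..<r}}"

text \<open>The summands \<open>(\<mu>\<^sub>1 \<otimes> \<dots> \<otimes> \<mu>\<^sub>m) \<circ> \<omega> \<circ> (\<delta>\<^sub>1 \<otimes> \<dots> \<otimes> \<delta>\<^sub>n)\<close>.\<close>

definition distributive_terms ::
  "('k::field, 'a) operad_data \<Rightarrow> ('k, 'c) operad_data \<Rightarrow> nat \<Rightarrow> nat \<Rightarrow> ('k, 'a, 'c) expr set" where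
  "distributive_terms A C n m =
     {Comp (Tens_list (map2 Oper ks \<mu>s)) (Comp \<omega> (Tens_list (map2 Coop ls \<delta>s)))
       | ks \<mu>s r \<omega> ls \<delta>s.
       length ks = m \<and> \<mu>s \<in> listset (map (ops A) ks) \<and>
       length ls = n \<and> \<delta>s \<in> listset (map (ops C) ls) \<and>
       sum_list ks = r \<and> sum_list ls = r \<and> \<omega> \<in> group_algebra r}"

definition distributive_relation where
  "distributive_relation A C n \<mu> m \<delta> r \<longleftrightarrow>
     (\<exists>es. set es \<subseteq> distributive_terms A C n m \<and>
           r = (Comp (Coop m \<delta>) (Oper n \<mu>), Sum_list n m es))"

definition all_distributive ::
  "('k::field, 'a) operad_data \<Rightarrow> ('k, 'c) operad_data \<Rightarrow>
   (('k, 'a, 'c) expr \<times> ('k, 'a, 'c) expr) set \<Rightarrow> bool" where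
  "all_distributive A C R \<longleftrightarrow>
     (\<forall>n m. \<forall>\<mu>\<in>ops A n. \<forall>\<delta>\<in>ops C m. \<exists>r\<in>R. distributive_relation A C n \<mu> m \<delta> r)"


section \<open>Free algebras\<close>

text \<open>
  \<open>A(V) = \<Oplus>\<^sub>n A(n) \<otimes>\<^bsub>S\<^sub>n\<^esub> V\<^sup>\<otimes>\<^sup>n\<close>.  The pair \<open>(\<mu>, [v\<^sub>1, \<dots>, v\<^sub>n])\<close> stands for \<open>\<mu> \<otimes> v\<^sub>1 \<otimes> \<dots> \<otimes> v\<^sub>n\<close>.
  The value \<open>n = 0\<close> is not excluded: its summand is zero when \<open>A(0) = 0\<close>.
\<close>

type_synonym ('k, 'a, 'v) free = "('a \<times> 'v list) \<Rightarrow>\<^sub>0 'k"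

definition free_reps ::
  "('k::field, 'a) operad_data \<Rightarrow> 'v set \<Rightarrow> ('k, 'a, 'v) free set" where
  "free_reps A V = {t. \<forall>(\<mu>, vs)\<in>Poly_Mapping.keys t. \<mu> \<in> ops A (length vs) \<and> set vs \<subseteq> V}"

definition free_null ::
  "('k::field, 'a::ab_group_add) operad_data \<Rightarrow> ('k \<Rightarrow> 'v \<Rightarrow> 'v) \<Rightarrow> 'v::ab_group_add set \<Rightarrow>
   ('k, 'a, 'v) free set" where
  "free_null A sV V = module.span fscale
     ({Poly_Mapping.single (\<mu> + \<nu>, vs) 1 - Poly_Mapping.single (\<mu>, vs) 1
         - Poly_Mapping.single (\<nu>, vs) 1 | \<mu> \<nu> vs.
         \<mu> \<in> ops A (length vs) \<and> \<nu> \<in> ops A (length vs) \<and> set vs \<subseteq> V} \<union>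
      {Poly_Mapping.single (oscale A a \<mu>, vs) 1 - Poly_Mapping.single (\<mu>, vs) a | a \<mu> vs.
         \<mu> \<in> ops A (length vs) \<and> set vs \<subseteq> V} \<union>
      {Poly_Mapping.single (\<mu>, us @ (x + y) # ws) 1 - Poly_Mapping.single (\<mu>, us @ x # ws) 1
         - Poly_Mapping.single (\<mu>, us @ y # ws) 1 | \<mu> us x y ws.
         \<mu> \<in> ops A (length us + 1 + length ws) \<and>
         set us \<subseteq> V \<and> x \<in> V \<and> y \<in> V \<and> set ws \<subseteq> V} \<union>
      {Poly_Mapping.single (\<mu>, us @ sV a x # ws) 1 - Poly_Mapping.single (\<mu>, us @ x # ws) a
         | \<mu> us a x ws.
         \<mu> \<in> ops A (length us + 1 + length ws) \<and> set us \<subseteq> V \<and> x \<in> V \<and> set ws \<subseteq> V} \<union>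
      {Poly_Mapping.single (oact A (length vs) \<sigma> \<mu>, vs) 1
         - Poly_Mapping.single (\<mu>, permute_list \<sigma> vs) 1 | \<sigma> \<mu> vs.
         \<sigma> permutes {..<length vs} \<and> \<mu> \<in> ops A (length vs) \<and> set vs \<subseteq> V})"

definition free_class ::
  "('k::field, 'a::ab_group_add) operad_data \<Rightarrow> ('k \<Rightarrow> 'v \<Rightarrow> 'v) \<Rightarrow> 'v::ab_group_add set \<Rightarrow>
   ('k, 'a, 'v) free \<Rightarrow> ('k, 'a, 'v) free" where
  "free_class A sV V = quot_rep fscale (free_null A sV V)"

definition free_space ::
  "('k::field, 'a::ab_group_add) operad_data \<Rightarrow> ('k \<Rightarrow> 'v \<Rightarrow> 'v) \<Rightarrow> 'v::ab_group_add set \<Rightarrow>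
   ('k, 'a, 'v) free set" where
  "free_space A sV V = free_class A sV V ` free_reps A V"

text \<open>
  \<open>\<mu>(\<nu>\<^sub>1 \<otimes> w\<^sub>1, \<dots>, \<nu>\<^sub>n \<otimes> w\<^sub>n) = \<gamma>(\<mu>; \<nu>\<^sub>1, \<dots>, \<nu>\<^sub>n) \<otimes> w\<^sub>1 \<dots> w\<^sub>n\<close>, extended multilinearly: the
  \<open>tensor_prod\<close> below expands the list of arguments into a combination of lists of basis vectors.
\<close>

definition free_op ::
  "('k::field, 'a::ab_group_add) operad_data \<Rightarrow> ('k \<Rightarrow> 'v \<Rightarrow> 'v) \<Rightarrow> 'v::ab_group_add set \<Rightarrow>
   'a \<Rightarrow> ('k, 'a, 'v) free list \<Rightarrow> ('k, 'a, 'v) free" where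
  "free_op A sV V \<mu> ts = free_class A sV V
     (fsum (\<lambda>bs. Poly_Mapping.single
              (ocomp A (map (length \<circ> snd) bs) \<mu> (map fst bs), concat (map snd bs)) 1)
           (tensor_prod (map (fsum (\<lambda>b. Poly_Mapping.single [b] 1)) ts)))"

definition free_map ::
  "('k::field, 'a::ab_group_add) operad_data \<Rightarrow> ('k \<Rightarrow> 'v \<Rightarrow> 'v) \<Rightarrow> 'v::ab_group_add set \<Rightarrow>
   ('v \<Rightarrow> 'v) \<Rightarrow> ('k, 'a, 'v) free \<Rightarrow> ('k, 'a, 'v) free" where
  \<comment> \<open>\<open>A(f) : A(V) \<rightarrow> A(W)\<close>\<close>
  "free_map A sV W f t =
     free_class A sV W (fsum (\<lambda>(\<mu>, vs). Poly_Mapping.single (\<mu>, map f vs) 1) t)"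

text \<open>
  A bialgebra structure on \<open>A(V)\<close>, functorial in \<open>V\<close>, extending its free algebra structure.  \<open>V\<close>
  ranges over all subspaces of the ambient vector space \<open>sV\<close>.
\<close>

definition functorial_free_bialgebra where
  "functorial_free_bialgebra A C R sV coF \<longleftrightarrow>
     (\<forall>V. module.subspace sV V \<longrightarrow>
        bialgebra A C R fscale (free_space A sV V) (free_op A sV V) (coF V)) \<and>
     (\<forall>V W f. module.subspace sV V \<and> module.subspace sV W \<and> linear_between sV V sV W f \<longrightarrow>
        bialgebra_hom A C R
          fscale (free_space A sV V) (free_op A sV V) (coF V)
          fscale (free_space A sV W) (free_op A sV W) (coF W) (free_map A sV W f))"

definition primitive_ops ::
  "('k::field, 'a::ab_group_add) operad_data \<Rightarrow> ('k, 'c::ab_group_add) operad_data \<Rightarrow>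
   ('k \<Rightarrow> 'v \<Rightarrow> 'v) \<Rightarrow>
   ('v::ab_group_add set \<Rightarrow> nat \<Rightarrow> 'c \<Rightarrow> ('k, 'a, 'v) free \<Rightarrow> (('k, 'a, 'v) free list \<Rightarrow>\<^sub>0 'k)) \<Rightarrow>
   nat \<Rightarrow> 'a set" where
  "primitive_ops A C sV coF n =
     {\<mu>\<in>ops A n. \<forall>xs. length xs = n \<and> distinct xs \<and> \<not> module.dependent sV (set xs) \<longrightarrow>
        (let V = module.span sV (set xs) in
         free_class A sV V (Poly_Mapping.single (\<mu>, xs) 1)
           \<in> primitive_part C fscale (free_space A sV V) (coF V))}"

end

theory Submission
  imports Defs
begin

text \<open>
  Let \<open>\<mu> \<in> A(n)\<close> and \<open>\<delta> \<in> C(m)\<close> with \<open>m \<ge> 2\<close>.  Evaluated at primitive elements, the right hand side of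
  the distributive relation for \<open>\<delta> \<circ> \<mu>\<close> involves only the cooperations of arity one, which are
  scalars, so \<open>\<delta>(\<mu>(y\<^sub>1, \<dots>, y\<^sub>n))\<close> is a combination of tensors of operations of \<open>A\<close> in the \<open>y\<^sub>i\<close> that does
  not depend on the bialgebra.  Algebra morphisms that map primitive arguments to primitive arguments
  therefore preserve the primitivity of \<open>\<mu>(y\<^sub>1, \<dots>, y\<^sub>n)\<close>.  This is applied to the morphism
  \<open>A(\<langle>x\<^sub>1, \<dots>, x\<^sub>n\<rangle>) \<rightarrow> H\<close> with \<open>x\<^sub>i \<mapsto> y\<^sub>i\<close>; the generators \<open>x\<^sub>i\<close> are primitive for reasons of weight.
  Hence \<open>\<mu>\<close> is primitive iff it preserves the primitive parts of all bialgebras, a condition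
  that is visibly stable under the operad structure.
\<close>

section \<open>Linear extensions\<close>

text \<open>The evaluation \<open>A(V) -> H\<close> at primitive elements is not known to respect
  cooperations, so primitivity cannot simply be pushed along it. What replaces this is that one and
  the same relation in \<open>R\<close> holds on both sides. Naturality is therefore split:
  composites of operations commute with an algebra morphism exactly, at the level of
  representatives, whereas cooperations at primitive elements do so only up to
  \<open>tensor_eq\<close>; multilinearity carries the latter through the former.

  The generators need an argument of their own, because the cooperations of \<open>A(V)\<close> are
  only assumed functorial. Multiplication by 2 on \<open>V\<close> serves as a grading operator,
  acting by \<open>2 ^ n\<close> on symbols of arity \<open>n\<close>. Separating 2 from
  \<open>2 ^ k\<close> for \<open>k \<ge> 2\<close> is where characteristic zero enters.

  "All bialgebras" would be a quantifier over types. The direction from primitive operations to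
  bialgebras is proved for an arbitrary carrier type; the converse tests only carriers in the type
  of the free algebras.\<close>

definition lincomb :: "('k::field \<Rightarrow> 'w \<Rightarrow> 'w) \<Rightarrow> ('b \<Rightarrow> 'w::ab_group_add) \<Rightarrow> ('b \<Rightarrow>\<^sub>0 'k) \<Rightarrow> 'w" where
  "lincomb s f p = (\<Sum>b\<in>Poly_Mapping.keys p. s (Poly_Mapping.lookup p b) (f b))"

lemma fsum_eq_lincomb: "fsum = lincomb fscale"
  by (simp add: fun_eq_iff fsum_def lincomb_def)

lemma lincomb_superset:
  assumes "vector_space s" "finite S" "Poly_Mapping.keys p \<subseteq> S"
  shows "lincomb s f p = (\<Sum>b\<in>S. s (Poly_Mapping.lookup p b) (f b))"
proof -
  interpret vector_space s by fact
  show ?thesis unfolding lincomb_def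
    by (rule sum.mono_neutral_left) (use assms(2,3) in \<open>auto simp: in_keys_iff\<close>)
qed

lemma linear_lincomb:
  fixes s :: "'k::field \<Rightarrow> 'w::ab_group_add \<Rightarrow> 'w" and f :: "'b \<Rightarrow> 'w"
  assumes "vector_space s"
  shows "Vector_Spaces.linear fscale s (lincomb s f)"
proof -
  interpret W: vector_space s by fact
  show ?thesis
    unfolding Vector_Spaces.linear_iff
  proof (intro conjI allI)
    show "vector_space (fscale :: 'k \<Rightarrow> ('b \<Rightarrow>\<^sub>0 'k) \<Rightarrow> _)" by (rule vector_space_fscale)
    show "vector_space s" by fact
  next
    fix p q :: "'b \<Rightarrow>\<^sub>0 'k"
    let ?S = "Poly_Mapping.keys p \<union> Poly_Mapping.keys q"
    have "lincomb s f (p + q) = (\<Sum>b\<in>?S. s (Poly_Mapping.lookup (p + q) b) (f b))"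
      by (rule lincomb_superset[OF assms]) (simp_all add: keys_add)
    moreover have "lincomb s f p = (\<Sum>b\<in>?S. s (Poly_Mapping.lookup p b) (f b))"
      "lincomb s f q = (\<Sum>b\<in>?S. s (Poly_Mapping.lookup q b) (f b))"
      by (simp_all add: lincomb_superset[OF assms])
    ultimately show "lincomb s f (p + q) = lincomb s f p + lincomb s f q"
      by (simp add: lookup_add W.scale_left_distrib sum.distrib)
  next
    fix a and p :: "'b \<Rightarrow>\<^sub>0 'k"
    have "Poly_Mapping.keys (fscale a p) \<subseteq> Poly_Mapping.keys p"
      by (auto simp: in_keys_iff lookup_fscale)
    hence "lincomb s f (fscale a p)
        = (\<Sum>b\<in>Poly_Mapping.keys p. s (Poly_Mapping.lookup (fscale a p) b) (f b))"
      by (simp add: lincomb_superset[OF assms])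
    thus "lincomb s f (fscale a p) = s a (lincomb s f p)"
      by (simp add: lookup_fscale lincomb_def W.scale_sum_right)
  qed
qed

lemma lincomb_single [simp]:
  assumes "vector_space s"
  shows "lincomb s f (Poly_Mapping.single b a) = s a (f b)"
proof -
  interpret vector_space s by fact
  show ?thesis by (simp add: lincomb_def)
qed

lemma linear_lincomb_eq:
  assumes "Vector_Spaces.linear s s' L"
  shows "L (lincomb s f p) = lincomb s' (\<lambda>b. L (f b)) p"
proof -
  interpret L: Vector_Spaces.linear s s' L by fact
  show ?thesis by (simp add: lincomb_def L.sum L.scale)
qed

lemma lincomb_cong:
  "(\<And>b. b \<in> Poly_Mapping.keys p \<Longrightarrow> f b = g b) \<Longrightarrow> lincomb s f p = lincomb s g p"
  by (simp add: lincomb_def)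

lemma lincomb_mem:
  assumes "vector_space s" "module.subspace s N" "\<And>b. b \<in> Poly_Mapping.keys p \<Longrightarrow> f b \<in> N"
  shows "lincomb s f p \<in> N"
proof -
  interpret vector_space s by fact
  show ?thesis unfolding lincomb_def
    by (intro subspace_sum[OF assms(2)] subspace_scale[OF assms(2)] assms(3))
qed

lemma lincomb_swap:
  assumes "vector_space s"
  shows "lincomb s (\<lambda>b. lincomb s (\<lambda>c. f b c) q) p = lincomb s (\<lambda>c. lincomb s (\<lambda>b. f b c) p) q"
proof -
  interpret vector_space s by fact
  show ?thesis unfolding lincomb_def
    by (simp add: scale_sum_right mult.commute) (rule sum.swap)
qed

lemma lincomb_fun_diff:
  assumes "vector_space s"
  shows "lincomb s (\<lambda>b. f b - g b) p = lincomb s f p - lincomb s g p"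
proof -
  interpret vector_space s by fact
  show ?thesis by (simp add: lincomb_def scale_right_diff_distrib sum_subtractf)
qed

lemma fscale_single [simp]: "fscale a (Poly_Mapping.single b c) = Poly_Mapping.single b (a * c)"
  by (rule poly_mapping_eqI) (simp add: lookup_fscale lookup_single when_def)

lemma fscale_simps [simp]:
  "fscale 1 p = p" "fscale 0 p = 0" "fscale a 0 = 0" "fscale a (fscale b p) = fscale (a * b) p"
  by (auto intro!: poly_mapping_eqI simp: lookup_fscale)

lemma linear_fsum: "Vector_Spaces.linear fscale fscale (fsum f)"
  unfolding fsum_eq_lincomb by (rule linear_lincomb[OF vector_space_fscale])

lemma fsum_single [simp]: "fsum f (Poly_Mapping.single b a) = fscale a (f b)"
  unfolding fsum_eq_lincomb by (rule lincomb_single[OF vector_space_fscale])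

lemma fsum_fsum: "fsum f (fsum g p) = fsum (\<lambda>b. fsum f (g b)) p"
  using linear_lincomb_eq[OF linear_fsum, of f g p] by (simp add: fsum_eq_lincomb)

lemma lincomb_fsum:
  "vector_space s \<Longrightarrow> lincomb s f (fsum g p) = lincomb s (\<lambda>b. lincomb s f (g b)) p"
  unfolding fsum_eq_lincomb by (rule linear_lincomb_eq[OF linear_lincomb])

lemma fsum_cong: "(\<And>b. b \<in> Poly_Mapping.keys p \<Longrightarrow> f b = g b) \<Longrightarrow> fsum f p = fsum g p"
  unfolding fsum_eq_lincomb by (rule lincomb_cong)

lemma fsum_mem:
  "\<lbrakk>module.subspace fscale N; \<And>b. b \<in> Poly_Mapping.keys p \<Longrightarrow> f b \<in> N\<rbrakk> \<Longrightarrow> fsum f p \<in> N"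
  unfolding fsum_eq_lincomb by (rule lincomb_mem[OF vector_space_fscale])

lemma fsum_ident: "fsum (\<lambda>b. Poly_Mapping.single b 1) p = p"
  by (rule poly_mapping_eqI)
    (simp add: fsum_def lookup_sum lookup_single when_def in_keys_iff)

lemma fsum_simps [simp]:
  "fsum f 0 = 0" "fsum f (p + q) = fsum f p + fsum f q" "fsum f (p - q) = fsum f p - fsum f q"
  "fsum f (fscale a p) = fscale a (fsum f p)"
proof -
  interpret Vector_Spaces.linear fscale fscale "fsum f" by (rule linear_fsum)
  show "fsum f 0 = 0" "fsum f (p + q) = fsum f p + fsum f q" "fsum f (p - q) = fsum f p - fsum f q"
    "fsum f (fscale a p) = fscale a (fsum f p)"
    by (rule zero add diff scale)+
qed

lemma fsum_fun_diff: "fsum (\<lambda>b. f b - g b) p = fsum f p - fsum g p"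
  unfolding fsum_eq_lincomb by (rule lincomb_fun_diff[OF vector_space_fscale])

lemma fscale_add: "fscale a (p + q) = fscale a p + fscale a q"
  and fscale_diff: "fscale a (p - q) = fscale a p - fscale a q"
  by (auto intro!: poly_mapping_eqI simp: lookup_fscale lookup_add lookup_minus algebra_simps)

text \<open>The preimage of a subspace under a linear map is a subspace. Tensor powers and free
  algebras are both quotients by spans of relations, so checks of well-definedness reduce to
  generators through this.\<close>

lemma linear_span_mem:
  assumes "Vector_Spaces.linear s s' L" "module.subspace s' N" "\<And>x. x \<in> G \<Longrightarrow> L x \<in> N"
    "z \<in> module.span s G"
  shows "L z \<in> N"
proof -
  interpret L: Vector_Spaces.linear s s' L by fact
  have "L.vs1.subspace {x. L x \<in> N}"
    using assms(2) by (auto simp: L.vs1.subspace_def L.vs2.subspace_def L.add L.scale L.zero)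
  thus ?thesis using L.vs1.span_minimal[of G "{x. L x \<in> N}"] assms(3,4) by blast
qed

section \<open>Tensor powers\<close>

lemma subspace_tensor_null: "module.subspace fscale (tensor_null s H)"
proof -
  interpret vector_space fscale by (rule vector_space_fscale)
  show ?thesis unfolding tensor_null_def by (rule subspace_span)
qed

lemma tensor_null_simps:
  "0 \<in> tensor_null s H"
  "t \<in> tensor_null s H \<Longrightarrow> u \<in> tensor_null s H \<Longrightarrow> t + u \<in> tensor_null s H"
  "t \<in> tensor_null s H \<Longrightarrow> u \<in> tensor_null s H \<Longrightarrow> t - u \<in> tensor_null s H"
  "t \<in> tensor_null s H \<Longrightarrow> fscale a t \<in> tensor_null s H"
proof -
  interpret vector_space fscale by (rule vector_space_fscale)
  note S = subspace_tensor_null[of s H]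
  show "0 \<in> tensor_null s H"
    "t \<in> tensor_null s H \<Longrightarrow> u \<in> tensor_null s H \<Longrightarrow> t + u \<in> tensor_null s H"
    "t \<in> tensor_null s H \<Longrightarrow> u \<in> tensor_null s H \<Longrightarrow> t - u \<in> tensor_null s H"
    "t \<in> tensor_null s H \<Longrightarrow> fscale a t \<in> tensor_null s H"
    using subspace_0[OF S] subspace_add[OF S] subspace_diff[OF S] subspace_scale[OF S] by auto
qed

lemma tensor_eq_refl [simp]: "tensor_eq s H t t"
  by (simp add: tensor_eq_def tensor_null_simps)

lemma tensor_eq_sym: "tensor_eq s H t u \<Longrightarrow> tensor_eq s H u t"
  unfolding tensor_eq_def using tensor_null_simps(3)[OF tensor_null_simps(1)] by fastforce

lemma tensor_eq_trans [trans]: "tensor_eq s H t u \<Longrightarrow> tensor_eq s H u v \<Longrightarrow> tensor_eq s H t v"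
  unfolding tensor_eq_def using tensor_null_simps(2) by fastforce

lemma tensor_eq_add:
  "tensor_eq s H t t' \<Longrightarrow> tensor_eq s H u u' \<Longrightarrow> tensor_eq s H (t + u) (t' + u')"
  unfolding tensor_eq_def using tensor_null_simps(2) by (fastforce simp: algebra_simps)

lemma tensor_eq_scale:
  "tensor_eq s H t t' \<Longrightarrow> tensor_eq s H (fscale a t) (fscale a t')"
  unfolding tensor_eq_def using tensor_null_simps(4) by (fastforce simp: fscale_diff[symmetric])

lemma tensor_null_add_gen:
  assumes "set us \<subseteq> H" "x \<in> H" "y \<in> H" "set ws \<subseteq> H"
  shows "Poly_Mapping.single (us @ (x + y) # ws) 1 - Poly_Mapping.single (us @ x # ws) 1
         - Poly_Mapping.single (us @ y # ws) 1 \<in> tensor_null s H"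
proof -
  interpret vector_space fscale by (rule vector_space_fscale)
  show ?thesis unfolding tensor_null_def by (rule span_base) (use assms in blast)
qed

lemma tensor_null_scale_gen:
  assumes "set us \<subseteq> H" "x \<in> H" "set ws \<subseteq> H"
  shows "Poly_Mapping.single (us @ s a x # ws) 1 - Poly_Mapping.single (us @ x # ws) a
         \<in> tensor_null s H"
proof -
  interpret vector_space fscale by (rule vector_space_fscale)
  show ?thesis unfolding tensor_null_def by (rule span_base) (use assms in blast)
qed

lemma linear_tensor_null:
  assumes "Vector_Spaces.linear fscale sW L" "module.subspace sW N" "z \<in> tensor_null s H"
    and "\<And>us x y ws. \<lbrakk>set us \<subseteq> H; x \<in> H; y \<in> H; set ws \<subseteq> H\<rbrakk> \<Longrightarrow>
      L (Poly_Mapping.single (us @ (x + y) # ws) 1 - Poly_Mapping.single (us @ x # ws) 1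
         - Poly_Mapping.single (us @ y # ws) 1) \<in> N"
    and "\<And>us a x ws. \<lbrakk>set us \<subseteq> H; x \<in> H; set ws \<subseteq> H\<rbrakk> \<Longrightarrow>
      L (Poly_Mapping.single (us @ s a x # ws) 1 - Poly_Mapping.single (us @ x # ws) a) \<in> N"
  shows "L z \<in> N"
  by (rule linear_span_mem[OF assms(1,2) _ assms(3)[unfolded tensor_null_def]])
    (use assms(4,5) in blast)

text \<open>
  Words of all lengths live in one type, and \<open>tensor_null\<close> mixes the relations of all lengths.
  Hence multilinearity is only demanded for the words of a given length \<open>r\<close>.
\<close>

definition multilinear_mod ::
  "('k::field \<Rightarrow> 'h \<Rightarrow> 'h) \<Rightarrow> 'h::ab_group_add set \<Rightarrow> nat \<Rightarrow> ('k \<Rightarrow> 'w \<Rightarrow> 'w) \<Rightarrow> 'w::ab_group_add set \<Rightarrow>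
   ('h list \<Rightarrow> 'w) \<Rightarrow> bool" where
  "multilinear_mod s H r sW N f \<longleftrightarrow>
     (\<forall>us x y ws a. length us + 1 + length ws = r \<and> set us \<subseteq> H \<and> x \<in> H \<and> y \<in> H \<and> set ws \<subseteq> H \<longrightarrow>
        f (us @ (x + y) # ws) - f (us @ x # ws) - f (us @ y # ws) \<in> N \<and>
        f (us @ s a x # ws) - sW a (f (us @ x # ws)) \<in> N)"

lemma lincomb_tensor_null:
  assumes "vector_space sW" "module.subspace sW N" "multilinear_mod s H r sW N f"
    and "z \<in> tensor_null s H" "\<And>w. w \<in> Poly_Mapping.keys z \<Longrightarrow> length w = r"
  shows "lincomb sW f z \<in> N"
proof -
  interpret W: vector_space sW by fact
  \<comment> \<open>\<open>tensor_null\<close> contains relations in every length, and nothing is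
    known of \<open>f\<close> outside length \<open>r\<close>. Cutting \<open>f\<close> off there
    sends the other relations to 0; on the words of \<open>z\<close> the cut changes
    nothing.\<close>
  let ?f = "\<lambda>w. if length w = r then f w else 0"
  interpret L: Vector_Spaces.linear fscale sW "lincomb sW ?f" by (rule linear_lincomb) fact
  have "lincomb sW ?f z \<in> N"
    by (rule linear_tensor_null[OF linear_lincomb assms(2,4)])
      (use assms(1,3) W.subspace_0[OF assms(2)] in \<open>auto simp: L.diff multilinear_mod_def\<close>)
  also have "lincomb sW ?f z = lincomb sW f z"
    by (rule lincomb_cong) (simp add: assms(5))
  finally show ?thesis .
qed

lemma subspace_tensor_reps: "module.subspace fscale (tensor_reps H n)"
proof -
  interpret vector_space fscale by (rule vector_space_fscale)
  show ?thesis
  proof (rule subspaceI)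
    show "0 \<in> tensor_reps H n" by (simp add: tensor_reps_def)
  next
    fix t u :: "'b list \<Rightarrow>\<^sub>0 'a" assume "t \<in> tensor_reps H n" "u \<in> tensor_reps H n"
    thus "t + u \<in> tensor_reps H n" unfolding tensor_reps_def using keys_add[of t u] by blast
  next
    fix a and t :: "'b list \<Rightarrow>\<^sub>0 'a" assume "t \<in> tensor_reps H n"
    thus "fscale a t \<in> tensor_reps H n" by (simp add: tensor_reps_def in_keys_iff lookup_fscale)
  qed
qed

lemma tensor_reps_simps:
  "0 \<in> tensor_reps H n"
  "t \<in> tensor_reps H n \<Longrightarrow> u \<in> tensor_reps H n \<Longrightarrow> t + u \<in> tensor_reps H n"
  "t \<in> tensor_reps H n \<Longrightarrow> u \<in> tensor_reps H n \<Longrightarrow> t - u \<in> tensor_reps H n"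
  "t \<in> tensor_reps H n \<Longrightarrow> fscale a t \<in> tensor_reps H n"
proof -
  interpret vector_space fscale by (rule vector_space_fscale)
  note S = subspace_tensor_reps[of H n]
  show "0 \<in> tensor_reps H n"
    "t \<in> tensor_reps H n \<Longrightarrow> u \<in> tensor_reps H n \<Longrightarrow> t + u \<in> tensor_reps H n"
    "t \<in> tensor_reps H n \<Longrightarrow> u \<in> tensor_reps H n \<Longrightarrow> t - u \<in> tensor_reps H n"
    "t \<in> tensor_reps H n \<Longrightarrow> fscale a t \<in> tensor_reps H n"
    using subspace_0[OF S] subspace_add[OF S] subspace_diff[OF S] subspace_scale[OF S] by auto
qed

lemma single_in_tensor_reps:
  "length w = n \<Longrightarrow> set w \<subseteq> H \<Longrightarrow> Poly_Mapping.single w a \<in> tensor_reps H n"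
  by (auto simp: tensor_reps_def)

lemma tensor_repsD:
  "t \<in> tensor_reps H n \<Longrightarrow> w \<in> Poly_Mapping.keys t \<Longrightarrow> length w = n \<and> set w \<subseteq> H"
  by (auto simp: tensor_reps_def)

text \<open>Descent of a map on words to tensor powers. Both tensors are representatives of the same
  degree \<open>r\<close>, so that their difference is supported on words of length
  \<open>r\<close>.\<close>

lemma fsum_tensor_eq:
  assumes "multilinear_mod s H r fscale (tensor_null s' H') f" "tensor_eq s H t u"
    "t \<in> tensor_reps H r" "u \<in> tensor_reps H r"
  shows "tensor_eq s' H' (fsum f t) (fsum f u)"
proof -
  have "fsum f (t - u) \<in> tensor_null s' H'" unfolding fsum_eq_lincomb
    by (rule lincomb_tensor_null[OF vector_space_fscale subspace_tensor_null assms(1)])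
      (use assms(2,3,4) tensor_reps_simps(3) tensor_repsD in \<open>unfold tensor_eq_def, blast+\<close>)
  thus ?thesis by (simp add: tensor_eq_def)
qed

section \<open>Products of tensors\<close>

lemma tensor_mult_single [simp]:
  "tensor_mult (Poly_Mapping.single v a) (Poly_Mapping.single w b) = Poly_Mapping.single (v @ w) (a * b)"
  by (simp add: tensor_mult_def)

lemma tensor_mult_simps [simp]:
  "tensor_mult 0 u = 0" "tensor_mult (t + t') u = tensor_mult t u + tensor_mult t' u"
  "tensor_mult (t - t') u = tensor_mult t u - tensor_mult t' u"
  "tensor_mult (fscale a t) u = fscale a (tensor_mult t u)"
  by (simp_all add: tensor_mult_def)

text \<open>Expanding the right factor first makes linearity in that factor an instance of linearity
  of \<open>fsum\<close>.\<close>

lemma tensor_mult_swap: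
  "tensor_mult t u = fsum (\<lambda>w. fsum (\<lambda>v. Poly_Mapping.single (v @ w) 1) t) u"
  unfolding tensor_mult_def fsum_eq_lincomb by (rule lincomb_swap[OF vector_space_fscale])

lemma tensor_mult_simps_right [simp]:
  "tensor_mult t 0 = 0" "tensor_mult t (u + u') = tensor_mult t u + tensor_mult t u'"
  "tensor_mult t (u - u') = tensor_mult t u - tensor_mult t u'"
  "tensor_mult t (fscale a u) = fscale a (tensor_mult t u)"
  by (simp_all add: tensor_mult_swap)

lemma tensor_mult_reps:
  "t \<in> tensor_reps H m \<Longrightarrow> u \<in> tensor_reps H n \<Longrightarrow> tensor_mult t u \<in> tensor_reps H (m + n)"
  unfolding tensor_mult_def
  by (intro fsum_mem subspace_tensor_reps single_in_tensor_reps) (auto dest!: tensor_repsD)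

lemma linear_tensor_mult:
  "Vector_Spaces.linear fscale fscale (\<lambda>t. tensor_mult t u)"
  "Vector_Spaces.linear fscale fscale (\<lambda>u. tensor_mult t u)"
  unfolding tensor_mult_def[of _ u] tensor_mult_swap[of t] by (rule linear_fsum)+

text \<open>Appending a word to a generating relation only lengthens its tail \<open>ws\<close>, so
  the result is again a generating relation; the letters of \<open>u\<close> must lie in
  \<open>H\<close> for this.\<close>

lemma tensor_mult_null_left:
  assumes "z \<in> tensor_null s H" "u \<in> tensor_reps H n"
  shows "tensor_mult z u \<in> tensor_null s H"
proof (rule linear_tensor_null[OF linear_tensor_mult(1) subspace_tensor_null assms(1)])
  fix us x y ws assume H: "set us \<subseteq> H" "x \<in> H" "y \<in> H" "set ws \<subseteq> H"
  have "fsum (\<lambda>w. Poly_Mapping.single (us @ (x + y) # ws @ w) 1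
      - Poly_Mapping.single (us @ x # ws @ w) 1 - Poly_Mapping.single (us @ y # ws @ w) 1) u
      \<in> tensor_null s H"
    by (intro fsum_mem subspace_tensor_null tensor_null_add_gen)
      (use H tensor_repsD[OF assms(2)] in auto)
  thus "tensor_mult (Poly_Mapping.single (us @ (x + y) # ws) 1 - Poly_Mapping.single (us @ x # ws) 1
         - Poly_Mapping.single (us @ y # ws) 1) u \<in> tensor_null s H"
    by (simp add: tensor_mult_def fsum_fun_diff)
next
  fix us a x ws assume H: "set us \<subseteq> H" "x \<in> H" "set ws \<subseteq> H"
  have "fsum (\<lambda>w. Poly_Mapping.single (us @ s a x # ws @ w) 1
      - Poly_Mapping.single (us @ x # ws @ w) a) u \<in> tensor_null s H"
    by (intro fsum_mem subspace_tensor_null tensor_null_scale_gen)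
      (use H tensor_repsD[OF assms(2)] in auto)
  thus "tensor_mult (Poly_Mapping.single (us @ s a x # ws) 1 - Poly_Mapping.single (us @ x # ws) a) u
      \<in> tensor_null s H"
    by (simp add: tensor_mult_swap fsum_fun_diff)
qed

lemma tensor_mult_null_right:
  assumes "z \<in> tensor_null s H" "u \<in> tensor_reps H n"
  shows "tensor_mult u z \<in> tensor_null s H"
proof (rule linear_tensor_null[OF linear_tensor_mult(2) subspace_tensor_null assms(1)])
  fix us x y ws assume H: "set us \<subseteq> H" "x \<in> H" "y \<in> H" "set ws \<subseteq> H"
  have "fsum (\<lambda>w. Poly_Mapping.single ((w @ us) @ (x + y) # ws) 1
      - Poly_Mapping.single ((w @ us) @ x # ws) 1 - Poly_Mapping.single ((w @ us) @ y # ws) 1) u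
      \<in> tensor_null s H"
    by (intro fsum_mem subspace_tensor_null tensor_null_add_gen)
      (use H tensor_repsD[OF assms(2)] in auto)
  thus "tensor_mult u (Poly_Mapping.single (us @ (x + y) # ws) 1 - Poly_Mapping.single (us @ x # ws) 1
         - Poly_Mapping.single (us @ y # ws) 1) \<in> tensor_null s H"
    by (simp add: tensor_mult_def fsum_fun_diff)
next
  fix us a x ws assume H: "set us \<subseteq> H" "x \<in> H" "set ws \<subseteq> H"
  have "fsum (\<lambda>w. Poly_Mapping.single ((w @ us) @ s a x # ws) 1
      - Poly_Mapping.single ((w @ us) @ x # ws) a) u \<in> tensor_null s H"
    by (intro fsum_mem subspace_tensor_null tensor_null_scale_gen)
      (use H tensor_repsD[OF assms(2)] in auto)
  thus "tensor_mult u (Poly_Mapping.single (us @ s a x # ws) 1 - Poly_Mapping.single (us @ x # ws) a)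
      \<in> tensor_null s H"
    by (simp add: tensor_mult_def fsum_fun_diff)
qed

text \<open>Telescoping: \<open>t u - t' u' = (t - t') u + t' (u - u')\<close>. Hence
  representatives are asked for only in the factors \<open>u\<close> and \<open>t'\<close>.\<close>

lemma tensor_eq_mult:
  assumes "tensor_eq s H t t'" "tensor_eq s H u u'" "t' \<in> tensor_reps H m" "u \<in> tensor_reps H n"
  shows "tensor_eq s H (tensor_mult t u) (tensor_mult t' u')"
proof -
  have "tensor_mult (t - t') u \<in> tensor_null s H" "tensor_mult t' (u - u') \<in> tensor_null s H"
    using assms tensor_mult_null_left tensor_mult_null_right unfolding tensor_eq_def by blast+
  from tensor_null_simps(2)[OF this] show ?thesis by (simp add: tensor_eq_def)
qed

section \<open>Tensors under linear maps\<close>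

lemma tensor_map_single [simp]:
  "tensor_map f (Poly_Mapping.single w a) = Poly_Mapping.single (map f w) a"
  by (simp add: tensor_map_def)

lemma tensor_map_simps [simp]:
  "tensor_map f 0 = 0" "tensor_map f (t + u) = tensor_map f t + tensor_map f u"
  "tensor_map f (t - u) = tensor_map f t - tensor_map f u"
  "tensor_map f (fscale a t) = fscale a (tensor_map f t)"
  by (simp_all add: tensor_map_def)

lemma tensor_map_fsum: "tensor_map f (fsum g t) = fsum (\<lambda>w. tensor_map f (g w)) t"
  by (simp add: tensor_map_def fsum_fsum)

lemma fsum_tensor_map: "fsum g (tensor_map f t) = fsum (\<lambda>w. g (map f w)) t"
  by (simp add: tensor_map_def fsum_fsum)

lemma tensor_map_mult:
  "tensor_map f (tensor_mult t u) = tensor_mult (tensor_map f t) (tensor_map f u)"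
  unfolding tensor_mult_def by (simp add: tensor_map_fsum fsum_tensor_map)

lemma tensor_map_reps:
  "f ` X \<subseteq> Y \<Longrightarrow> t \<in> tensor_reps X n \<Longrightarrow> tensor_map f t \<in> tensor_reps Y n"
  unfolding tensor_map_def
  by (intro fsum_mem subspace_tensor_reps single_in_tensor_reps) (auto dest!: tensor_repsD)

lemma tensor_map_null:
  assumes f: "linear_between s X s' Y f" and z: "z \<in> tensor_null s X"
  shows "tensor_map f z \<in> tensor_null s' Y"
proof -
  have fX: "f x \<in> Y" if "x \<in> X" for x using f that by (auto simp: linear_between_def)
  have add: "f (x + y) = f x + f y" if "x \<in> X" "y \<in> X" for x y
    using f that by (auto simp: linear_between_def)
  have scale: "f (s a x) = s' a (f x)" if "x \<in> X" for a x
    using f that by (auto simp: linear_between_def)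
  show ?thesis
  proof (rule linear_tensor_null[OF _ subspace_tensor_null z])
    show "Vector_Spaces.linear fscale fscale (tensor_map f :: (_ \<Rightarrow>\<^sub>0 'a) \<Rightarrow> _)"
      unfolding tensor_map_def by (rule linear_fsum)
  next
    fix us x y ws assume H: "set us \<subseteq> X" "x \<in> X" "y \<in> X" "set ws \<subseteq> X"
    show "tensor_map f (Poly_Mapping.single (us @ (x + y) # ws) 1 - Poly_Mapping.single (us @ x # ws) 1
         - Poly_Mapping.single (us @ y # ws) 1) \<in> tensor_null s' Y"
      by (simp add: add H, intro tensor_null_add_gen) (use H fX in auto)
  next
    fix us a x ws assume H: "set us \<subseteq> X" "x \<in> X" "set ws \<subseteq> X"
    show "tensor_map f (Poly_Mapping.single (us @ s a x # ws) 1 - Poly_Mapping.single (us @ x # ws) a)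
        \<in> tensor_null s' Y"
      by (simp add: scale H, intro tensor_null_scale_gen) (use H fX in auto)
  qed
qed

lemma tensor_map_eq:
  assumes "linear_between s X s' Y f" "tensor_eq s X t u"
  shows "tensor_eq s' Y (tensor_map f t) (tensor_map f u)"
  using tensor_map_null[OF assms(1), of "t - u"] assms(2) by (simp add: tensor_eq_def)

section \<open>Operations, cooperations and their composites\<close>

lemma listset_iff: "xs \<in> listset Ls \<longleftrightarrow> list_all2 (\<in>) xs Ls"
proof (induction Ls arbitrary: xs)
  case (Cons L Ls)
  thus ?case by (cases xs) (auto simp: set_Cons_def)
qed simp

lemma listset_replicate: "xs \<in> listset (replicate n H) \<longleftrightarrow> length xs = n \<and> set xs \<subseteq> H"
  by (auto simp: listset_iff list_all2_conv_all_nth in_set_conv_nth subset_iff)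

lemma opn_mem:
  "\<lbrakk>operad_algebra A s H opn; \<mu> \<in> ops A (length w); set w \<subseteq> H\<rbrakk> \<Longrightarrow> opn \<mu> w \<in> H"
  using operad_algebra.opn_linear[of A s H opn w] by (auto simp: linear_between_def)

text \<open>Multilinearity of operations is axiomatized through list updates; the slot form
  \<open>us @ x # ws\<close> is the shape of the relations in \<open>tensor_null\<close> and
  \<open>free_null\<close>.\<close>

lemma opn_add:
  assumes "operad_algebra A s H opn" "\<mu> \<in> ops A (length us + 1 + length ws)"
    and "set us \<subseteq> H" "x \<in> H" "y \<in> H" "set ws \<subseteq> H"
  shows "opn \<mu> (us @ (x + y) # ws) = opn \<mu> (us @ x # ws) + opn \<mu> (us @ y # ws)"
proof -
  let ?n = "length us + 1 + length ws"
  have m: "multilinear_on s (replicate ?n H) s (opn \<mu>)"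
    using operad_algebra.opn_multilinear[OF assms(1,2)] .
  have "us @ x # ws \<in> listset (replicate ?n H)" using assms by (simp only: listset_replicate) auto
  moreover have "length us < ?n" "replicate ?n H ! length us = H" by (simp_all del: replicate_Suc add: nth_replicate)
  ultimately have "opn \<mu> ((us @ x # ws)[length us := (us @ x # ws) ! length us + y])
      = opn \<mu> (us @ x # ws) + opn \<mu> ((us @ x # ws)[length us := y])"
    using m assms(5) unfolding multilinear_on_def length_replicate by metis
  thus ?thesis by simp
qed

lemma opn_scale:
  assumes "operad_algebra A s H opn" "\<mu> \<in> ops A (length us + 1 + length ws)"
    and "set us \<subseteq> H" "x \<in> H" "set ws \<subseteq> H"
  shows "opn \<mu> (us @ s a x # ws) = s a (opn \<mu> (us @ x # ws))"
proof -
  let ?n = "length us + 1 + length ws"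
  have m: "multilinear_on s (replicate ?n H) s (opn \<mu>)"
    using operad_algebra.opn_multilinear[OF assms(1,2)] .
  have "us @ x # ws \<in> listset (replicate ?n H)" using assms by (simp only: listset_replicate) auto
  moreover have "length us < ?n" "replicate ?n H ! length us = H" by (simp_all del: replicate_Suc add: nth_replicate)
  ultimately have "opn \<mu> ((us @ x # ws)[length us := s a ((us @ x # ws) ! length us)])
      = s a (opn \<mu> (us @ x # ws))"
    using m assms(4) unfolding multilinear_on_def length_replicate by metis
  thus ?thesis by simp
qed

text \<open>Type soundness of expressions. It supplies the degree conditions of
  \<open>fsum_tensor_eq\<close> and \<open>tensor_eq_mult\<close>.\<close>

lemma interp_reps:
  assumes "operad_algebra A s H opn" "operad_coalgebra C s H coop"
    and "well_formed A C e" "length w = source e" "set w \<subseteq> H"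
  shows "interp opn coop e w \<in> tensor_reps H (target e)"
  using assms(3-)
proof (induction e arbitrary: w)
  case (Oper n \<mu>)
  thus ?case using opn_mem[OF assms(1)] by (auto intro: single_in_tensor_reps)
next
  case (Coop n \<delta>)
  then obtain x where "w = [x]" "x \<in> H" by (auto simp: length_Suc_conv)
  thus ?case using operad_coalgebra.coop_mem[OF assms(2)] Coop by simp
next
  case (Perm n \<sigma>)
  hence "inv \<sigma> permutes {..<length w}" by (simp add: permutes_inv)
  hence "set (permute_list (inv \<sigma>) w) = set w" by (rule set_permute_list)
  thus ?case using Perm by (simp add: tensor_perm_def single_in_tensor_reps)
next
  case (Tens e f)
  have "set (take (source e) w) \<subseteq> H" "set (drop (source e) w) \<subseteq> H"
    using Tens.prems(3) set_take_subset set_drop_subset by fast+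
  thus ?case using Tens by (auto intro!: tensor_mult_reps)
next
  case (Comp e f)
  hence f: "interp opn coop f w \<in> tensor_reps H (target f)" by simp
  show ?case
    by simp (rule fsum_mem[OF subspace_tensor_reps], use Comp tensor_repsD[OF f] in simp)
qed (auto intro: tensor_reps_simps)

text \<open>A permutation moves the distinguished slot to position
  \<open>inv \<tau> (length us)\<close> and arranges the other entries independently of what fills
  the slot. Relations in one slot thus become relations in another.\<close>

lemma permute_list_slot:
  assumes "\<tau> permutes {..<n}" "n = length us + 1 + length ws"
  obtains us' ws' where "\<And>z. permute_list \<tau> (us @ z # ws) = us' @ z # ws'"
    "set us' \<subseteq> set us \<union> set ws" "set ws' \<subseteq> set us \<union> set ws" "length us' + 1 + length ws' = n"
proof -
  define i where "i = length us"
  define j where "j = inv \<tau> i"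
  have \<tau>j: "\<tau> j = i" unfolding j_def using assms(1) by (simp add: permutes_inverses)
  have "i < n" using assms(2) i_def by simp
  hence jn: "j < n" unfolding j_def using permutes_in_image[OF permutes_inv[OF assms(1)], of i] by simp
  \<comment> \<open>\<open>g\<close> reads the word with the slot removed, so indices beyond the
    slot shift down by one.\<close>
  define g where "g k = (us @ ws) ! (if \<tau> k < i then \<tau> k else \<tau> k - 1)" for k
  have nth: "(us @ z # ws) ! \<tau> k = (if k = j then z else g k)" for z k
  proof (cases "k = j")
    case False
    hence "\<tau> k \<noteq> i" using \<tau>j permutes_inj[OF assms(1)] by (metis injD)
    thus ?thesis using False by (auto simp: g_def i_def nth_append nth_Cons')
  qed (use \<tau>j i_def in simp)
  have g: "g k \<in> set us \<union> set ws" if "k < n" "k \<noteq> j" for k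
  proof -
    have "\<tau> k \<noteq> i" using that \<tau>j permutes_inj[OF assms(1)] by (metis injD)
    moreover have "\<tau> k < n" using permutes_in_image[OF assms(1), of k] that by simp
    ultimately have "(if \<tau> k < i then \<tau> k else \<tau> k - 1) < length (us @ ws)"
      using assms(2) i_def by auto
    thus ?thesis unfolding g_def set_append[symmetric] by (rule nth_mem)
  qed
  have upt: "[0..<n] = [0..<j] @ j # [Suc j..<n]"
    using jn by (metis le_add_diff_inverse less_or_eq_imp_le upt_add_eq_append upt_conv_Cons zero_le)
  show thesis
  proof
    fix z
    have "permute_list \<tau> (us @ z # ws) = map (\<lambda>k. (us @ z # ws) ! \<tau> k) [0..<n]"
      by (simp add: permute_list_def assms(2))
    also have "\<dots> = map g [0..<j] @ z # map g [Suc j..<n]"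
      unfolding nth upt by simp
    finally show "permute_list \<tau> (us @ z # ws) = map g [0..<j] @ z # map g [Suc j..<n]" .
    show "set (map g [0..<j]) \<subseteq> set us \<union> set ws" "set (map g [Suc j..<n]) \<subseteq> set us \<union> set ws"
      unfolding set_map by (rule image_subsetI, rule g, use jn in simp_all)+
  qed (use jn in simp)
qed

text \<open>Cooperations are excluded because \<open>coop\<close> only chooses representatives, and
  an algebra morphism need not respect it. Without them \<open>interp\<close> is natural in the
  strict sense.\<close>

fun operational :: "('k, 'a, 'c) expr \<Rightarrow> bool" where
  "operational (Coop n \<delta>) \<longleftrightarrow> False"
| "operational (Tens e f) \<longleftrightarrow> operational e \<and> operational f"
| "operational (Comp e f) \<longleftrightarrow> operational e \<and> operational f"
| "operational (Add e f) \<longleftrightarrow> operational e \<and> operational f"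
| "operational (Scale a e) \<longleftrightarrow> operational e"
| "operational _ \<longleftrightarrow> True"

text \<open>In a tensor product the varied slot falls into exactly one factor. In a composite the
  inner relation becomes a null tensor, and the induction hypothesis lets the outer map descend to
  classes.\<close>

lemma multilinear_interp:
  assumes alg: "operad_algebra A s H opn" and coalg: "operad_coalgebra C s H coop"
    and "well_formed A C e" "operational e"
  shows "multilinear_mod s H (source e) fscale (tensor_null s H) (interp opn coop e)"
  using assms(3-)
proof (induction e)
  case (Oper n \<mu>)
  show ?case unfolding multilinear_mod_def
  proof (intro allI impI, elim conjE)
    fix us x y ws a assume len: "length us + 1 + length ws = source (Oper n \<mu> :: ('a, 'b, 'd) expr)"
      and H: "set us \<subseteq> H" "x \<in> H" "y \<in> H" "set ws \<subseteq> H"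
    have \<mu>: "\<mu> \<in> ops A (length us + 1 + length ws)" using Oper len by simp
    have mem: "opn \<mu> (us @ z # ws) \<in> H" if "z \<in> H" for z
      using opn_mem[OF alg, of \<mu> "us @ z # ws"] \<mu> H that by simp
    show "interp opn coop (Oper n \<mu>) (us @ (x + y) # ws) - interp opn coop (Oper n \<mu>) (us @ x # ws)
        - interp opn coop (Oper n \<mu>) (us @ y # ws) \<in> tensor_null s H \<and>
        interp opn coop (Oper n \<mu>) (us @ s a x # ws) - fscale a (interp opn coop (Oper n \<mu>) (us @ x # ws))
        \<in> tensor_null s H"
      using tensor_null_add_gen[of "[]" H _ _ "[]" s, OF _ mem[OF H(2)] mem[OF H(3)]]
        tensor_null_scale_gen[of "[]" H _ "[]" s a, OF _ mem[OF H(2)]]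
      by (simp add: opn_add[OF alg \<mu> H] opn_scale[OF alg \<mu> H(1,2,4)])
  qed
next
  case (Perm n \<sigma>)
  show ?case unfolding multilinear_mod_def
  proof (intro allI impI, elim conjE)
    fix us x y ws a assume len: "length us + 1 + length ws = source (Perm n \<sigma> :: ('a, 'b, 'd) expr)"
      and H: "set us \<subseteq> H" "x \<in> H" "y \<in> H" "set ws \<subseteq> H"
    have "inv \<sigma> permutes {..<n}" using Perm by (simp add: permutes_inv)
    from permute_list_slot[OF this] len obtain us' ws' where
      *: "\<And>z. permute_list (inv \<sigma>) (us @ z # ws) = us' @ z # ws'"
      "set us' \<subseteq> set us \<union> set ws" "set ws' \<subseteq> set us \<union> set ws" by (metis source.simps(3))
    have H': "set us' \<subseteq> H" "set ws' \<subseteq> H" using * H by auto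
    show "interp opn coop (Perm n \<sigma>) (us @ (x + y) # ws) - interp opn coop (Perm n \<sigma>) (us @ x # ws)
        - interp opn coop (Perm n \<sigma>) (us @ y # ws) \<in> tensor_null s H \<and>
        interp opn coop (Perm n \<sigma>) (us @ s a x # ws) - fscale a (interp opn coop (Perm n \<sigma>) (us @ x # ws))
        \<in> tensor_null s H"
      using tensor_null_add_gen[OF H'(1) H(2,3) H'(2), of s] tensor_null_scale_gen[OF H'(1) H(2) H'(2), of s a]
      by (simp add: tensor_perm_def *(1))
  qed
next
  case (Tens e f)
  have wf: "well_formed A C e" "well_formed A C f" using Tens.prems by auto
  have e: "multilinear_mod s H (source e) fscale (tensor_null s H) (interp opn coop e)"
    and f: "multilinear_mod s H (source f) fscale (tensor_null s H) (interp opn coop f)"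
    using Tens by auto
  show ?case unfolding multilinear_mod_def
  proof (intro allI impI, elim conjE)
    fix us x y ws a assume len: "length us + 1 + length ws = source (Tens e f :: ('a, 'b, 'd) expr)"
      and H: "set us \<subseteq> H" "x \<in> H" "y \<in> H" "set ws \<subseteq> H"
    let ?e = "interp opn coop e" and ?f = "interp opn coop f"
    show "interp opn coop (Tens e f) (us @ (x + y) # ws) - interp opn coop (Tens e f) (us @ x # ws)
        - interp opn coop (Tens e f) (us @ y # ws) \<in> tensor_null s H \<and>
        interp opn coop (Tens e f) (us @ s a x # ws) - fscale a (interp opn coop (Tens e f) (us @ x # ws))
        \<in> tensor_null s H"
    \<comment> \<open>Whether the varied slot is among the first \<open>source e\<close> inputs
      decides which factor sees it; the other factor then takes a fixed value.\<close>
    proof (cases "length us < source e")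
      case True
      define k where "k = source e - length us - 1"
      have tk: "take (source e) (us @ z # ws) = us @ z # take k ws"
        "drop (source e) (us @ z # ws) = drop k ws" for z
        using True by (auto simp: k_def take_Cons' drop_Cons' not_less)
      have k: "length us + 1 + length (take k ws) = source e" "set (take k ws) \<subseteq> H"
        using True len H(4) set_take_subset[of k ws] by (auto simp: k_def)
      have k': "length (drop k ws) = source f" "set (drop k ws) \<subseteq> H"
        using True len H(4) set_drop_subset[of k ws] by (auto simp: k_def)
      have u: "?f (drop k ws) \<in> tensor_reps H (target f)"
        by (rule interp_reps[OF alg coalg wf(2) k'])
      have "?e (us @ (x + y) # take k ws) - ?e (us @ x # take k ws) - ?e (us @ y # take k ws)
          \<in> tensor_null s H"
        "?e (us @ s a x # take k ws) - fscale a (?e (us @ x # take k ws)) \<in> tensor_null s H"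
        using e k H unfolding multilinear_mod_def by blast+
      from this[THEN tensor_mult_null_left[OF _ u]] show ?thesis by (simp add: tk del: take_append drop_append)
    next
      case False
      define vs where "vs = drop (source e) us"
      have tk: "take (source e) (us @ z # ws) = take (source e) us"
        "drop (source e) (us @ z # ws) = vs @ z # ws" for z
        using False by (auto simp: vs_def)
      have k: "length vs + 1 + length ws = source f" "set vs \<subseteq> H"
        using False len H(1) set_drop_subset[of "source e" us] by (auto simp: vs_def)
      have k': "length (take (source e) us) = source e" "set (take (source e) us) \<subseteq> H"
        using False H(1) set_take_subset[of "source e" us] by auto
      have u: "?e (take (source e) us) \<in> tensor_reps H (target e)"
        by (rule interp_reps[OF alg coalg wf(1) k'])
      have "?f (vs @ (x + y) # ws) - ?f (vs @ x # ws) - ?f (vs @ y # ws) \<in> tensor_null s H"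
        "?f (vs @ s a x # ws) - fscale a (?f (vs @ x # ws)) \<in> tensor_null s H"
        using f k H unfolding multilinear_mod_def by blast+
      from this[THEN tensor_mult_null_right[OF _ u]] show ?thesis by (simp add: tk del: take_append drop_append)
    qed
  qed
next
  case (Comp e f)
  have wf: "well_formed A C e" "well_formed A C f" and st: "source e = target f"
    using Comp.prems by auto
  have e: "multilinear_mod s H (source e) fscale (tensor_null s H) (interp opn coop e)"
    and f: "multilinear_mod s H (source f) fscale (tensor_null s H) (interp opn coop f)"
    using Comp by auto
  show ?case unfolding multilinear_mod_def
  proof (intro allI impI, elim conjE)
    fix us x y ws a assume len: "length us + 1 + length ws = source (Comp e f :: ('a, 'b, 'd) expr)"
      and H: "set us \<subseteq> H" "x \<in> H" "y \<in> H" "set ws \<subseteq> H"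
    let ?f = "interp opn coop f"
    interpret vector_space s by (rule operad_algebra.alg_vector_space[OF alg])
    have cl: "x + y \<in> H" "s a x \<in> H"
      using H operad_algebra.alg_subspace[OF alg] by (auto intro: subspace_add subspace_scale)
    have r: "?f (us @ z # ws) \<in> tensor_reps H (target f)" if "z \<in> H" for z
      by (rule interp_reps[OF alg coalg wf(2)]) (use len H that in auto)
    have "?f (us @ (x + y) # ws) - ?f (us @ x # ws) - ?f (us @ y # ws) \<in> tensor_null s H"
      "?f (us @ s a x # ws) - fscale a (?f (us @ x # ws)) \<in> tensor_null s H"
      using f len H unfolding multilinear_mod_def by (metis source.simps(5))+
    \<comment> \<open>Written as an equivalence with 0, the inner relation can be fed to
      \<open>fsum_tensor_eq\<close> for the outer expression \<open>e\<close>.\<close>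
    hence "tensor_eq s H (?f (us @ (x + y) # ws) - ?f (us @ x # ws) - ?f (us @ y # ws)) 0"
      "tensor_eq s H (?f (us @ s a x # ws) - fscale a (?f (us @ x # ws))) 0"
      by (simp_all add: tensor_eq_def)
    from this[THEN fsum_tensor_eq[OF e]]
    show "interp opn coop (Comp e f) (us @ (x + y) # ws) - interp opn coop (Comp e f) (us @ x # ws)
        - interp opn coop (Comp e f) (us @ y # ws) \<in> tensor_null s H \<and>
        interp opn coop (Comp e f) (us @ s a x # ws) - fscale a (interp opn coop (Comp e f) (us @ x # ws))
        \<in> tensor_null s H"
      using H cl by (simp add: st r tensor_reps_simps tensor_eq_def)
  qed
next
  case (Add e f)
  have e: "multilinear_mod s H (source e) fscale (tensor_null s H) (interp opn coop e)"
    and f: "multilinear_mod s H (source e) fscale (tensor_null s H) (interp opn coop f)"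
    using Add by auto
  show ?case unfolding multilinear_mod_def
  proof (intro allI impI, elim conjE)
    fix us x y ws a assume len: "length us + 1 + length ws = source (Add e f :: ('a, 'b, 'd) expr)"
      and H: "set us \<subseteq> H" "x \<in> H" "y \<in> H" "set ws \<subseteq> H"
    let ?e = "interp opn coop e" and ?f = "interp opn coop f"
    have "?e (us @ (x + y) # ws) - ?e (us @ x # ws) - ?e (us @ y # ws) \<in> tensor_null s H"
      "?e (us @ s a x # ws) - fscale a (?e (us @ x # ws)) \<in> tensor_null s H"
      "?f (us @ (x + y) # ws) - ?f (us @ x # ws) - ?f (us @ y # ws) \<in> tensor_null s H"
      "?f (us @ s a x # ws) - fscale a (?f (us @ x # ws)) \<in> tensor_null s H"
      using e f len H unfolding multilinear_mod_def by (metis source.simps(7))+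
    from tensor_null_simps(2)[OF this(1,3)] tensor_null_simps(2)[OF this(2,4)]
    show "interp opn coop (Add e f) (us @ (x + y) # ws) - interp opn coop (Add e f) (us @ x # ws)
        - interp opn coop (Add e f) (us @ y # ws) \<in> tensor_null s H \<and>
        interp opn coop (Add e f) (us @ s a x # ws) - fscale a (interp opn coop (Add e f) (us @ x # ws))
        \<in> tensor_null s H"
      by (simp add: fscale_add algebra_simps)
  qed
next
  case (Scale b e)
  have e: "multilinear_mod s H (source e) fscale (tensor_null s H) (interp opn coop e)"
    using Scale by auto
  show ?case unfolding multilinear_mod_def
  proof (intro allI impI, elim conjE)
    fix us x y ws a assume len: "length us + 1 + length ws = source (Scale b e :: ('a, 'b, 'd) expr)"
      and H: "set us \<subseteq> H" "x \<in> H" "y \<in> H" "set ws \<subseteq> H"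
    let ?e = "interp opn coop e"
    have "?e (us @ (x + y) # ws) - ?e (us @ x # ws) - ?e (us @ y # ws) \<in> tensor_null s H"
      "?e (us @ s a x # ws) - fscale a (?e (us @ x # ws)) \<in> tensor_null s H"
      using e len H unfolding multilinear_mod_def by (metis source.simps(8))+
    from this[THEN tensor_null_simps(4), of b]
    show "interp opn coop (Scale b e) (us @ (x + y) # ws) - interp opn coop (Scale b e) (us @ x # ws)
        - interp opn coop (Scale b e) (us @ y # ws) \<in> tensor_null s H \<and>
        interp opn coop (Scale b e) (us @ s a x # ws) - fscale a (interp opn coop (Scale b e) (us @ x # ws))
        \<in> tensor_null s H"
      by (simp add: fscale_diff mult.commute)
  qed
qed (auto simp: multilinear_mod_def tensor_null_simps)

text \<open>Equality holds for representatives, not merely up to \<open>tensor_eq\<close>: once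
  \<open>Coop\<close> is excluded, an algebra morphism commutes exactly with every
  constructor.\<close>

lemma interp_natural:
  assumes "algebra_hom A s X opX s' Y opY \<phi>" "operad_coalgebra C s X coX"
    and "well_formed A C e" "operational e" "length w = source e" "set w \<subseteq> X"
  shows "tensor_map \<phi> (interp opX coX e w) = interp opY coY e (map \<phi> w)"
  using assms(3-)
proof (induction e arbitrary: w)
  case (Oper n \<mu>)
  thus ?case using assms(1) by (simp add: algebra_hom_def)
next
  case (Perm n \<sigma>)
  hence "inv \<sigma> permutes {..<length w}" by (simp add: permutes_inv)
  thus ?case by (simp add: tensor_perm_def permute_list_map)
next
  case (Tens e f)
  have "set (take (source e) w) \<subseteq> X" "set (drop (source e) w) \<subseteq> X"
    using Tens.prems(4) set_take_subset set_drop_subset by fast+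
  thus ?case using Tens by (simp add: tensor_map_mult take_map drop_map)
next
  case (Comp e f)
  have alg: "operad_algebra A s X opX" using assms(1) by (simp add: algebra_hom_def)
  have r: "interp opX coX f w \<in> tensor_reps X (target f)"
    using interp_reps[OF alg assms(2)] Comp.prems by simp
  have "tensor_map \<phi> (interp opX coX (Comp e f) w)
      = fsum (\<lambda>v. tensor_map \<phi> (interp opX coX e v)) (interp opX coX f w)"
    by (simp add: tensor_map_fsum)
  also have "\<dots> = fsum (\<lambda>v. interp opY coY e (map \<phi> v)) (interp opX coX f w)"
    by (rule fsum_cong) (use Comp tensor_repsD[OF r] in simp)
  also have "\<dots> = interp opY coY (Comp e f) (map \<phi> w)"
    using Comp by (simp add: fsum_tensor_map[symmetric])
  finally show ?case .
qed simp_all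

section \<open>Arities of the constituents of distributive terms\<close>

lemma Tens_list_simps [simp]:
  "Tens_list [] = Perm 0 id" "Tens_list (e # es) = Tens e (Tens_list es)"
  by (simp_all add: Tens_list_def)

lemma Sum_list_simps [simp]:
  "Sum_list m n [] = Zero m n" "Sum_list m n (e # es) = Add e (Sum_list m n es)"
  by (simp_all add: Sum_list_def)

lemma group_algebraD:
  assumes "\<omega> \<in> group_algebra r"
  shows "well_formed A C \<omega>" "operational \<omega>" "source \<omega> = r" "target \<omega> = r"
proof -
  from assms obtain as where as: "\<omega> = Sum_list r r (map (\<lambda>(a, \<sigma>). Scale a (Perm r \<sigma>)) as)"
    "\<forall>(a, \<sigma>)\<in>set as. \<sigma> permutes {..<r}"
    by (auto simp: group_algebra_def)
  have "well_formed A C \<omega> \<and> operational \<omega> \<and> source \<omega> = r \<and> target \<omega> = r"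
    using as(2) unfolding as(1) by (induction as) auto
  thus "well_formed A C \<omega>" "operational \<omega>" "source \<omega> = r" "target \<omega> = r" by blast+
qed

lemma Tens_list_Oper:
  assumes "list_all2 (\<lambda>\<mu> k. \<mu> \<in> ops A k) \<mu>s ks"
  shows "well_formed A C (Tens_list (map2 Oper ks \<mu>s))" "operational (Tens_list (map2 Oper ks \<mu>s))"
    "source (Tens_list (map2 Oper ks \<mu>s)) = sum_list ks"
    "target (Tens_list (map2 Oper ks \<mu>s)) = length ks"
proof -
  have "well_formed A C (Tens_list (map2 Oper ks \<mu>s)) \<and> operational (Tens_list (map2 Oper ks \<mu>s)) \<and>
    source (Tens_list (map2 Oper ks \<mu>s)) = sum_list ks \<and>
    target (Tens_list (map2 Oper ks \<mu>s)) = length ks"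
    using assms by (induction rule: list_all2_induct) (auto simp: permutes_id)
  thus "well_formed A C (Tens_list (map2 Oper ks \<mu>s))" "operational (Tens_list (map2 Oper ks \<mu>s))"
    "source (Tens_list (map2 Oper ks \<mu>s)) = sum_list ks"
    "target (Tens_list (map2 Oper ks \<mu>s)) = length ks" by blast+
qed

lemma Tens_list_Coop:
  assumes "list_all2 (\<lambda>\<delta> l. \<delta> \<in> ops C l) \<delta>s ls"
  shows "well_formed A C (Tens_list (map2 Coop ls \<delta>s))"
    "source (Tens_list (map2 Coop ls \<delta>s)) = length ls"
    "target (Tens_list (map2 Coop ls \<delta>s)) = sum_list ls"
proof -
  have "well_formed A C (Tens_list (map2 Coop ls \<delta>s)) \<and>
    source (Tens_list (map2 Coop ls \<delta>s)) = length ls \<and>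
    target (Tens_list (map2 Coop ls \<delta>s)) = sum_list ls"
    using assms by (induction rule: list_all2_induct) (auto simp: permutes_id)
  thus "well_formed A C (Tens_list (map2 Coop ls \<delta>s))"
    "source (Tens_list (map2 Coop ls \<delta>s)) = length ls"
    "target (Tens_list (map2 Coop ls \<delta>s)) = sum_list ls" by blast+
qed

section \<open>Transfer of primitivity along algebra morphisms\<close>

text \<open>Arities at least 2 vanish by primitivity. Arity 0 has its own argument:
  \<open>\<delta>\<close> is the zero cooperation, which is 0 times itself.\<close>

lemma coop_zero:
  assumes "operad_coalgebra C s H coop" "n \<noteq> 1" "\<delta> \<in> ops C n" "ops C 0 = {0}"
    "x \<in> primitive_part C s H coop"
  shows "tensor_eq s H (coop n \<delta> x) 0"
proof (cases "n = 0")
  case True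
  interpret operad_coalgebra C s H coop by fact
  have [simp]: "oscale C 0 0 = 0"
    using vector_space by (simp add: vector_space_def module_def module.scale_zero_left)
  have "\<delta> = 0" "x \<in> H" using True assms by (auto simp: primitive_part_def)
  thus ?thesis using coop_scale_left[of \<delta> 0 x 0] assms True by simp
next
  case False
  thus ?thesis using assms by (simp add: primitive_part_def)
qed

lemma coop_scalar:
  assumes "operad_coalgebra C s H coop" "x \<in> H"
  shows "tensor_eq s H (coop 1 (oscale C c (oone C)) x) (Poly_Mapping.single [x] c)"
proof -
  interpret operad_coalgebra C s H coop by fact
  have "tensor_eq s H (coop 1 (oscale C c (oone C)) x) (fscale c (coop 1 (oone C) x))"
    using assms(2) by (intro coop_scale_left) (use one_mem in simp)
  also have "tensor_eq s H \<dots> (fscale c (Poly_Mapping.single [x] 1))"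
    by (intro tensor_eq_scale coop_one assms(2))
  finally show ?thesis by simp
qed

text \<open>\<open>\<phi>\<close> is a morphism of algebras only; the two coalgebra structures are
  unrelated. Compatibility relations come in with \<open>opn_primitive_transfer\<close>.\<close>

locale algebra_hom_of_bialgebras =
  fixes A :: "('k::field, 'a::ab_group_add) operad_data" and C :: "('k, 'c::ab_group_add) operad_data"
    and s :: "'k \<Rightarrow> 'x::ab_group_add \<Rightarrow> 'x" and X opX coX
    and s' :: "'k \<Rightarrow> 'y::ab_group_add \<Rightarrow> 'y" and Y opY coY and \<phi>
  assumes conn: "connected_operad C"
    and hom: "algebra_hom A s X opX s' Y opY \<phi>"
    and coalgX: "operad_coalgebra C s X coX" and coalgY: "operad_coalgebra C s' Y coY"
begin

lemma algX: "operad_algebra A s X opX" and algY: "operad_algebra A s' Y opY"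
  and linear: "linear_between s X s' Y \<phi>"
  using hom by (simp_all add: algebra_hom_def)

lemma image: "x \<in> X \<Longrightarrow> \<phi> x \<in> Y"
  using linear by (auto simp: linear_between_def)

text \<open>As \<open>C(1)\<close> is spanned by the identity, a cooperation of arity one is the
  same scalar on both sides; every other arity gives zero on both. Primitivity of
  \<open>\<phi> x\<close> is assumed separately, since \<open>\<phi>\<close> need not preserve
  it.\<close>

lemma coop_natural:
  assumes "\<delta> \<in> ops C l" and x: "x \<in> primitive_part C s X coX" "\<phi> x \<in> primitive_part C s' Y coY"
  shows "tensor_eq s' Y (tensor_map \<phi> (coX l \<delta> x)) (coY l \<delta> (\<phi> x))"
proof (cases "l = 1")
  case True
  interpret operad C using conn by (simp add: connected_operad_def)
  interpret V: vector_space "oscale C" by (rule vector_space)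
  have xX: "x \<in> X" using x by (simp add: primitive_part_def)
  obtain c where \<delta>: "\<delta> = oscale C c (oone C)"
    using assms(1) conn True unfolding connected_operad_def V.span_singleton by auto
  have "tensor_eq s' Y (tensor_map \<phi> (coX l \<delta> x)) (tensor_map \<phi> (Poly_Mapping.single [x] c))"
    unfolding \<delta> True by (intro tensor_map_eq[OF linear] coop_scalar[OF coalgX xX])
  also have "tensor_map \<phi> (Poly_Mapping.single [x] c) = Poly_Mapping.single [\<phi> x] c" by simp
  also have "tensor_eq s' Y \<dots> (coY l \<delta> (\<phi> x))"
    unfolding \<delta> True by (intro tensor_eq_sym[OF coop_scalar[OF coalgY image[OF xX]]])
  finally show ?thesis .
next
  case False
  have C0: "ops C 0 = {0}" using conn by (simp add: connected_operad_def)
  have "tensor_eq s' Y (tensor_map \<phi> (coX l \<delta> x)) (tensor_map \<phi> 0)"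
    by (intro tensor_map_eq[OF linear] coop_zero[OF coalgX False assms(1) C0 x(1)])
  also have "tensor_map \<phi> 0 = 0" by simp
  also have "tensor_eq s' Y 0 (coY l \<delta> (\<phi> x))"
    by (intro tensor_eq_sym[OF coop_zero[OF coalgY False assms(1) C0 x(2)]])
  finally show ?thesis .
qed

lemma Tens_list_Coop_natural:
  assumes "list_all2 (\<lambda>\<delta> l. \<delta> \<in> ops C l) \<delta>s ls" "length xs = length ls"
    and "set xs \<subseteq> primitive_part C s X coX" "\<phi> ` set xs \<subseteq> primitive_part C s' Y coY"
  shows "tensor_eq s' Y (tensor_map \<phi> (interp opX coX (Tens_list (map2 Coop ls \<delta>s)) xs))
    (interp opY coY (Tens_list (map2 Coop ls \<delta>s)) (map \<phi> xs))"
  using assms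
proof (induction arbitrary: xs rule: list_all2_induct)
  case (Cons \<delta> \<delta>s l ls)
  then obtain x xs' where xs: "xs = x # xs'" by (cases xs) auto
  have X: "x \<in> X" "set xs' \<subseteq> X" using Cons.prems xs by (auto simp: primitive_part_def)
  note T = Tens_list_Coop[OF Cons.hyps(2)]
  have "interp opX coX (Tens_list (map2 Coop ls \<delta>s)) xs' \<in> tensor_reps X (sum_list ls)"
    using interp_reps[OF algX coalgX T(1), of xs'] X Cons.prems xs by (simp add: T)
  hence "tensor_map \<phi> (interp opX coX (Tens_list (map2 Coop ls \<delta>s)) xs') \<in> tensor_reps Y (sum_list ls)"
    by (intro tensor_map_reps) (auto intro: image)
  moreover have "coY l \<delta> (\<phi> x) \<in> tensor_reps Y l"
    using operad_coalgebra.coop_mem[OF coalgY] Cons.hyps image X by blast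
  moreover have "tensor_eq s' Y (tensor_map \<phi> (coX l \<delta> x)) (coY l \<delta> (\<phi> x))"
    using Cons.prems xs Cons.hyps by (intro coop_natural) auto
  moreover have "tensor_eq s' Y (tensor_map \<phi> (interp opX coX (Tens_list (map2 Coop ls \<delta>s)) xs'))
    (interp opY coY (Tens_list (map2 Coop ls \<delta>s)) (map \<phi> xs'))"
    using Cons.prems xs by (intro Cons.IH) auto
  ultimately show ?case
    unfolding xs by (simp add: tensor_map_mult tensor_eq_mult)
qed (simp add: tensor_perm_def)

text \<open>The term is regrouped as \<open>E\<close> after \<open>T\<close>, with the cooperations
  in \<open>T\<close> and all operations and permutations in \<open>E\<close>. \<open>T\<close> is
  natural up to \<open>tensor_eq\<close>, \<open>E\<close> exactly, and \<open>E\<close> is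
  multilinear, so that it preserves the equivalence left by \<open>T\<close>.\<close>

lemma distributive_term_natural:
  assumes "e \<in> distributive_terms A C (length xs) m"
    and xs: "set xs \<subseteq> primitive_part C s X coX" "\<phi> ` set xs \<subseteq> primitive_part C s' Y coY"
  shows "tensor_eq s' Y (tensor_map \<phi> (interp opX coX e xs)) (interp opY coY e (map \<phi> xs))"
proof -
  obtain ks \<mu>s r \<omega> ls \<delta>s where
    e: "e = Comp (Tens_list (map2 Oper ks \<mu>s)) (Comp \<omega> (Tens_list (map2 Coop ls \<delta>s)))"
    and \<mu>s: "list_all2 (\<lambda>\<mu> k. \<mu> \<in> ops A k) \<mu>s ks"
    and \<delta>s: "list_all2 (\<lambda>\<delta> l. \<delta> \<in> ops C l) \<delta>s ls"
    and len: "length ls = length xs" "sum_list ks = r" "sum_list ls = r" and \<omega>: "\<omega> \<in> group_algebra r"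
    using assms(1) unfolding distributive_terms_def listset_iff list_all2_map2 by blast
  define E where "E = Comp (Tens_list (map2 Oper ks \<mu>s)) \<omega>"
  define T :: "('k, 'a, 'c) expr" where "T = Tens_list (map2 Coop ls \<delta>s)"
  note O = Tens_list_Oper[OF \<mu>s] and W = group_algebraD[OF \<omega>]
  have E: "well_formed A C E" "operational E" "source E = r"
    using O W len by (auto simp: E_def)
  have T: "well_formed A C T" "source T = length xs" "target T = r"
    using Tens_list_Coop[OF \<delta>s] len by (auto simp: T_def)
  have interp: "interp opn coop e w = fsum (interp opn coop E) (interp opn coop T w)" for opn coop w
    by (simp add: e E_def T_def fsum_fsum) (rule fsum_cong, simp)
  have X: "set xs \<subseteq> X" using xs(1) by (auto simp: primitive_part_def)
  have TX: "interp opX coX T xs \<in> tensor_reps X r"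
    using interp_reps[OF algX coalgX T(1), of xs] T X by simp
  have TY: "interp opY coY T (map \<phi> xs) \<in> tensor_reps Y r"
    using interp_reps[OF algY coalgY T(1), of "map \<phi> xs"] T X image by auto
  have "tensor_map \<phi> (interp opX coX e xs)
      = fsum (\<lambda>v. tensor_map \<phi> (interp opX coX E v)) (interp opX coX T xs)"
    by (simp add: interp tensor_map_fsum)
  also have "\<dots> = fsum (\<lambda>v. interp opY coY E (map \<phi> v)) (interp opX coX T xs)"
    using tensor_repsD[OF TX] by (intro fsum_cong interp_natural[OF hom coalgX E(1,2)]) (auto simp: E)
  also have "\<dots> = fsum (interp opY coY E) (tensor_map \<phi> (interp opX coX T xs))"
    by (simp add: fsum_tensor_map)
  also have "tensor_eq s' Y \<dots> (fsum (interp opY coY E) (interp opY coY T (map \<phi> xs)))"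
    using multilinear_interp[OF algY coalgY E(1,2)] TX TY
    by (intro fsum_tensor_eq[where r = r] tensor_map_reps)
      (auto simp: E image T_def intro!: Tens_list_Coop_natural \<delta>s xs(1) len(1)[symmetric] xs(2)[THEN subsetD])
  also have "\<dots> = interp opY coY e (map \<phi> xs)" by (simp add: interp)
  finally show ?thesis .
qed

text \<open>As \<open>opX \<mu> xs\<close> is primitive, the relation in \<open>X\<close> shows that
  its right-hand side vanishes at \<open>xs\<close>. Naturality carries the vanishing to
  \<open>Y\<close>, where the same relation turns it back into a statement on
  \<open>opY \<mu>\<close>.\<close>

lemma opn_primitive_transfer:
  assumes H0: "all_distributive A C R"
    and bialg: "bialgebra A C R s X opX coX" "bialgebra A C R s' Y opY coY"
    and \<mu>: "\<mu> \<in> ops A (length xs)"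
    and xs: "set xs \<subseteq> primitive_part C s X coX" "\<phi> ` set xs \<subseteq> primitive_part C s' Y coY"
    and prim: "opX \<mu> xs \<in> primitive_part C s X coX"
  shows "opY \<mu> (map \<phi> xs) \<in> primitive_part C s' Y coY"
proof -
  have X: "set xs \<subseteq> X" using xs(1) by (auto simp: primitive_part_def)
  have Y: "set (map \<phi> xs) \<subseteq> Y" using X image by auto
  have "tensor_eq s' Y (coY m \<delta> (opY \<mu> (map \<phi> xs))) 0" if m: "m \<ge> 2" and \<delta>: "\<delta> \<in> ops C m" for m \<delta>
  proof -
    \<comment> \<open>\<open>R\<close> belongs to the type of bialgebras, not to a single bialgebra,
      so the same list \<open>es\<close> is valid in \<open>X\<close> and in
      \<open>Y\<close>.\<close>
    obtain es where es: "set es \<subseteq> distributive_terms A C (length xs) m"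
      and R: "(Comp (Coop m \<delta>) (Oper (length xs) \<mu>), Sum_list (length xs) m es) \<in> R"
      using H0 \<mu> \<delta> unfolding all_distributive_def distributive_relation_def by blast
    have nat: "tensor_eq s' Y (tensor_map \<phi> (interp opX coX (Sum_list (length xs) m es) xs))
        (interp opY coY (Sum_list (length xs) m es) (map \<phi> xs))"
      using es by (induction es) (auto intro!: tensor_eq_add distributive_term_natural xs(1) xs(2)[THEN subsetD])
    have "tensor_eq s X (coX m \<delta> (opX \<mu> xs)) (interp opX coX (Sum_list (length xs) m es) xs)"
      using bialg(1) R X unfolding bialgebra_def satisfies_def by fastforce
    hence "tensor_eq s X (interp opX coX (Sum_list (length xs) m es) xs) (coX m \<delta> (opX \<mu> xs))"
      by (rule tensor_eq_sym)
    also have "tensor_eq s X \<dots> 0" using prim m \<delta> by (auto simp: primitive_part_def)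
    finally have "tensor_eq s' Y (tensor_map \<phi> (interp opX coX (Sum_list (length xs) m es) xs)) (tensor_map \<phi> 0)"
      by (rule tensor_map_eq[OF linear])
    have "tensor_eq s' Y (coY m \<delta> (opY \<mu> (map \<phi> xs))) (interp opY coY (Sum_list (length xs) m es) (map \<phi> xs))"
      using bialg(2) R Y unfolding bialgebra_def satisfies_def by fastforce
    also have "tensor_eq s' Y \<dots> (tensor_map \<phi> (interp opX coX (Sum_list (length xs) m es) xs))"
      by (rule tensor_eq_sym[OF nat])
    also have "tensor_eq s' Y \<dots> (tensor_map \<phi> 0)" by fact
    finally show ?thesis by simp
  qed
  thus ?thesis using opn_mem[OF algY, of \<mu> "map \<phi> xs"] \<mu> Y by (simp add: primitive_part_def)
qed

end

section \<open>Free algebras\<close>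

lemma mset_concat_map2_permute_list:
  assumes "list_all2 (\<lambda>\<tau> b. \<tau> permutes {..<length b}) \<tau>s bs"
  shows "mset (concat (map2 permute_list \<tau>s bs)) = mset (concat bs)"
  using assms by (induction rule: list_all2_induct) simp_all

lemma concat_blocks: "concat (blocks ks) = [0..<sum_list ks]"
proof (induction ks rule: rev_induct)
  case (snoc k ks)
  let ?b = "\<lambda>ks j. [sum_list (take j ks)..<sum_list (take (Suc j) ks)]"
  have "map (?b (ks @ [k])) [0..<length ks] = map (?b ks) [0..<length ks]"
    by (rule map_cong) simp_all
  hence "blocks (ks @ [k]) = blocks ks @ [[sum_list ks..<sum_list ks + k]]"
    by (simp add: blocks_def del: upt_Suc) (simp add: upt_Suc)
  thus ?case using snoc upt_add_eq_append[of 0 "sum_list ks" k] by simp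
qed (simp add: blocks_def)

lemma perm_of_permutes:
  assumes "mset p = mset [0..<n]"
  shows "perm_of p permutes {..<n}"
proof (rule bij_imp_permutes)
  have "length p = n" "distinct p" "set p = {..<n}"
    using mset_eq_length[OF assms] mset_eq_imp_distinct_iff[OF assms] mset_eq_setD[OF assms]
    by (simp_all add: atLeast0LessThan)
  hence "bij_betw ((!) p) {..<n} {..<n}" by (intro bij_betw_nth) auto
  thus "bij_betw (perm_of p) {..<n} {..<n}"
    by (rule bij_betw_cong[THEN iffD1, rotated]) (simp add: perm_of_def \<open>length p = n\<close>)
  show "perm_of p x = x" if "x \<notin> {..<n}" for x
    using that by (simp add: perm_of_def \<open>length p = n\<close>)
qed

text \<open>Permuting inside the blocks preserves the multiset of their concatenation
  \<open>[0..<sum_list ks]\<close>. The symmetry relation of \<open>free_null\<close> asks for a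
  genuine permutation, hence this check.\<close>

lemma sum_perm_permutes:
  assumes "list_all2 (\<lambda>\<tau> k. \<tau> permutes {..<k}) \<tau>s ks"
  shows "sum_perm ks \<tau>s permutes {..<sum_list ks}"
  unfolding sum_perm_def
proof (rule perm_of_permutes)
  have "length (blocks ks ! i) = ks ! i" if "i < length ks" for i
    using that by (simp add: blocks_def take_Suc_conv_app_nth)
  hence "list_all2 (\<lambda>\<tau> b. \<tau> permutes {..<length b}) \<tau>s (blocks ks)"
    using assms by (auto simp: list_all2_conv_all_nth blocks_def)
  thus "mset (concat (map2 permute_list \<tau>s (blocks ks))) = mset [0..<sum_list ks]"
    by (simp add: mset_concat_map2_permute_list concat_blocks del: mset_upt)
qed

context operad
begin

text \<open>Sum, scalar and symmetry: these are the relations of \<open>free_null\<close> that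
  change the operation, here for one argument of a composite.\<close>

lemma ocomp_slot:
  assumes "\<mu> \<in> ops A (length ks1 + 1 + length ks2)"
    and "list_all2 (\<lambda>\<nu> k. \<nu> \<in> ops A k) \<nu>s1 ks1" "list_all2 (\<lambda>\<nu> k. \<nu> \<in> ops A k) \<nu>s2 ks2" "\<nu> \<in> ops A k"
  shows "\<nu>' \<in> ops A k \<Longrightarrow> ocomp A (ks1 @ k # ks2) \<mu> (\<nu>s1 @ (\<nu> + \<nu>') # \<nu>s2)
      = ocomp A (ks1 @ k # ks2) \<mu> (\<nu>s1 @ \<nu> # \<nu>s2) + ocomp A (ks1 @ k # ks2) \<mu> (\<nu>s1 @ \<nu>' # \<nu>s2)"
    and "ocomp A (ks1 @ k # ks2) \<mu> (\<nu>s1 @ oscale A a \<nu> # \<nu>s2)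
      = oscale A a (ocomp A (ks1 @ k # ks2) \<mu> (\<nu>s1 @ \<nu> # \<nu>s2))"
    and "\<sigma> permutes {..<k} \<Longrightarrow> ocomp A (ks1 @ k # ks2) \<mu> (\<nu>s1 @ oact A k \<sigma> \<nu> # \<nu>s2)
      = oact A (sum_list (ks1 @ k # ks2))
          (sum_perm (ks1 @ k # ks2) (replicate (length ks1) id @ \<sigma> # replicate (length ks2) id))
          (ocomp A (ks1 @ k # ks2) \<mu> (\<nu>s1 @ \<nu> # \<nu>s2))"
proof -
  let ?ks = "ks1 @ k # ks2" and ?\<nu>s = "\<nu>s1 @ \<nu> # \<nu>s2"
  have len: "length \<nu>s1 = length ks1" "length \<nu>s2 = length ks2"
    using assms by (auto dest: list_all2_lengthD)
  have \<mu>: "\<mu> \<in> ops A (length ?ks)" using assms(1) by simp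
  have ops: "list_all2 (\<lambda>\<nu> k. \<nu> \<in> ops A k) ?\<nu>s ?ks"
    using assms(2-4) by (intro list_all2_appendI list.rel_intros)
  hence \<nu>s: "?\<nu>s \<in> listset (map (ops A) ?ks)"
    unfolding listset_iff list_all2_map2 .
  have ml: "multilinear_on (oscale A) (map (ops A) ?ks) (oscale A) (ocomp A ?ks \<mu>)"
    by (rule comp_multilinear[OF \<mu>])
  have i: "length ks1 < length (map (ops A) ?ks)" "map (ops A) ?ks ! length ks1 = ops A k"
    by (simp_all add: nth_append)
  have *: "ocomp A ?ks \<mu> (?\<nu>s[length ks1 := ?\<nu>s ! length ks1 + \<nu>'])
      = ocomp A ?ks \<mu> ?\<nu>s + ocomp A ?ks \<mu> (?\<nu>s[length ks1 := \<nu>']) \<and>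
    ocomp A ?ks \<mu> (?\<nu>s[length ks1 := oscale A a (?\<nu>s ! length ks1)]) = oscale A a (ocomp A ?ks \<mu> ?\<nu>s)"
    if "\<nu>' \<in> ops A k" for \<nu>' a
    using ml[unfolded multilinear_on_def] \<nu>s i that by (metis (no_types, lifting))
  show "\<nu>' \<in> ops A k \<Longrightarrow> ocomp A ?ks \<mu> (\<nu>s1 @ (\<nu> + \<nu>') # \<nu>s2)
      = ocomp A ?ks \<mu> ?\<nu>s + ocomp A ?ks \<mu> (\<nu>s1 @ \<nu>' # \<nu>s2)"
    using *[of \<nu>'] by (simp flip: len(1))
  show "ocomp A ?ks \<mu> (\<nu>s1 @ oscale A a \<nu> # \<nu>s2) = oscale A a (ocomp A ?ks \<mu> ?\<nu>s)"
    using *[OF assms(4), of a] by (simp flip: len(1))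
  let ?\<tau>s = "replicate (length ks1) id @ \<sigma> # replicate (length ks2) id"
  assume \<sigma>: "\<sigma> permutes {..<k}"
  \<comment> \<open>\<open>comp_act_inner\<close> permutes inside all arguments at once; taking
    \<open>id\<close> outside the slot leaves the others unchanged by \<open>act_id\<close>.\<close>
  have "ocomp A ?ks \<mu> (map (\<lambda>i. oact A (?ks ! i) (?\<tau>s ! i) (?\<nu>s ! i)) [0..<length ?ks])
      = oact A (sum_list ?ks) (sum_perm ?ks ?\<tau>s) (ocomp A ?ks \<mu> ?\<nu>s)"
    by (rule comp_act_inner[OF \<mu> \<nu>s]) (use \<sigma> in \<open>auto simp: nth_append nth_Cons' permutes_id\<close>)
  also have "map (\<lambda>i. oact A (?ks ! i) (?\<tau>s ! i) (?\<nu>s ! i)) [0..<length ?ks] = \<nu>s1 @ oact A k \<sigma> \<nu> # \<nu>s2"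
  proof (rule nth_equalityI)
    fix i assume "i < length (map (\<lambda>i. oact A (?ks ! i) (?\<tau>s ! i) (?\<nu>s ! i)) [0..<length ?ks])"
    hence i: "i < length ?ks" by simp
    have \<nu>: "?\<nu>s ! i \<in> ops A (?ks ! i)" by (rule list_all2_nthD2[OF ops i])
    from i consider "i < length ks1" | "i = length ks1"
      | j where "i = length ks1 + Suc j" "j < length ks2"
      by (metis add_Suc_right add_less_cancel_left length_Cons length_append less_imp_Suc_add linorder_neqE_nat not_less_eq)
    hence "oact A (?ks ! i) (?\<tau>s ! i) (?\<nu>s ! i) = (\<nu>s1 @ oact A k \<sigma> \<nu> # \<nu>s2) ! i"
      using \<nu> len by cases (simp_all add: act_id nth_append)
    thus "map (\<lambda>i. oact A (?ks ! i) (?\<tau>s ! i) (?\<nu>s ! i)) [0..<length ?ks] ! i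
        = (\<nu>s1 @ oact A k \<sigma> \<nu> # \<nu>s2) ! i"
      using i by (subst nth_map) (simp_all del: upt_Suc)
  qed (simp add: len)
  finally show "ocomp A ?ks \<mu> (\<nu>s1 @ oact A k \<sigma> \<nu> # \<nu>s2)
      = oact A (sum_list ?ks) (sum_perm ?ks ?\<tau>s) (ocomp A ?ks \<mu> ?\<nu>s)" .
qed

end

text \<open>A free vector space as degree one of the words over its basis. Letters are symbols here,
  not vectors, so \<open>tensor_prod (map letter ts)\<close> is the full expansion of an argument
  list used in \<open>free_op\<close>.\<close>

definition letter :: "('b \<Rightarrow>\<^sub>0 'k::field) \<Rightarrow> ('b list \<Rightarrow>\<^sub>0 'k)" where
  "letter = fsum (\<lambda>b. Poly_Mapping.single [b] 1)"

lemma tensor_prod_simps [simp]: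
  "tensor_prod [] = Poly_Mapping.single [] 1"
  "tensor_prod (t # ts) = tensor_mult t (tensor_prod ts)"
  by (simp_all add: tensor_prod_def)

lemma lincomb_tensor_mult_letter:
  assumes "vector_space s"
  shows "lincomb s f (tensor_mult (letter t) u) = lincomb s (\<lambda>b. lincomb s (\<lambda>bs. f (b # bs)) u) t"
proof -
  interpret vector_space s by fact
  show ?thesis by (simp add: tensor_mult_def letter_def fsum_fsum lincomb_fsum assms)
qed

lemma tensor_prod_letters_reps:
  assumes "\<And>t. t \<in> set ts \<Longrightarrow> Poly_Mapping.keys t \<subseteq> L"
  shows "tensor_prod (map letter ts) \<in> tensor_reps L (length ts)"
  using assms
proof (induction ts)
  case (Cons t ts)
  have "letter t \<in> tensor_reps L 1" unfolding letter_def
    by (intro fsum_mem subspace_tensor_reps single_in_tensor_reps) (use Cons.prems in auto)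
  from tensor_mult_reps[OF this] Cons show ?case by simp
qed (simp add: single_in_tensor_reps)

lemma tensor_prod_letters_single:
  "tensor_prod (map (\<lambda>x. letter (Poly_Mapping.single (h x) 1)) xs) = Poly_Mapping.single (map h xs) 1"
  by (induction xs) (simp_all add: letter_def)

text \<open>\<open>L\<close> is linear on \<open>H\<close> only, so membership of the partial sums
  in \<open>H\<close> is carried through the induction.\<close>

lemma linear_between_lincomb:
  assumes "vector_space s" "vector_space s'" "module.subspace s H" "linear_between s H s' W L"
    and "\<And>b. b \<in> Poly_Mapping.keys t \<Longrightarrow> h b \<in> H"
  shows "L (lincomb s h t) = lincomb s' (\<lambda>b. L (h b)) t"
proof -
  interpret S: vector_space s by fact
  interpret S': vector_space s' by fact
  have add: "L (x + y) = L x + L y" if "x \<in> H" "y \<in> H" for x y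
    using assms(4) that by (auto simp: linear_between_def)
  have scale: "L (s a x) = s' a (L x)" if "x \<in> H" for a x
    using assms(4) that by (auto simp: linear_between_def)
  have zero: "L 0 = 0" using scale[of 0 0] S.subspace_0[OF assms(3)] by simp
  have "L (\<Sum>b\<in>B. s (c b) (h b)) = (\<Sum>b\<in>B. s' (c b) (L (h b))) \<and> (\<Sum>b\<in>B. s (c b) (h b)) \<in> H"
    if "finite B" "\<And>b. b \<in> B \<Longrightarrow> h b \<in> H" for B c
    using that
  proof (induction rule: finite_induct)
    case empty
    show ?case by (simp add: zero S.subspace_0[OF assms(3)])
  next
    case (insert b B)
    have b: "h b \<in> H" "s (c b) (h b) \<in> H"
      using insert.prems S.subspace_scale[OF assms(3)] by blast+
    have IH: "L (\<Sum>b\<in>B. s (c b) (h b)) = (\<Sum>b\<in>B. s' (c b) (L (h b)))" "(\<Sum>b\<in>B. s (c b) (h b)) \<in> H"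
      using insert.IH insert.prems by blast+
    show ?case
      using insert.hyps add[OF b(2) IH(2)] scale[OF b(1)] S.subspace_add[OF assms(3) b(2) IH(2)]
      by (simp add: IH(1))
  qed
  from this[OF finite_keys assms(5), THEN conjunct1] show ?thesis unfolding lincomb_def by this
qed

text \<open>Multilinear expansion, one argument at a time: \<open>F\<close> with its first slot
  frozen at \<open>h b\<close> is multilinear in the remaining ones. The subspace \<open>{0}\<close>
  turns \<open>multilinear_mod\<close> into strict multilinearity.\<close>

lemma lincomb_tensor_prod_letters:
  assumes s: "vector_space s" and H: "module.subspace s H"
    and "\<And>t. t \<in> set ts \<Longrightarrow> Poly_Mapping.keys t \<subseteq> L" and h: "\<And>b. b \<in> L \<Longrightarrow> h b \<in> H"
    and "\<And>bs. length bs = length ts \<Longrightarrow> set bs \<subseteq> L \<Longrightarrow> f bs = F (map h bs)"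
    and "multilinear_mod s H (length ts) s {0} F"
  shows "lincomb s f (tensor_prod (map letter ts)) = F (map (lincomb s h) ts)"
  using assms(3,5,6)
proof (induction ts arbitrary: f F)
  case Nil
  interpret vector_space s by fact
  show ?case using Nil(2)[of "[]"] by (simp add: s)
next
  case (Cons t ts)
  have t: "Poly_Mapping.keys t \<subseteq> L" using Cons.prems(1) by simp
  have w: "set (map (lincomb s h) ts) \<subseteq> H"
    using Cons.prems(1) h by (auto intro!: lincomb_mem[OF s H])
  have slot: "linear_between s H s UNIV (\<lambda>x. F (x # map (lincomb s h) ts))"
    unfolding linear_between_def
  proof (intro conjI ballI allI)
    fix x y a assume "x \<in> H" "y \<in> H"
    thus "F ((x + y) # map (lincomb s h) ts) = F (x # map (lincomb s h) ts) + F (y # map (lincomb s h) ts)"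
      using Cons.prems(3)[unfolded multilinear_mod_def, rule_format, of "[]" "map (lincomb s h) ts" x y] w
      by (simp add: algebra_simps)
  next
    fix x a assume "x \<in> H"
    thus "F (s a x # map (lincomb s h) ts) = s a (F (x # map (lincomb s h) ts))"
      using Cons.prems(3)[unfolded multilinear_mod_def, rule_format, of "[]" "map (lincomb s h) ts" x x a] w
      by simp
  qed simp
  have "lincomb s f (tensor_prod (map letter (t # ts)))
      = lincomb s (\<lambda>b. lincomb s (\<lambda>bs. f (b # bs)) (tensor_prod (map letter ts))) t"
    by (simp add: lincomb_tensor_mult_letter s)
  also have "\<dots> = lincomb s (\<lambda>b. F (h b # map (lincomb s h) ts)) t"
  proof (rule lincomb_cong, rule Cons.IH)
    fix b assume "b \<in> Poly_Mapping.keys t"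
    hence b: "b \<in> L" using t by blast
    show "f (b # bs) = F (h b # map h bs)" if "length bs = length ts" "set bs \<subseteq> L" for bs
      using Cons.prems(2)[of "b # bs"] b that by simp
    show "multilinear_mod s H (length ts) s {0} (\<lambda>w. F (h b # w))"
      unfolding multilinear_mod_def
    proof (intro allI impI, elim conjE)
      fix us x y ws a
      assume "length us + 1 + length ws = length ts" "set us \<subseteq> H" "x \<in> H" "y \<in> H" "set ws \<subseteq> H"
      thus "F (h b # us @ (x + y) # ws) - F (h b # us @ x # ws) - F (h b # us @ y # ws) \<in> {0} \<and>
          F (h b # us @ s a x # ws) - s a (F (h b # us @ x # ws)) \<in> {0}"
        using Cons.prems(3)[unfolded multilinear_mod_def, rule_format, of "h b # us" ws x y a] h[OF b]
        by simp
    qed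
  qed (use Cons.prems(1) in auto)
  also have "\<dots> = F (lincomb s h t # map (lincomb s h) ts)"
    by (rule linear_between_lincomb[OF s s H slot, symmetric]) (use t h in blast)
  finally show ?case by simp
qed

text \<open>The conditions under which a map on the symbols \<open>(\<mu>, vs)\<close> induces a linear map on \<open>A(V)\<close>.\<close>

definition operadic ::
  "('k::field, 'a::ab_group_add) operad_data \<Rightarrow> ('k \<Rightarrow> 'v \<Rightarrow> 'v) \<Rightarrow> 'v::ab_group_add set \<Rightarrow>
   ('k \<Rightarrow> 'w \<Rightarrow> 'w) \<Rightarrow> ('a \<times> 'v list \<Rightarrow> 'w::ab_group_add) \<Rightarrow> bool" where
  "operadic A sV V s f \<longleftrightarrow>
     (\<forall>\<mu> vs. \<mu> \<in> ops A (length vs) \<and> set vs \<subseteq> V \<longrightarrow>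
        (\<forall>\<nu>\<in>ops A (length vs). f (\<mu> + \<nu>, vs) = f (\<mu>, vs) + f (\<nu>, vs)) \<and>
        (\<forall>a. f (oscale A a \<mu>, vs) = s a (f (\<mu>, vs))) \<and>
        (\<forall>\<sigma>. \<sigma> permutes {..<length vs} \<longrightarrow> f (oact A (length vs) \<sigma> \<mu>, vs) = f (\<mu>, permute_list \<sigma> vs))) \<and>
     (\<forall>\<mu> us x ws. \<mu> \<in> ops A (length us + 1 + length ws) \<and> set us \<subseteq> V \<and> x \<in> V \<and> set ws \<subseteq> V \<longrightarrow>
        (\<forall>y\<in>V. f (\<mu>, us @ (x + y) # ws) = f (\<mu>, us @ x # ws) + f (\<mu>, us @ y # ws)) \<and>
        (\<forall>a. f (\<mu>, us @ sV a x # ws) = s a (f (\<mu>, us @ x # ws))))"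

lemma operadicD:
  assumes "operadic A sV V s f"
  shows "\<lbrakk>\<mu> \<in> ops A (length vs); set vs \<subseteq> V; \<nu> \<in> ops A (length vs)\<rbrakk> \<Longrightarrow> f (\<mu> + \<nu>, vs) = f (\<mu>, vs) + f (\<nu>, vs)"
    and "\<lbrakk>\<mu> \<in> ops A (length vs); set vs \<subseteq> V\<rbrakk> \<Longrightarrow> f (oscale A a \<mu>, vs) = s a (f (\<mu>, vs))"
    and "\<lbrakk>\<mu> \<in> ops A (length vs); set vs \<subseteq> V; \<sigma> permutes {..<length vs}\<rbrakk> \<Longrightarrow>
      f (oact A (length vs) \<sigma> \<mu>, vs) = f (\<mu>, permute_list \<sigma> vs)"
    and "\<lbrakk>\<mu> \<in> ops A (length us + 1 + length ws); set us \<subseteq> V; x \<in> V; y \<in> V; set ws \<subseteq> V\<rbrakk> \<Longrightarrow>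
      f (\<mu>, us @ (x + y) # ws) = f (\<mu>, us @ x # ws) + f (\<mu>, us @ y # ws)"
    and "\<lbrakk>\<mu> \<in> ops A (length us + 1 + length ws); set us \<subseteq> V; x \<in> V; set ws \<subseteq> V\<rbrakk> \<Longrightarrow>
      f (\<mu>, us @ sV a x # ws) = s a (f (\<mu>, us @ x # ws))"
  using assms unfolding operadic_def by blast+

lemma lincomb_free_null:
  assumes s: "vector_space s" and f: "operadic A sV V s f" and z: "z \<in> free_null A sV V"
  shows "lincomb s f z = 0"
proof -
  interpret S: vector_space s by fact
  interpret L: Vector_Spaces.linear fscale s "lincomb s f" by (rule linear_lincomb[OF s])
  have "lincomb s f z \<in> {0}"
    by (rule linear_span_mem[OF linear_lincomb[OF s] S.subspace_single_0 _ z[unfolded free_null_def]])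
      (auto simp: L.diff s operadicD[OF f])
  thus ?thesis by simp
qed

section \<open>The free algebra as a quotient and its universal property\<close>

locale free_algebra = operad A
  for A :: "('k::field, 'a::ab_group_add) operad_data" +
  fixes sV :: "'k \<Rightarrow> 'v::ab_group_add \<Rightarrow> 'v" and V :: "'v set"
  assumes sV: "vector_space sV" and V: "module.subspace sV V"
begin

abbreviation "cls \<equiv> free_class A sV V"
abbreviation "null \<equiv> free_null A sV V"
abbreviation "X \<equiv> free_space A sV V"

definition symbols :: "('a \<times> 'v list) set" where
  "symbols = {(\<mu>, vs). \<mu> \<in> ops A (length vs) \<and> set vs \<subseteq> V}"

definition sym_cls :: "'a \<times> 'v list \<Rightarrow> ('k, 'a, 'v) free" where
  "sym_cls b = cls (Poly_Mapping.single b 1)"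

sublocale ops: vector_space "oscale A" by (rule vector_space)
sublocale sV: vector_space sV by (rule sV)
sublocale free: vector_space "fscale :: 'k \<Rightarrow> ('k, 'a, 'v) free \<Rightarrow> _" by (rule vector_space_fscale)

lemma free_reps_iff: "t \<in> free_reps A V \<longleftrightarrow> Poly_Mapping.keys t \<subseteq> symbols"
  by (auto simp: free_reps_def symbols_def)

lemma subspace_free_reps: "free.subspace (free_reps A V)"
proof (rule free.subspaceI)
  fix t u assume "t \<in> free_reps A V" "u \<in> free_reps A V"
  thus "t + u \<in> free_reps A V" using keys_add[of t u] unfolding free_reps_iff by blast
next
  fix a t assume "t \<in> free_reps A V"
  thus "fscale a t \<in> free_reps A V" unfolding free_reps_iff by (auto simp: in_keys_iff lookup_fscale)
qed (simp add: free_reps_iff)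

lemma single_free_reps: "b \<in> symbols \<Longrightarrow> Poly_Mapping.single b a \<in> free_reps A V"
  by (simp add: free_reps_iff)

lemma subspace_null: "free.subspace null"
  unfolding free_null_def by (rule free.subspace_span)

text \<open>Ensures that the representative picked by \<open>quot_rep\<close>, which differs from
  the given one by a null element, still involves only symbols over \<open>V\<close>.\<close>

lemma null_free_reps: "null \<subseteq> free_reps A V"
  unfolding free_null_def
proof (rule free.span_minimal[OF _ subspace_free_reps], intro Un_least subsetI)
  note d = free.subspace_diff[OF subspace_free_reps]
  have act: "oact A n \<sigma> \<mu> \<in> ops A n" if "\<sigma> permutes {..<n}" "\<mu> \<in> ops A n" for n \<sigma> \<mu>
    using act_linear[OF that(1)] that(2) by (auto simp: linear_between_def)
  note perm = set_permute_list
  fix t :: "('k, 'a, 'v) free"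
  show "t \<in> free_reps A V"
    if "t \<in> {Poly_Mapping.single (\<mu> + \<nu>, vs) 1 - Poly_Mapping.single (\<mu>, vs) 1
         - Poly_Mapping.single (\<nu>, vs) 1 | \<mu> \<nu> vs.
         \<mu> \<in> ops A (length vs) \<and> \<nu> \<in> ops A (length vs) \<and> set vs \<subseteq> V}"
    using that by (auto intro!: d single_free_reps simp: symbols_def ops.subspace_add[OF subspace])
  show "t \<in> free_reps A V"
    if "t \<in> {Poly_Mapping.single (oscale A a \<mu>, vs) 1 - Poly_Mapping.single (\<mu>, vs) a | a \<mu> vs.
         \<mu> \<in> ops A (length vs) \<and> set vs \<subseteq> V}"
    using that by (auto intro!: d single_free_reps simp: symbols_def ops.subspace_scale[OF subspace])
  show "t \<in> free_reps A V"
    if "t \<in> {Poly_Mapping.single (\<mu>, us @ (x + y) # ws) 1 - Poly_Mapping.single (\<mu>, us @ x # ws) 1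
         - Poly_Mapping.single (\<mu>, us @ y # ws) 1 | \<mu> us x y ws.
         \<mu> \<in> ops A (length us + 1 + length ws) \<and>
         set us \<subseteq> V \<and> x \<in> V \<and> y \<in> V \<and> set ws \<subseteq> V}"
    using that by (auto intro!: d single_free_reps simp: symbols_def sV.subspace_add[OF V])
  show "t \<in> free_reps A V"
    if "t \<in> {Poly_Mapping.single (\<mu>, us @ sV a x # ws) 1 - Poly_Mapping.single (\<mu>, us @ x # ws) a
         | \<mu> us a x ws.
         \<mu> \<in> ops A (length us + 1 + length ws) \<and> set us \<subseteq> V \<and> x \<in> V \<and> set ws \<subseteq> V}"
    using that by (auto intro!: d single_free_reps simp: symbols_def sV.subspace_scale[OF V])
  show "t \<in> free_reps A V"
    if "t \<in> {Poly_Mapping.single (oact A (length vs) \<sigma> \<mu>, vs) 1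
         - Poly_Mapping.single (\<mu>, permute_list \<sigma> vs) 1 | \<sigma> \<mu> vs.
         \<sigma> permutes {..<length vs} \<and> \<mu> \<in> ops A (length vs) \<and> set vs \<subseteq> V}"
    using that by (auto intro!: d single_free_reps simp: symbols_def perm act)
qed

lemma linear_cls: "Vector_Spaces.linear fscale fscale cls"
  unfolding free_class_def using quot_rep[OF vector_space_fscale subspace_null] by blast

lemma cls_diff_null: "cls t - t \<in> null"
  unfolding free_class_def using quot_rep[OF vector_space_fscale subspace_null] by blast

lemma cls_eq_iff: "cls t = cls u \<longleftrightarrow> t - u \<in> null"
  unfolding free_class_def by (rule quot_rep_eq_iff[OF vector_space_fscale subspace_null])

lemma cls_cls [simp]: "cls (cls t) = cls t"
  unfolding cls_eq_iff by (rule cls_diff_null)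

lemma cls_eq_lincomb: "cls t = lincomb fscale sym_cls t"
  using linear_lincomb_eq[OF linear_cls, of "\<lambda>b. Poly_Mapping.single b 1" t]
  by (simp add: sym_cls_def[abs_def] fsum_ident flip: fsum_eq_lincomb)

text \<open>The relations hold for classes because they span \<open>null\<close>. The unfoldings
  bring every clause into the form that a generator lies in that span.\<close>

lemma operadic_sym_cls: "operadic A sV V fscale sym_cls"
proof -
  interpret c: Vector_Spaces.linear fscale fscale cls by (rule linear_cls)
  have sc: "fscale a (cls (Poly_Mapping.single b 1)) = cls (Poly_Mapping.single b a)" for a b
    by (simp flip: c.scale)
  show ?thesis
    unfolding operadic_def sym_cls_def sc c.add[symmetric] cls_eq_iff diff_diff_eq[symmetric]
    unfolding free_null_def by (intro conjI allI impI ballI; rule free.span_base; blast)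
qed

text \<open>Elements of the quotient are themselves representatives, so maps on \<open>X\<close> can
  be given by formulas on symbols.\<close>

lemma free_spaceD: "t \<in> X \<Longrightarrow> t \<in> free_reps A V \<and> cls t = t"
proof -
  assume "t \<in> X"
  then obtain u where u: "t = cls u" "u \<in> free_reps A V" by (auto simp: free_space_def)
  have "cls u - u \<in> free_reps A V" using cls_diff_null null_free_reps by blast
  from free.subspace_add[OF subspace_free_reps this u(2)] show ?thesis using u by simp
qed

lemma cls_mem: "t \<in> free_reps A V \<Longrightarrow> cls t \<in> X"
  by (simp add: free_space_def)

lemma sym_cls_mem: "b \<in> symbols \<Longrightarrow> sym_cls b \<in> X"
  unfolding sym_cls_def by (intro cls_mem single_free_reps)

text \<open>\<open>cls t\<close> differs from \<open>t\<close> by a null element, which an operadic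
  map kills. This hides the arbitrary choice made in \<open>quot_rep\<close>.\<close>

lemma lincomb_cls:
  assumes s: "vector_space s" and f: "operadic A sV V s f"
  shows "lincomb s f (cls t) = lincomb s f t"
proof -
  interpret L: Vector_Spaces.linear fscale s "lincomb s f" by (rule linear_lincomb[OF s])
  show ?thesis using lincomb_free_null[OF s f cls_diff_null, of t] by (simp add: L.diff)
qed

lemma free_op_eq:
  "free_op A sV V \<mu> ts = lincomb fscale
     (\<lambda>bs. sym_cls (ocomp A (map (length \<circ> snd) bs) \<mu> (map fst bs), concat (map snd bs)))
     (tensor_prod (map letter ts))"
  unfolding free_op_def fsum_eq_lincomb linear_lincomb_eq[OF linear_cls] letter_def sym_cls_def ..

text \<open>The morphism \<open>A(V) -> H\<close> of the universal property. It can be written on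
  symbols because classes are stored as representatives.\<close>

definition eval :: "('k \<Rightarrow> 'h \<Rightarrow> 'h) \<Rightarrow> ('a \<Rightarrow> 'h list \<Rightarrow> 'h) \<Rightarrow> ('v \<Rightarrow> 'h) \<Rightarrow> ('k, 'a, 'v) free \<Rightarrow> 'h::ab_group_add" where
  "eval s opn g = lincomb s (\<lambda>(\<nu>, vs). opn \<nu> (map g vs))"

lemma operadic_opn:
  assumes alg: "operad_algebra A s H opn" and g: "linear_between sV V s H g"
  shows "operadic A sV V s (\<lambda>(\<nu>, vs). opn \<nu> (map g vs))"
proof -
  interpret H: operad_algebra A s H opn by fact
  have gV: "g x \<in> H" if "x \<in> V" for x using g that by (auto simp: linear_between_def)
  hence gV': "g ` U \<subseteq> H" if "U \<subseteq> V" for U using that by blast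
  have add: "g (x + y) = g x + g y" if "x \<in> V" "y \<in> V" for x y
    using g that by (auto simp: linear_between_def)
  have scale: "g (sV a x) = s a (g x)" if "x \<in> V" for a x
    using g that by (auto simp: linear_between_def)
  show ?thesis
    unfolding operadic_def prod.case
  proof (intro conjI allI impI ballI; (elim conjE)?)
    fix \<mu> vs \<nu> assume "\<mu> \<in> ops A (length vs)" "set vs \<subseteq> V" "\<nu> \<in> ops A (length vs)"
    thus "opn (\<mu> + \<nu>) (map g vs) = opn \<mu> (map g vs) + opn \<nu> (map g vs)"
      using H.opn_linear[of "map g vs"] gV' by (simp add: linear_between_def)
  next
    fix \<mu> vs a assume "\<mu> \<in> ops A (length vs)" "set vs \<subseteq> V"
    thus "opn (oscale A a \<mu>) (map g vs) = s a (opn \<mu> (map g vs))"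
      using H.opn_linear[of "map g vs"] gV' by (simp add: linear_between_def)
  next
    fix \<mu> vs \<sigma> assume "\<mu> \<in> ops A (length vs)" "set vs \<subseteq> V" "\<sigma> permutes {..<length vs}"
    thus "opn (oact A (length vs) \<sigma> \<mu>) (map g vs) = opn \<mu> (map g (permute_list \<sigma> vs))"
      using H.opn_act[of "map g vs" \<sigma> \<mu>] gV' by (simp add: permute_list_map)
  next
    fix \<mu> us x ws y
    assume "\<mu> \<in> ops A (length us + 1 + length ws)" "set us \<subseteq> V" "x \<in> V" "set ws \<subseteq> V" "y \<in> V"
    thus "opn \<mu> (map g (us @ (x + y) # ws)) = opn \<mu> (map g (us @ x # ws)) + opn \<mu> (map g (us @ y # ws))"
      using opn_add[OF alg, of \<mu> "map g us" "map g ws" "g x" "g y"] gV gV' by (simp add: add)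
  next
    fix \<mu> us x ws a
    assume "\<mu> \<in> ops A (length us + 1 + length ws)" "set us \<subseteq> V" "x \<in> V" "set ws \<subseteq> V"
    thus "opn \<mu> (map g (us @ sV a x # ws)) = s a (opn \<mu> (map g (us @ x # ws)))"
      using opn_scale[OF alg, of \<mu> "map g us" "map g ws" "g x" a] gV gV' by (simp add: scale)
  qed
qed

lemma eval_sym_cls:
  assumes alg: "operad_algebra A s H opn" and g: "linear_between sV V s H g"
  shows "eval s opn g (sym_cls (\<mu>, vs)) = opn \<mu> (map g vs)"
proof -
  interpret H: operad_algebra A s H opn by fact
  interpret vector_space s by (rule H.alg_vector_space)
  show ?thesis unfolding eval_def sym_cls_def
    by (subst lincomb_cls[OF H.alg_vector_space operadic_opn[OF assms]]) (simp add: H.alg_vector_space)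
qed

text \<open>Compatibility with operations is the axiom \<open>opn_comp\<close>, applied to each word
  of symbols in the expansion of the arguments. The algebra structure on \<open>X\<close> is a
  hypothesis, supplied later by the bialgebra structure of the free algebra.\<close>

lemma algebra_hom_eval:
  assumes free: "operad_algebra A fscale X (free_op A sV V)"
    and alg: "operad_algebra A s H opn" and g: "linear_between sV V s H g"
  shows "algebra_hom A fscale X (free_op A sV V) s H opn (eval s opn g)"
proof -
  interpret H: operad_algebra A s H opn by fact
  let ?h = "\<lambda>(\<nu>, vs). opn \<nu> (map g vs)"
  note s = H.alg_vector_space
  interpret e: Vector_Spaces.linear fscale s "lincomb s ?h" by (rule linear_lincomb[OF s])
  have gV: "g ` U \<subseteq> H" if "U \<subseteq> V" for U using g that by (auto simp: linear_between_def)
  have h: "?h b \<in> H" if "b \<in> symbols" for b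
    using that gV by (cases b) (simp add: symbols_def opn_mem[OF alg])
  have "eval s opn g t \<in> H" if "t \<in> X" for t
    unfolding eval_def
    by (rule lincomb_mem[OF s H.alg_subspace]) (use free_spaceD[OF that] h in \<open>auto simp: free_reps_iff\<close>)
  moreover have "eval s opn g (free_op A sV V \<mu> ts) = opn \<mu> (map (eval s opn g) ts)"
    if \<mu>: "\<mu> \<in> ops A (length ts)" and ts: "set ts \<subseteq> X" for \<mu> ts
  proof -
    have "eval s opn g (free_op A sV V \<mu> ts)
        = lincomb s (\<lambda>bs. opn (ocomp A (map (length \<circ> snd) bs) \<mu> (map fst bs)) (map g (concat (map snd bs))))
            (tensor_prod (map letter ts))"
      unfolding free_op_eq eval_def linear_lincomb_eq[OF linear_lincomb[OF s]]
      using eval_sym_cls[OF alg g] by (simp add: eval_def)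
    also have "\<dots> = opn \<mu> (map (lincomb s ?h) ts)"
    proof (rule lincomb_tensor_prod_letters[OF s H.alg_subspace _ h])
      show "Poly_Mapping.keys t \<subseteq> symbols" if "t \<in> set ts" for t
        using free_spaceD ts that by (auto simp: free_reps_iff)
      show "multilinear_mod s H (length ts) s {0} (opn \<mu>)"
        using opn_add[OF alg] opn_scale[OF alg] \<mu> by (auto simp: multilinear_mod_def)
      fix bs assume bs: "length bs = length ts" "set bs \<subseteq> symbols"
      let ?xss = "map (\<lambda>b. map g (snd b)) bs"
      have "opn (ocomp A (map length ?xss) \<mu> (map fst bs)) (concat ?xss)
          = opn \<mu> (map2 opn (map fst bs) ?xss)"
      proof (rule H.opn_comp)
        show "map fst bs \<in> listset (map (\<lambda>xs. ops A (length xs)) ?xss)"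
          using bs(2) unfolding listset_iff by (auto simp: list_all2_conv_all_nth symbols_def dest!: nth_mem)
        show "set xs \<subseteq> H" if "xs \<in> set ?xss" for xs
          using that bs(2) gV by (fastforce simp: symbols_def)
      qed (use \<mu> bs in simp)
      moreover have "map2 opn (map fst bs) ?xss = map ?h bs"
        by (induction bs) auto
      moreover have "map length ?xss = map (length \<circ> snd) bs" by simp
      moreover have "concat ?xss = map g (concat (map snd bs))" by (simp add: map_concat comp_def)
      ultimately show "opn (ocomp A (map (length \<circ> snd) bs) \<mu> (map fst bs)) (map g (concat (map snd bs)))
          = opn \<mu> (map ?h bs)" by metis
    qed
    finally show ?thesis by (simp add: eval_def)
  qed
  ultimately show ?thesis
    using free alg by (auto simp: algebra_hom_def linear_between_def eval_def e.add e.scale)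
qed

text \<open>This is what makes \<open>free_op\<close> well defined on classes, one argument at a
  time. The delicate clause is symmetry, where permuting the inputs of the middle operation must
  match a permutation of the whole composite.\<close>

lemma operadic_free_op:
  assumes \<mu>: "\<mu> \<in> ops A (length bs1 + 1 + length bs2)" and bs: "set bs1 \<subseteq> symbols" "set bs2 \<subseteq> symbols"
  shows "operadic A sV V fscale (\<lambda>b. let bs = bs1 @ b # bs2 in
    sym_cls (ocomp A (map (length \<circ> snd) bs) \<mu> (map fst bs), concat (map snd bs)))"
proof -
  define ks1 ks2 where "ks1 = map (length \<circ> snd) bs1" and "ks2 = map (length \<circ> snd) bs2"
  define \<nu>s1 \<nu>s2 where "\<nu>s1 = map fst bs1" and "\<nu>s2 = map fst bs2"
  define vss1 vss2 where "vss1 = map snd bs1" and "vss2 = map snd bs2"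
  note defs = ks1_def ks2_def \<nu>s1_def \<nu>s2_def vss1_def vss2_def
  have ks: "ks1 = map length vss1" "ks2 = map length vss2" by (simp_all add: defs)
  have \<mu>': "\<mu> \<in> ops A (length ks1 + 1 + length ks2)" using \<mu> by (simp add: defs)
  have n: "list_all2 (\<lambda>\<nu> k. \<nu> \<in> ops A k) \<nu>s1 ks1" "list_all2 (\<lambda>\<nu> k. \<nu> \<in> ops A k) \<nu>s2 ks2"
    using bs by (auto simp: defs list_all2_conv_all_nth symbols_def dest!: nth_mem)
  have v: "set (concat vss1) \<subseteq> V" "set (concat vss2) \<subseteq> V"
    using bs by (fastforce simp: symbols_def defs)+
  note slot = ocomp_slot[OF \<mu>' n]
  define comp where "comp k \<nu> = ocomp A (ks1 @ k # ks2) \<mu> (\<nu>s1 @ \<nu> # \<nu>s2)" for k \<nu>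
  have mem: "comp k \<nu> \<in> ops A (length (concat vss1) + k + length (concat vss2))" if "\<nu> \<in> ops A k" for \<nu> k
    using comp_mem[of \<mu> "ks1 @ k # ks2" "\<nu>s1 @ \<nu> # \<nu>s2"] \<mu>' n that
    by (simp add: comp_def listset_iff list_all2_map2 list_all2_appendI add.assoc length_concat ks)
  have eq: "(let bs = bs1 @ (\<nu>, vs) # bs2 in
      sym_cls (ocomp A (map (length \<circ> snd) bs) \<mu> (map fst bs), concat (map snd bs)))
    = sym_cls (comp (length vs) \<nu>, concat vss1 @ vs @ concat vss2)" for \<nu> vs
    by (simp add: comp_def defs)
  note op = operadicD[OF operadic_sym_cls]
  show ?thesis
    unfolding operadic_def eq
  proof (intro conjI allI impI ballI; (elim conjE)?)
    fix \<nu> vs \<nu>' assume H: "\<nu> \<in> ops A (length vs)" "set vs \<subseteq> V" "\<nu>' \<in> ops A (length vs)"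
    show "sym_cls (comp (length vs) (\<nu> + \<nu>'), concat vss1 @ vs @ concat vss2)
      = sym_cls (comp (length vs) \<nu>, concat vss1 @ vs @ concat vss2)
        + sym_cls (comp (length vs) \<nu>', concat vss1 @ vs @ concat vss2)"
      unfolding comp_def slot(1)[OF H(1,3)] unfolding comp_def[symmetric]
      by (rule op(1)) (use mem H v in \<open>simp_all add: add.assoc del: set_concat\<close>)
  next
    fix \<nu> vs a assume H: "\<nu> \<in> ops A (length vs)" "set vs \<subseteq> V"
    show "sym_cls (comp (length vs) (oscale A a \<nu>), concat vss1 @ vs @ concat vss2)
      = fscale a (sym_cls (comp (length vs) \<nu>, concat vss1 @ vs @ concat vss2))"
      unfolding comp_def slot(2)[OF H(1)] unfolding comp_def[symmetric]
      by (rule op(2)) (use mem H v in \<open>simp_all add: add.assoc del: set_concat\<close>)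
  next
    fix \<nu> vs \<sigma> assume H: "\<nu> \<in> ops A (length vs)" "set vs \<subseteq> V" and \<sigma>: "\<sigma> permutes {..<length vs}"
    let ?ks = "ks1 @ length vs # ks2"
    let ?\<tau>s = "replicate (length ks1) id @ \<sigma> # replicate (length ks2) id"
    let ?vss = "vss1 @ vs # vss2"
    have ks': "?ks = map length ?vss" by (simp add: ks)
    have \<tau>s: "list_all2 (\<lambda>\<tau> k. \<tau> permutes {..<k}) ?\<tau>s ?ks"
      using \<sigma> by (intro list_all2_appendI list.rel_intros) (auto simp: list_all2_conv_all_nth permutes_id)
    have len: "sum_list ?ks = length (concat vss1 @ vs @ concat vss2)" by (simp add: ks length_concat)
    \<comment> \<open>On words this permutation acts as \<open>\<sigma>\<close> on the middle block
      alone, so the symmetry relation for the composite yields that for the slot.\<close>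
    have "permute_list (sum_perm ?ks ?\<tau>s) (concat ?vss) = concat (map2 permute_list ?\<tau>s ?vss)"
      unfolding ks'
    proof (rule permute_list_sum_perm)
      show "?\<tau>s ! i permutes {..<length (?vss ! i)}" if "i < length ?vss" for i
        by (rule list_all2_nthD2[OF \<tau>s[unfolded ks' list_all2_map2] that])
    qed (simp add: ks)
    also have "map2 permute_list (replicate (length xss) id) xss = xss" for xss :: "'v list list"
      by (induction xss) (auto simp: permute_list_id)
    from this[of vss1] this[of vss2]
    have "map2 permute_list ?\<tau>s ?vss = vss1 @ permute_list \<sigma> vs # vss2"
      by (simp add: ks)
    finally have "permute_list (sum_perm ?ks ?\<tau>s) (concat vss1 @ vs @ concat vss2)
        = concat vss1 @ permute_list \<sigma> vs @ concat vss2" by (simp only: concat_append concat.simps)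
    moreover have "comp (length vs) (oact A (length vs) \<sigma> \<nu>)
        = oact A (length (concat vss1 @ vs @ concat vss2)) (sum_perm ?ks ?\<tau>s) (comp (length vs) \<nu>)"
      unfolding comp_def len[symmetric] by (rule slot(3)[OF H(1) \<sigma>])
    moreover have "sum_perm ?ks ?\<tau>s permutes {..<length (concat vss1 @ vs @ concat vss2)}"
      using sum_perm_permutes[OF \<tau>s] unfolding len .
    ultimately show "sym_cls (comp (length vs) (oact A (length vs) \<sigma> \<nu>), concat vss1 @ vs @ concat vss2)
      = sym_cls (comp (length (permute_list \<sigma> vs)) \<nu>, concat vss1 @ permute_list \<sigma> vs @ concat vss2)"
      using op(3)[of "comp (length vs) \<nu>" "concat vss1 @ vs @ concat vss2" "sum_perm ?ks ?\<tau>s"]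
        mem[OF H(1)] H v by (simp add: add.assoc del: set_concat)
  next
    fix \<nu> us x ws y
    assume H: "\<nu> \<in> ops A (length us + 1 + length ws)" "set us \<subseteq> V" "x \<in> V" "set ws \<subseteq> V" "y \<in> V"
    show "sym_cls (comp (length (us @ (x + y) # ws)) \<nu>, concat vss1 @ (us @ (x + y) # ws) @ concat vss2)
      = sym_cls (comp (length (us @ x # ws)) \<nu>, concat vss1 @ (us @ x # ws) @ concat vss2)
        + sym_cls (comp (length (us @ y # ws)) \<nu>, concat vss1 @ (us @ y # ws) @ concat vss2)"
      using op(4)[of "comp (length (us @ x # ws)) \<nu>" "concat vss1 @ us" "ws @ concat vss2" x y] mem[OF H(1)] H v
      by (simp add: add.assoc del: set_concat)
  next
    fix \<nu> us x ws a
    assume H: "\<nu> \<in> ops A (length us + 1 + length ws)" "set us \<subseteq> V" "x \<in> V" "set ws \<subseteq> V"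
    show "sym_cls (comp (length (us @ sV a x # ws)) \<nu>, concat vss1 @ (us @ sV a x # ws) @ concat vss2)
      = fscale a (sym_cls (comp (length (us @ x # ws)) \<nu>, concat vss1 @ (us @ x # ws) @ concat vss2))"
      using op(5)[of "comp (length (us @ x # ws)) \<nu>" "concat vss1 @ us" "ws @ concat vss2" x a] mem[OF H(1)] H v
      by (simp add: add.assoc del: set_concat)
  qed
qed

text \<open>Equivalent representatives are exchanged one argument after the other. \<open>f\<close>
  is generalized in the induction so that a letter already expanded can be absorbed into it.\<close>

lemma lincomb_letters_cong:
  assumes "list_all2 (\<lambda>t u. t \<in> free_reps A V \<and> u \<in> free_reps A V \<and> t - u \<in> null) ts us"
    and "\<And>bs cs. \<lbrakk>length bs + 1 + length cs = length ts; set bs \<subseteq> symbols; set cs \<subseteq> symbols\<rbrakk> \<Longrightarrow>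
      operadic A sV V fscale (\<lambda>b. f (bs @ b # cs))"
  shows "lincomb fscale f (tensor_prod (map letter ts)) = lincomb fscale f (tensor_prod (map letter us))"
  using assms
proof (induction arbitrary: f rule: list_all2_induct)
  case (Cons t ts u us)
  let ?K = "\<lambda>f ts. lincomb fscale f (tensor_prod (map letter ts))"
  note vs = vector_space_fscale
  interpret L: Vector_Spaces.linear fscale fscale "lincomb fscale (\<lambda>b. ?K (\<lambda>bs. f (b # bs)) us)"
    by (rule linear_lincomb[OF vs])
  have len: "length us = length ts" using Cons.hyps(2) by (auto dest: list_all2_lengthD)
  have us: "Poly_Mapping.keys u' \<subseteq> symbols" if "u' \<in> set us" for u'
    using that Cons.hyps(2) by (auto simp: list_all2_conv_all_nth in_set_conv_nth free_reps_iff)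
  have "?K f (t # ts) = lincomb fscale (\<lambda>b. ?K (\<lambda>bs. f (b # bs)) ts) t"
    by (simp add: lincomb_tensor_mult_letter vs)
  also have "\<dots> = lincomb fscale (\<lambda>b. ?K (\<lambda>bs. f (b # bs)) us) t"
  proof (rule lincomb_cong, rule Cons.IH)
    fix b bs cs assume b: "b \<in> Poly_Mapping.keys t"
      and *: "length bs + 1 + length cs = length ts" "set bs \<subseteq> symbols" "set cs \<subseteq> symbols"
    show "operadic A sV V fscale (\<lambda>b'. f (b # bs @ b' # cs))"
      using Cons.prems[of "b # bs" cs] b * Cons.hyps(1) by (auto simp: free_reps_iff)
  qed
  also have "\<dots> = lincomb fscale (\<lambda>b. ?K (\<lambda>bs. f (b # bs)) us) u"
  proof -
    \<comment> \<open>Swapping the sums puts the null element \<open>t - u\<close> innermost, with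
      all other letters fixed; there the operadic condition applies.\<close>
    have "lincomb fscale (\<lambda>b. ?K (\<lambda>bs. f (b # bs)) us) (t - u)
        = lincomb fscale (\<lambda>bs. lincomb fscale (\<lambda>b. f (b # bs)) (t - u)) (tensor_prod (map letter us))"
      by (rule lincomb_swap[OF vs])
    also have "\<dots> = lincomb fscale (\<lambda>bs. 0) (tensor_prod (map letter us))"
    proof (rule lincomb_cong)
      fix bs assume "bs \<in> Poly_Mapping.keys (tensor_prod (map letter us))"
      with tensor_repsD[OF tensor_prod_letters_reps[OF us]] have "length bs = length us \<and> set bs \<subseteq> symbols"
        by blast
      thus "lincomb fscale (\<lambda>b. f (b # bs)) (t - u) = 0"
        using lincomb_free_null[OF vs Cons.prems[of "[]" bs]] Cons.hyps(1) len by simp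
    qed
    finally show ?thesis by (simp add: L.diff) (simp add: lincomb_def)
  qed
  also have "\<dots> = ?K f (u # us)" by (simp add: lincomb_tensor_mult_letter vs)
  finally show ?case .
qed simp

text \<open>The canonical map from \<open>V\<close> to the free algebra.\<close>

definition gen :: "'v \<Rightarrow> ('k, 'a, 'v) free" where
  "gen x = sym_cls (oone A, [x])"

lemma gen_mem: "x \<in> V \<Longrightarrow> gen x \<in> X"
  unfolding gen_def by (rule sym_cls_mem) (use one_mem in \<open>simp add: symbols_def\<close>)

lemma free_op_gen:
  assumes \<mu>: "\<mu> \<in> ops A (length xs)" and xs: "set xs \<subseteq> V"
  shows "free_op A sV V \<mu> (map gen xs) = sym_cls (\<mu>, xs)"
proof -
  \<comment> \<open>\<open>gen x\<close> is stored as whatever representative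
    \<open>quot_rep\<close> picked. Replacing it by the plain symbol \<open>?g x\<close> leaves a
    single word in the expansion, to which \<open>comp_one_right\<close> applies.\<close>
  let ?g = "\<lambda>x. Poly_Mapping.single (oone A, [x]) (1 :: 'k)"
  have g: "?g x \<in> free_reps A V" if "x \<in> V" for x
    using that one_mem by (intro single_free_reps) (simp add: symbols_def)
  have "list_all2 (\<lambda>t u. t \<in> free_reps A V \<and> u \<in> free_reps A V \<and> t - u \<in> null) (map gen xs) (map ?g xs)"
    using xs g cls_diff_null free_spaceD[OF gen_mem]
    by (auto simp: list_all2_conv_all_nth gen_def sym_cls_def subset_iff)
  hence "free_op A sV V \<mu> (map gen xs) = lincomb fscale
     (\<lambda>bs. sym_cls (ocomp A (map (length \<circ> snd) bs) \<mu> (map fst bs), concat (map snd bs)))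
     (tensor_prod (map letter (map ?g xs)))"
    unfolding free_op_eq
    by (rule lincomb_letters_cong) (use operadic_free_op[unfolded Let_def] \<mu> in simp)
  also have "\<dots> = sym_cls (ocomp A (replicate (length xs) 1) \<mu> (replicate (length xs) (oone A)), xs)"
    by (simp add: tensor_prod_letters_single comp_def vector_space_fscale map_replicate_const)
  also have "\<dots> = sym_cls (\<mu>, xs)" using comp_one_right[OF \<mu>] by simp
  finally show ?thesis .
qed

lemma sym_cls_scale:
  assumes "\<mu> \<in> ops A (length us + length vs)" "set us \<subseteq> V" "set vs \<subseteq> V"
  shows "sym_cls (\<mu>, us @ map (sV c) vs) = fscale (c ^ length vs) (sym_cls (\<mu>, us @ vs))"
  using assms
proof (induction vs arbitrary: us)
  case (Cons v vs)
  have "sym_cls (\<mu>, us @ map (sV c) (v # vs)) = sym_cls (\<mu>, (us @ [sV c v]) @ map (sV c) vs)" by simp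
  also have "\<dots> = fscale (c ^ length vs) (sym_cls (\<mu>, us @ sV c v # vs))"
    using Cons.IH[of "us @ [sV c v]"] Cons.prems sV.subspace_scale[OF V] by simp
  also have "sym_cls (\<mu>, us @ sV c v # vs) = fscale c (sym_cls (\<mu>, us @ v # vs))"
    using Cons.prems by (intro operadicD(5)[OF operadic_sym_cls]) auto
  finally show ?case by (simp add: mult.commute)
qed simp

text \<open>Multilinearity pulls one factor \<open>c\<close> out of each letter. Functoriality will
  make this operator, which detects arity, commute with the cooperations.\<close>

lemma free_map_scale:
  assumes b: "\<mu> \<in> ops A (length vs)" "set vs \<subseteq> V"
  shows "free_map A sV V (sV c) (sym_cls (\<mu>, vs)) = fscale (c ^ length vs) (sym_cls (\<mu>, vs))"
proof -
  let ?f = "\<lambda>(\<mu>, vs). sym_cls (\<mu>, map (sV c) vs)"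
  have eq: "free_map A sV V (sV c) t = lincomb fscale ?f t" for t
    unfolding free_map_def fsum_eq_lincomb linear_lincomb_eq[OF linear_cls]
    by (simp add: sym_cls_def case_prod_unfold)
  note op = operadicD[OF operadic_sym_cls]
  have cV: "sV c ` U \<subseteq> V" if "U \<subseteq> V" for U using that sV.subspace_scale[OF V] by blast
  have "operadic A sV V fscale ?f"
    unfolding operadic_def prod.case
  proof (intro conjI allI impI ballI; (elim conjE)?)
    fix \<mu> vs \<nu> assume "\<mu> \<in> ops A (length vs)" "set vs \<subseteq> V" "\<nu> \<in> ops A (length vs)"
    thus "sym_cls (\<mu> + \<nu>, map (sV c) vs) = sym_cls (\<mu>, map (sV c) vs) + sym_cls (\<nu>, map (sV c) vs)"
      using op(1)[of \<mu> "map (sV c) vs" \<nu>] cV by simp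
  next
    fix \<mu> vs a assume "\<mu> \<in> ops A (length vs)" "set vs \<subseteq> V"
    thus "sym_cls (oscale A a \<mu>, map (sV c) vs) = fscale a (sym_cls (\<mu>, map (sV c) vs))"
      using op(2)[of \<mu> "map (sV c) vs" a] cV by simp
  next
    fix \<mu> vs \<sigma> assume "\<mu> \<in> ops A (length vs)" "set vs \<subseteq> V" "\<sigma> permutes {..<length vs}"
    thus "sym_cls (oact A (length vs) \<sigma> \<mu>, map (sV c) vs) = sym_cls (\<mu>, map (sV c) (permute_list \<sigma> vs))"
      using op(3)[of \<mu> "map (sV c) vs" \<sigma>] cV by (simp add: permute_list_map)
  next
    fix \<mu> us x ws y
    assume "\<mu> \<in> ops A (length us + 1 + length ws)" "set us \<subseteq> V" "x \<in> V" "set ws \<subseteq> V" "y \<in> V"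
    thus "sym_cls (\<mu>, map (sV c) (us @ (x + y) # ws))
        = sym_cls (\<mu>, map (sV c) (us @ x # ws)) + sym_cls (\<mu>, map (sV c) (us @ y # ws))"
      using op(4)[of \<mu> "map (sV c) us" "map (sV c) ws" "sV c x" "sV c y"] cV sV.subspace_scale[OF V]
      by (simp add: sV.scale_right_distrib)
  next
    fix \<mu> us x ws a
    assume "\<mu> \<in> ops A (length us + 1 + length ws)" "set us \<subseteq> V" "x \<in> V" "set ws \<subseteq> V"
    thus "sym_cls (\<mu>, map (sV c) (us @ sV a x # ws)) = fscale a (sym_cls (\<mu>, map (sV c) (us @ x # ws)))"
      using op(5)[of \<mu> "map (sV c) us" "map (sV c) ws" "sV c x" a] cV sV.subspace_scale[OF V]
      by (simp add: mult.commute)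
  qed
  hence "free_map A sV V (sV c) (sym_cls (\<mu>, vs)) = sym_cls (\<mu>, map (sV c) vs)"
    unfolding eq sym_cls_def[of "(\<mu>, vs)"]
    by (subst lincomb_cls[OF vector_space_fscale]) (simp_all add: vector_space_fscale)
  also have "\<dots> = fscale (c ^ length vs) (sym_cls (\<mu>, vs))"
    using sym_cls_scale[of \<mu> "[]" vs c] b by simp
  finally show ?thesis .
qed

end

section \<open>Generators are primitive\<close>

text \<open>Independence of eigenvectors for different eigenvalues, modulo an invariant subspace
  \<open>N\<close>. Members of \<open>S\<close> may share eigenvalues; they only have to avoid
  \<open>c\<close>.\<close>

lemma eigenvector_mem:
  assumes F: "Vector_Spaces.linear s s F" and N: "module.subspace s N" "\<And>x. x \<in> N \<Longrightarrow> F x \<in> N"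
    and "finite S" "\<And>v. v \<in> S \<Longrightarrow> \<exists>d. d \<noteq> c \<and> F v - s d v \<in> N"
    and "x - (\<Sum>v\<in>S. s (a v) v) \<in> N" "F x - s c x \<in> N"
  shows "x \<in> N"
proof -
  interpret F: Vector_Spaces.linear s s F by fact
  note add = F.vs1.subspace_add[OF N(1)] and diff = F.vs1.subspace_diff[OF N(1)]
    and scale = F.vs1.subspace_scale[OF N(1)]
  show ?thesis
    using assms(4-)
  proof (induction S arbitrary: x a rule: finite_induct)
    case (insert v S)
    obtain d where d: "d \<noteq> c" "F v - s d v \<in> N" using insert.prems(1) by blast
    obtain e where e: "\<And>u. u \<in> S \<Longrightarrow> F u - s (e u) u \<in> N" using insert.prems(1) by (metis insertCI)
    \<comment> \<open>Modulo \<open>N\<close>, applying \<open>F - d\<close> removes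
      \<open>v\<close> and multiplies the coefficient of \<open>u\<close> by \<open>e u - d\<close>.
      The result \<open>?y\<close> again has eigenvalue \<open>c\<close>, so the induction
      hypothesis puts it into \<open>N\<close>; it is also \<open>(c - d) x\<close> modulo
      \<open>N\<close>.\<close>
    let ?y = "F x - s d x" and ?\<Sigma> = "\<Sum>u\<in>insert v S. s (a u) u"
    have "?y - (\<Sum>u\<in>S. s (a u * (e u - d)) u)
        = (F (x - ?\<Sigma>) - s d (x - ?\<Sigma>)) + s (a v) (F v - s d v) + (\<Sum>u\<in>S. s (a u) (F u - s (e u) u))"
      using insert.hyps
      by (simp add: F.diff F.add F.sum F.scale F.vs1.scale_right_diff_distrib F.vs1.scale_right_distrib
          F.vs1.scale_left_diff_distrib F.vs1.scale_sum_right sum_subtractf right_diff_distrib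
          sum.distrib mult.commute)
    also have "\<dots> \<in> N"
      by (rule add[OF add[OF diff[OF N(2)[OF insert.prems(2)] scale[OF insert.prems(2)]] scale[OF d(2)]]
            F.vs1.subspace_sum[OF N(1) scale[OF e]]])
    finally have "?y - (\<Sum>u\<in>S. s (a u * (e u - d)) u) \<in> N" .
    moreover have "F ?y - s c ?y = F (F x - s c x) - s d (F x - s c x)"
      by (simp add: F.diff F.scale F.vs1.scale_right_diff_distrib mult.commute)
    hence "F ?y - s c ?y \<in> N" using diff[OF N(2) scale] insert.prems(3) by simp
    ultimately have "?y \<in> N"
      by (rule insert.IH[rotated, of _ "\<lambda>u. a u * (e u - d)"]) (rule insert.prems(1), simp)
    from diff[OF this insert.prems(3)] have "s (c - d) x \<in> N"
      by (simp add: F.vs1.scale_left_diff_distrib)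
    from scale[OF this, of "inverse (c - d)"] d(1) show ?case by simp
  qed simp
qed

context free_algebra
begin

text \<open>Eigenvectors modulo \<open>tensor_null\<close>, since tensors are stored by
  representatives. All \<open>k\<close> are collected in one set, which need not be closed under
  sums; hence the spans below. The bound \<open>k \<ge> m\<close> says that each tensor factor has
  weight at least one.\<close>

definition weight_vectors :: "nat \<Rightarrow> (('k, 'a, 'v) free list \<Rightarrow>\<^sub>0 'k) set" where
  "weight_vectors m = {t \<in> tensor_reps X m. \<exists>k\<ge>m.
     tensor_map (free_map A sV V (sV 2)) t - fscale (2 ^ k) t \<in> tensor_null fscale X}"

sublocale tens: vector_space "fscale :: 'k \<Rightarrow> (('k, 'a, 'v) free list \<Rightarrow>\<^sub>0 'k) \<Rightarrow> _"
  by (rule vector_space_fscale)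

lemma subspace_free_space: "free.subspace X"
proof -
  interpret c: Vector_Spaces.linear fscale fscale cls by (rule linear_cls)
  show ?thesis unfolding free_space_def by (rule c.subspace_image[OF subspace_free_reps])
qed

context
  assumes A0: "ops A 0 = {0}"
    and G: "linear_between fscale X fscale X (free_map A sV V (sV 2))"
begin

lemma zero_letter_null: "Poly_Mapping.single [0] 1 \<in> tensor_null fscale X"
proof -
  have "0 \<in> X" by (rule free.subspace_0[OF subspace_free_space])
  thus ?thesis using tensor_null_scale_gen[of "[]" X 0 "[]" fscale 0] by simp
qed

text \<open>For a null tensor the eigenvector condition holds with every \<open>k\<close>.\<close>

lemma null_weight_vector:
  "t \<in> tensor_null fscale X \<Longrightarrow> t \<in> tensor_reps X m \<Longrightarrow> t \<in> weight_vectors m"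
  using tensor_map_null[OF G, of t] tensor_null_simps(3,4) unfolding weight_vectors_def by blast

text \<open>It suffices to treat classes of symbols, which span \<open>X\<close> and are
  eigenvectors: weights add under the product, and a nonzero class contributes at least one.\<close>

lemma weight_vectors_Cons:
  assumes a: "a \<in> X" and u: "u \<in> weight_vectors m"
  shows "tensor_mult (Poly_Mapping.single [a] 1) u \<in> tens.span (weight_vectors (Suc m))"
proof -
  let ?W = "tens.span (weight_vectors (Suc m))" and ?G = "free_map A sV V (sV 2)"
  let ?cons = "\<lambda>a. tensor_mult (Poly_Mapping.single [a] 1) u"
  let ?P = "{a \<in> X. ?cons a \<in> ?W}"
  have ur: "u \<in> tensor_reps X m" using u by (simp add: weight_vectors_def)
  have null: "tensor_mult z u \<in> ?W" if "z \<in> tensor_null fscale X" "z \<in> tensor_reps X 1" for z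
    using tensor_mult_null_left[OF that(1) ur] tensor_mult_reps[OF that(2) ur]
    by (intro tens.span_base null_weight_vector) simp_all
  note X = subspace_free_space
  have letter: "Poly_Mapping.single [a] c \<in> tensor_reps X 1" if "a \<in> X" for a c
    using that by (simp add: single_in_tensor_reps)
  \<comment> \<open>The word \<open>[a]\<close> depends linearly on \<open>a\<close> only modulo
    null tensors; the discrepancy is harmless, as null tensors are weight vectors.\<close>
  have "free.subspace ?P"
  proof (rule free.subspaceI)
    show "0 \<in> ?P"
      using free.subspace_0[OF X] null[OF zero_letter_null letter] by simp
  next
    fix a b assume ab: "a \<in> ?P" "b \<in> ?P"
    let ?z = "Poly_Mapping.single [a + b] 1 - Poly_Mapping.single [a] 1 - Poly_Mapping.single [b] 1"
    have sum: "a + b \<in> X" using ab free.subspace_add[OF X] by blast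
    have "tensor_mult ?z u \<in> ?W"
      using ab sum tensor_null_add_gen[of "[]" X a b "[]" fscale]
      by (intro null tensor_reps_simps letter) auto
    from tens.span_add[OF tens.span_add[OF this, of "?cons a"], of "?cons b"] ab sum
    show "a + b \<in> ?P" by simp
  next
    fix c a assume a: "a \<in> ?P"
    let ?z = "Poly_Mapping.single [fscale c a] 1 - Poly_Mapping.single [a] c"
    have sc: "fscale c a \<in> X" using a free.subspace_scale[OF X] by blast
    have "tensor_mult ?z u \<in> ?W"
      using a sc tensor_null_scale_gen[of "[]" X a "[]" fscale c]
      by (intro null tensor_reps_simps letter) auto
    moreover have "Poly_Mapping.single [a] c = fscale c (Poly_Mapping.single [a] 1)" by simp
    hence "tensor_mult (Poly_Mapping.single [a] c) u \<in> ?W"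
      using a by (simp only: tensor_mult_simps tens.span_scale mem_Collect_eq)
    ultimately have "tensor_mult ?z u + tensor_mult (Poly_Mapping.single [a] c) u \<in> ?W"
      by (rule tens.span_add)
    thus "fscale c a \<in> ?P" using sc by simp
  qed
  moreover have "sym_cls b \<in> ?P" if b: "b \<in> symbols" for b
  proof -
    obtain \<mu> vs where \<mu>: "b = (\<mu>, vs)" "\<mu> \<in> ops A (length vs)" "set vs \<subseteq> V"
      using b by (auto simp: symbols_def)
    let ?e = "sym_cls b"
    have e: "?e \<in> X" by (rule sym_cls_mem[OF b])
    have Ge: "?G ?e = fscale (2 ^ length vs) ?e" using free_map_scale[OF \<mu>(2,3), of 2] \<mu>(1) by simp
    have "?cons ?e \<in> ?W"
    \<comment> \<open>Weight zero would break the bound, but \<open>A(0) = 0\<close> makes such a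
      class zero.\<close>
    proof (cases "length vs = 0")
      case True
      hence "\<mu> = oscale A 0 0" "\<mu> = 0" using \<mu>(2) A0 by auto
      hence "?e = 0" using operadicD(2)[OF operadic_sym_cls, of 0 vs 0] \<mu> by auto
      thus ?thesis using null[OF zero_letter_null letter] e by simp
    next
      case False
      obtain k where k: "k \<ge> m" "tensor_eq fscale X (tensor_map ?G u) (fscale (2 ^ k) u)"
        using u by (auto simp: weight_vectors_def tensor_eq_def)
      have Gu: "tensor_map ?G u \<in> tensor_reps X m"
        using G ur by (intro tensor_map_reps) (auto simp: linear_between_def)
      have "tensor_map ?G (?cons ?e) = tensor_mult (Poly_Mapping.single [?G ?e] 1) (tensor_map ?G u)"
        by (simp add: tensor_map_mult)
      also have "tensor_eq fscale X \<dots>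
          (tensor_mult (Poly_Mapping.single [?e] (2 ^ length vs)) (fscale (2 ^ k) u))"
        using tensor_null_scale_gen[of "[]" X ?e "[]" fscale "2 ^ length vs"] e
        by (intro tensor_eq_mult[OF _ k(2) letter Gu]) (simp_all add: tensor_eq_def Ge)
      also have "Poly_Mapping.single [?e] (2 ^ length vs) = fscale (2 ^ length vs) (Poly_Mapping.single [?e] 1)"
        by simp
      also have "tensor_mult \<dots> (fscale (2 ^ k) u) = fscale (2 ^ (length vs + k)) (?cons ?e)"
        unfolding tensor_mult_simps tensor_mult_simps_right by (simp add: power_add mult.commute)
      finally have "tensor_eq fscale X (tensor_map ?G (?cons ?e)) (fscale (2 ^ (length vs + k)) (?cons ?e))" .
      moreover have "Suc m \<le> length vs + k" using k(1) False by linarith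
      ultimately have "?cons ?e \<in> weight_vectors (Suc m)"
        using tensor_mult_reps[OF letter[OF e] ur]
        by (auto simp: weight_vectors_def tensor_eq_def intro!: exI[of _ "length vs + k"])
      thus ?thesis by (rule tens.span_base)
    qed
    thus ?thesis using e by simp
  qed
  ultimately have "lincomb fscale sym_cls a \<in> ?P"
    using free_spaceD[OF a] by (intro lincomb_mem[OF vector_space_fscale]) (auto simp: free_reps_iff)
  thus ?thesis using free_spaceD[OF a] cls_eq_lincomb[of a] by simp
qed

lemma tensor_reps_weight_vectors: "t \<in> tensor_reps X m \<Longrightarrow> t \<in> tens.span (weight_vectors m)"
proof -
  have word: "Poly_Mapping.single w 1 \<in> tens.span (weight_vectors (length w))" if "set w \<subseteq> X" for w
    using that
  proof (induction w)
    case Nil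
    show ?case
      by (rule tens.span_base)
        (simp add: weight_vectors_def single_in_tensor_reps tensor_null_simps exI[of _ 0])
  next
    case (Cons a w)
    have "tensor_mult (Poly_Mapping.single [a] 1) (Poly_Mapping.single w 1)
        \<in> tens.span (weight_vectors (Suc (length w)))"
      by (rule linear_span_mem[OF linear_tensor_mult(2) tens.subspace_span weight_vectors_Cons])
        (use Cons in auto)
    thus ?case by simp
  qed
  assume t: "t \<in> tensor_reps X m"
  have "fsum (\<lambda>w. Poly_Mapping.single w 1) t \<in> tens.span (weight_vectors m)"
    by (rule fsum_mem[OF tens.subspace_span]) (use word tensor_repsD[OF t] in blast)
  thus ?thesis by (simp add: fsum_ident)
qed

text \<open>
  For \<open>x \<in> V\<close> the tensor \<open>\<delta>(x)\<close> has weight one, by functoriality applied to the multiplication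
  by \<open>2\<close> on \<open>V\<close>, whereas all the weights of \<open>A(V)\<^sup>\<otimes>\<^sup>m\<close> are at least \<open>m\<close>, as \<open>A(0) = 0\<close>.
\<close>

lemma gen_primitive:
  assumes coalg: "coalgebra_hom C fscale X co fscale X co (free_map A sV V (sV 2))"
    and char: "\<And>k. k \<ge> 2 \<Longrightarrow> (2 :: 'k) ^ k \<noteq> 2" and x: "x \<in> V"
  shows "gen x \<in> primitive_part C fscale X co"
proof -
  interpret D: operad_coalgebra C fscale X co using coalg by (simp add: coalgebra_hom_def)
  let ?G = "free_map A sV V (sV 2)" and ?N = "tensor_null fscale X"
  have "tensor_eq fscale X (co m \<delta> (gen x)) 0" if m: "m \<ge> 2" and \<delta>: "\<delta> \<in> ops C m" for m \<delta>
  proof -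
    let ?t = "co m \<delta> (gen x)"
    have g: "gen x \<in> X" by (rule gen_mem[OF x])
    have t: "?t \<in> tensor_reps X m" by (rule D.coop_mem[OF \<delta> g])
    have "?G (gen x) = fscale 2 (gen x)"
      unfolding gen_def using free_map_scale[of "oone A" "[x]" 2] x one_mem by simp
    with coalg \<delta> g have "tensor_eq fscale X (tensor_map ?G ?t) (co m \<delta> (fscale 2 (gen x)))"
      unfolding coalgebra_hom_def by metis
    also have "tensor_eq fscale X \<dots> (fscale 2 ?t)" by (rule D.coop_scale_right[OF \<delta> g])
    finally have Gt: "tensor_map ?G ?t - fscale 2 ?t \<in> ?N" by (simp add: tensor_eq_def)
    obtain S a where S: "finite S" "S \<subseteq> weight_vectors m" "?t = (\<Sum>v\<in>S. fscale (a v) v)"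
      using tensor_reps_weight_vectors[OF t] unfolding tens.span_explicit by blast
    \<comment> \<open>The weights are \<open>2 ^ k\<close> with \<open>k \<ge> m \<ge> 2\<close>,
      and \<open>char\<close> separates them from the eigenvalue 2 of \<open>?t\<close>.\<close>
    have eig: "\<exists>d. d \<noteq> 2 \<and> tensor_map ?G v - fscale d v \<in> ?N" if v: "v \<in> S" for v
    proof -
      obtain k where "k \<ge> m" "tensor_map ?G v - fscale (2 ^ k) v \<in> ?N"
        using subsetD[OF S(2) v] by (auto simp: weight_vectors_def)
      thus ?thesis using char[of k] m by auto
    qed
    have "Vector_Spaces.linear fscale fscale (tensor_map ?G :: (_ \<Rightarrow>\<^sub>0 'k) \<Rightarrow> _)"
      unfolding tensor_map_def by (rule linear_fsum)
    moreover have "?t - (\<Sum>v\<in>S. fscale (a v) v) \<in> ?N" unfolding S(3) by (simp add: tensor_null_simps)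
    ultimately have "?t \<in> ?N"
      using eigenvector_mem[OF _ subspace_tensor_null tensor_map_null[OF G] S(1) eig _ Gt, of a] by blast
    thus ?thesis by (simp add: tensor_eq_def)
  qed
  thus ?thesis using gen_mem[OF x] by (simp add: primitive_part_def)
qed

end

end

section \<open>Primitive operations\<close>

lemma subspace_primitive_part:
  assumes "operad_coalgebra C s H coop"
  shows "module.subspace s (primitive_part C s H coop)"
proof -
  interpret operad_coalgebra C s H coop by fact
  interpret S: vector_space s by (rule coalg_vector_space)
  note H = coalg_subspace
  show ?thesis
  proof (rule S.subspaceI)
    have "tensor_eq s H (coop n \<delta> (s 0 0)) (fscale 0 (coop n \<delta> 0))" if "\<delta> \<in> ops C n" for n \<delta>
      using coop_scale_right[OF that S.subspace_0[OF H]] .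
    thus "0 \<in> primitive_part C s H coop" using S.subspace_0[OF H] by (simp add: primitive_part_def)
  next
    fix x y assume xy: "x \<in> primitive_part C s H coop" "y \<in> primitive_part C s H coop"
    have "tensor_eq s H (coop n \<delta> (x + y)) 0" if "n \<ge> 2" "\<delta> \<in> ops C n" for n \<delta>
    proof -
      have "tensor_eq s H (coop n \<delta> (x + y)) (coop n \<delta> x + coop n \<delta> y)"
        using xy that by (intro coop_add_right) (auto simp: primitive_part_def)
      also have "tensor_eq s H \<dots> (0 + 0)"
        using xy that by (intro tensor_eq_add) (auto simp: primitive_part_def)
      finally show ?thesis by simp
    qed
    thus "x + y \<in> primitive_part C s H coop"
      using xy S.subspace_add[OF H] by (simp add: primitive_part_def)
  next
    fix a x assume x: "x \<in> primitive_part C s H coop"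
    have "tensor_eq s H (coop n \<delta> (s a x)) 0" if "n \<ge> 2" "\<delta> \<in> ops C n" for n \<delta>
    proof -
      have "tensor_eq s H (coop n \<delta> (s a x)) (fscale a (coop n \<delta> x))"
        using x that by (intro coop_scale_right) (auto simp: primitive_part_def)
      also have "tensor_eq s H \<dots> (fscale a 0)"
        using x that by (intro tensor_eq_scale) (auto simp: primitive_part_def)
      finally show ?thesis by simp
    qed
    thus "s a x \<in> primitive_part C s H coop"
      using x S.subspace_scale[OF H] by (simp add: primitive_part_def)
  qed
qed

lemma primitive_part_subset: "primitive_part C s H coop \<subseteq> H"
  by (auto simp: primitive_part_def)

section \<open>Inheritance of the axioms by suboperads and subspaces\<close>

lemma listset_mono:
  "\<lbrakk>xs \<in> listset (map P ks); \<And>k. P k \<subseteq> Q k\<rbrakk> \<Longrightarrow> xs \<in> listset (map Q ks)"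
  unfolding listset_iff list_all2_map2 by (erule list_all2_mono) blast

lemma multilinear_on_mono:
  assumes "multilinear_on s Us s' f" "list_all2 (\<subseteq>) Ws Us"
  shows "multilinear_on s Ws s' f"
  unfolding multilinear_on_def
proof (intro ballI allI impI)
  fix xs i y a assume xs: "xs \<in> listset Ws" and i: "i < length Ws" and y: "y \<in> Ws ! i"
  have "list_all2 (\<in>) xs Us"
    by (rule list_all2_trans[OF _ xs[unfolded listset_iff] assms(2)]) blast
  moreover have "length Us = length Ws" "Ws ! i \<subseteq> Us ! i"
    using assms(2) i by (auto simp: list_all2_conv_all_nth)
  ultimately show "f (xs[i := xs ! i + y]) = f xs + f (xs[i := y]) \<and> f (xs[i := s a (xs ! i)]) = s' a (f xs)"
    using assms(1) i y unfolding multilinear_on_def listset_iff[symmetric] by (metis subsetD)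
qed

lemma restrict_ops_sel:
  "ops (restrict_ops A P) = P" "oscale (restrict_ops A P) = oscale A" "oact (restrict_ops A P) = oact A"
  "ocomp (restrict_ops A P) = ocomp A" "oone (restrict_ops A P) = oone A"
  by simp_all

text \<open>All equational axioms are inherited from \<open>A\<close>; only the closure conditions
  carry content.\<close>

lemma suboperadI:
  assumes "operad A" "\<And>n. P n \<subseteq> ops A n" "\<And>n. module.subspace (oscale A) (P n)" "oone A \<in> P 1"
    and act: "\<And>n \<sigma> \<mu>. \<lbrakk>\<sigma> permutes {..<n}; \<mu> \<in> P n\<rbrakk> \<Longrightarrow> oact A n \<sigma> \<mu> \<in> P n"
    and comp: "\<And>ks \<mu> \<nu>s. \<lbrakk>\<mu> \<in> P (length ks); \<nu>s \<in> listset (map P ks)\<rbrakk> \<Longrightarrow> ocomp A ks \<mu> \<nu>s \<in> P (sum_list ks)"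
  shows "suboperad P A"
proof -
  interpret operad A by fact
  note P = subsetD[OF assms(2)] and Ps = listset_mono[OF _ assms(2)]
  have "operad (restrict_ops A P)"
  proof (rule operad.intro, unfold restrict_ops_sel)
    show "vector_space (oscale A)" by (rule vector_space)
    show "module.subspace (oscale A) (P n)" "oone A \<in> P 1" for n by fact+
    show "linear_between (oscale A) (P n) (oscale A) (P n) (oact A n \<sigma>)" if "\<sigma> permutes {..<n}" for \<sigma> n
      using act_linear[OF that] act[OF that] P by (auto simp: linear_between_def)
    show "oact A n id \<mu> = \<mu>" if "\<mu> \<in> P n" for \<mu> n using act_id P that by blast
    show "oact A n (\<sigma> \<circ> \<tau>) \<mu> = oact A n \<sigma> (oact A n \<tau> \<mu>)"
      if "\<sigma> permutes {..<n}" "\<tau> permutes {..<n}" "\<mu> \<in> P n" for \<sigma> \<tau> \<mu> n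
      using act_comp P that by blast
    show "ocomp A ks \<mu> \<nu>s \<in> P (sum_list ks)"
      if "\<mu> \<in> P (length ks)" "\<nu>s \<in> listset (map P ks)" for ks \<mu> \<nu>s
      using comp that .
    show "linear_between (oscale A) (P (length ks)) (oscale A) (P (sum_list ks)) (\<lambda>\<mu>. ocomp A ks \<mu> \<nu>s)"
      if "\<nu>s \<in> listset (map P ks)" for ks \<nu>s
      using comp_linear[OF Ps[OF that]] comp[OF _ that] P by (auto simp: linear_between_def)
    show "multilinear_on (oscale A) (map P ks) (oscale A) (ocomp A ks \<mu>)" if "\<mu> \<in> P (length ks)" for ks \<mu>
      by (rule multilinear_on_mono[OF comp_multilinear[OF P[OF that]]])
        (simp add: list_all2_conv_all_nth assms(2))
    show "ocomp A [n] (oone A) [\<mu>] = \<mu>" if "\<mu> \<in> P n" for n \<mu> using comp_one_left P that by blast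
    show "ocomp A (replicate n 1) \<mu> (replicate n (oone A)) = \<mu>" if "\<mu> \<in> P n" for n \<mu>
      using comp_one_right P that by blast
    show "ocomp A (concat kss) (ocomp A (map length kss) \<mu> \<nu>s) (concat \<xi>ss) =
        ocomp A (map sum_list kss) \<mu> (map (\<lambda>i. ocomp A (kss ! i) (\<nu>s ! i) (\<xi>ss ! i)) [0..<length kss])"
      if "\<mu> \<in> P (length kss)" "\<nu>s \<in> listset (map (\<lambda>ks. P (length ks)) kss)" "length \<xi>ss = length kss"
        "\<And>i. i < length kss \<Longrightarrow> \<xi>ss ! i \<in> listset (map P (kss ! i))" for kss \<mu> \<nu>s \<xi>ss
      by (rule comp_assoc[OF P[OF that(1)] _ that(3) Ps[OF that(4)]])
        (rule listset_mono[OF that(2) assms(2)])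
    show "ocomp A ks (oact A (length ks) \<sigma> \<mu>) \<nu>s =
        oact A (sum_list ks) (block_perm ks \<sigma>) (ocomp A (permute_list \<sigma> ks) \<mu> (permute_list \<sigma> \<nu>s))"
      if "\<sigma> permutes {..<length ks}" "\<mu> \<in> P (length ks)" "\<nu>s \<in> listset (map P ks)" for ks \<sigma> \<mu> \<nu>s
      by (rule comp_act_outer[OF that(1) P[OF that(2)] Ps[OF that(3)]])
    show "ocomp A ks \<mu> (map (\<lambda>i. oact A (ks ! i) (\<tau>s ! i) (\<nu>s ! i)) [0..<length ks]) =
        oact A (sum_list ks) (sum_perm ks \<tau>s) (ocomp A ks \<mu> \<nu>s)"
      if "\<mu> \<in> P (length ks)" "\<nu>s \<in> listset (map P ks)" "length \<tau>s = length ks"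
        "\<And>i. i < length ks \<Longrightarrow> \<tau>s ! i permutes {..<ks ! i}" for ks \<mu> \<nu>s \<tau>s
      by (rule comp_act_inner[OF P[OF that(1)] Ps[OF that(2)] that(3,4)])
  qed
  thus ?thesis using assms(2) by (simp add: suboperad_def)
qed

text \<open>Used for two choices of \<open>Q\<close>: the primitive part, and \<open>H\<close>
  itself, which has to become an algebra over the smaller operad as well.\<close>

lemma operad_algebra_restrict:
  assumes alg: "operad_algebra A s H opn" and sub: "suboperad P A"
    and Q: "module.subspace s Q" "Q \<subseteq> H"
    and closed: "\<And>\<mu> xs. \<lbrakk>\<mu> \<in> P (length xs); set xs \<subseteq> Q\<rbrakk> \<Longrightarrow> opn \<mu> xs \<in> Q"
  shows "operad_algebra (restrict_ops A P) s Q opn"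
proof -
  interpret operad_algebra A s H opn by fact
  have PA: "P n \<subseteq> ops A n" for n using sub by (simp add: suboperad_def)
  note P = subsetD[OF PA]
  have QH: "set xs \<subseteq> Q \<Longrightarrow> set xs \<subseteq> H" for xs using Q(2) by blast
  have "operad (restrict_ops A P)" using sub by (simp add: suboperad_def)
  moreover have "operad_algebra_axioms (restrict_ops A P) s Q opn"
  proof (rule operad_algebra_axioms.intro, unfold restrict_ops_sel)
    show "vector_space s" "module.subspace s Q" by (rule alg_vector_space) fact
    show "linear_between (oscale A) (P (length xs)) s Q (\<lambda>\<mu>. opn \<mu> xs)" if "set xs \<subseteq> Q" for xs
      using opn_linear[OF QH[OF that]] closed[OF _ that] P by (auto simp: linear_between_def)
    show "multilinear_on s (replicate n Q) s (opn \<mu>)" if "\<mu> \<in> P n" for n \<mu>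
      by (rule multilinear_on_mono[OF opn_multilinear[OF P[OF that]]])
        (simp add: list_all2_conv_all_nth Q(2))
    show "opn (oone A) [x] = x" if "x \<in> Q" for x using opn_one Q(2) that by blast
    show "opn (oact A (length xs) \<sigma> \<mu>) xs = opn \<mu> (permute_list \<sigma> xs)"
      if "set xs \<subseteq> Q" "\<sigma> permutes {..<length xs}" "\<mu> \<in> P (length xs)" for xs \<sigma> \<mu>
      by (rule opn_act[OF QH[OF that(1)] that(2) P[OF that(3)]])
    show "opn (ocomp A (map length xss) \<mu> \<nu>s) (concat xss) = opn \<mu> (map2 opn \<nu>s xss)"
      if "\<mu> \<in> P (length xss)" "\<nu>s \<in> listset (map (\<lambda>xs. P (length xs)) xss)"
        "\<And>xs. xs \<in> set xss \<Longrightarrow> set xs \<subseteq> Q" for \<mu> xss \<nu>s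
      by (rule opn_comp[OF P[OF that(1)] listset_mono[OF that(2) PA] QH[OF that(3)]])
  qed
  ultimately show ?thesis by (simp add: operad_algebra_def)
qed

lemma split_list_by_lengths:
  "length ys = sum_list ks \<Longrightarrow> \<exists>xss. map length xss = ks \<and> concat xss = ys"
proof (induction ks arbitrary: ys)
  case (Cons k ks)
  from Cons.IH[of "drop k ys"] Cons.prems obtain xss where "map length xss = ks" "concat xss = drop k ys"
    by auto
  thus ?case using Cons.prems by (intro exI[of _ "take k ys # xss"]) simp
qed simp

text \<open>\<open>infinite\<close> guarantees \<open>n\<close> independent variables for each
  \<open>n\<close>; in too small a universe the condition in \<open>primitive_ops\<close> would be
  vacuous for large arities.\<close>

locale generalized_bialgebras =
  fixes A :: "('k::field_char_0, 'a::ab_group_add) operad_data"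
    and C :: "('k, 'c::ab_group_add) operad_data"
    and R :: "(('k, 'a, 'c) expr \<times> ('k, 'a, 'c) expr) set"
    and sV :: "'k \<Rightarrow> 'v::ab_group_add \<Rightarrow> 'v"
    and coF :: "'v set \<Rightarrow> nat \<Rightarrow> 'c \<Rightarrow> ('k, 'a, 'v) free \<Rightarrow> (('k, 'a, 'v) free list \<Rightarrow>\<^sub>0 'k)"
  assumes type: "bialgebra_type A C R"
    and sV: "vector_space sV" and infinite: "\<exists>B. infinite B \<and> \<not> module.dependent sV B"
    and H0: "all_distributive A C R"
    and H1: "functorial_free_bialgebra A C R sV coF"
begin

lemma operad: "operad A" and conn: "connected_operad C" and A0: "ops A 0 = {0}"
  using type by (simp_all add: bialgebra_type_def connected_operad_def)

lemma free_algebra: "module.subspace sV V \<Longrightarrow> free_algebra A sV V"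
  using operad sV by (simp add: free_algebra_def free_algebra_axioms_def)

lemma free_bialgebra:
  "module.subspace sV V \<Longrightarrow> bialgebra A C R fscale (free_space A sV V) (free_op A sV V) (coF V)"
  using H1 by (simp add: functorial_free_bialgebra_def)

lemma gen_primitive:
  assumes V: "module.subspace sV V" and x: "x \<in> V"
  shows "free_algebra.gen A sV V x \<in> primitive_part C fscale (free_space A sV V) (coF V)"
proof -
  interpret F: free_algebra A sV V by (rule free_algebra[OF V])
  have "linear_between sV V sV V (sV 2)"
    using F.sV.subspace_scale[OF V]
    by (auto simp: linear_between_def F.sV.scale_right_distrib mult.commute)
  hence "bialgebra_hom A C R fscale F.X (free_op A sV V) (coF V) fscale F.X (free_op A sV V) (coF V)
      (free_map A sV V (sV 2))"
    using H1 V unfolding functorial_free_bialgebra_def by blast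
  hence *: "coalgebra_hom C fscale F.X (coF V) fscale F.X (coF V) (free_map A sV V (sV 2))"
    by (simp add: bialgebra_hom_def)
  \<comment> \<open>The inequality is proved in the natural numbers and transferred along
    \<open>of_nat\<close>, which is injective in characteristic zero.\<close>
  have "(2 :: 'k) ^ k \<noteq> 2" if "k \<ge> 2" for k
  proof -
    have "(2 :: nat) ^ k \<noteq> 2" using that power_increasing[of 2 k "2 :: nat"] by auto
    thus ?thesis by (metis of_nat_eq_iff of_nat_numeral of_nat_power)
  qed
  thus ?thesis
    using * by (intro F.gen_primitive[OF A0 _ * _ x]) (auto simp: coalgebra_hom_def)
qed

lemma independent_list:
  obtains xs where "length xs = n" "distinct xs" "\<not> module.dependent sV (set xs)"
proof -
  interpret vector_space sV by (rule sV)
  obtain B where B: "infinite B" "independent B" using infinite by blast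
  obtain T where "finite T" "card T = n" "T \<subseteq> B" using infinite_arbitrarily_large[OF B(1)] by blast
  moreover from this obtain xs where "set xs = T" "distinct xs" using finite_distinct_list by blast
  ultimately show thesis using that[of xs] B(2) independent_mono distinct_card by metis
qed

text \<open>One independent list \<open>xs\<close> is enough: the generic element on it is primitive
  by definition, and evaluation at \<open>ys\<close> transfers this to \<open>H\<close>. The free
  carrier type serves both the closure proof and the final statement.\<close>

lemma opn_primitive:
  assumes bialg: "bialgebra A C R s H opn coop"
    and \<mu>: "\<mu> \<in> primitive_ops A C sV coF (length ys)" and ys: "set ys \<subseteq> primitive_part C s H coop"
  shows "opn \<mu> ys \<in> primitive_part C s H coop"
proof -
  obtain xs where xs: "length xs = length ys" "distinct xs" "\<not> module.dependent sV (set xs)"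
    by (rule independent_list)
  have alg: "operad_algebra A s H opn" using bialg by (simp add: bialgebra_def)
  interpret H: operad_algebra A s H opn by (rule alg)
  interpret S: vector_space s by (rule H.alg_vector_space)
  interpret W: vector_space sV by (rule sV)
  interpret vector_space_pair sV s ..
  define V where "V = W.span (set xs)"
  have V: "W.subspace V" by (simp add: V_def)
  have xV: "set xs \<subseteq> V" by (simp add: V_def W.span_superset)
  interpret F: free_algebra A sV V by (rule free_algebra[OF V])
  have yH: "set ys \<subseteq> H" using ys primitive_part_subset by blast
  \<comment> \<open>\<open>xs\<close> is independent, so a linear map may take any values on it,
    repeated ones included; \<open>xs\<close> is distinct, so \<open>map_of\<close> reads them off
    unambiguously.\<close>
  obtain g where g: "Vector_Spaces.linear sV s g" "\<forall>x\<in>set xs. g x = the (map_of (zip xs ys) x)"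
    using linear_independent_extend[OF xs(3), of "\<lambda>x. the (map_of (zip xs ys) x)"] by blast
  have gxs: "map g xs = ys"
    using g(2) xs by (intro nth_equalityI) (simp_all add: map_of_zip_nth)
  have "g v \<in> H" if "v \<in> V" for v
    by (rule linear_span_mem[OF g(1) H.alg_subspace _ that[unfolded V_def]])
      (use gxs yH in auto)
  hence g': "linear_between sV V s H g"
    using g(1) by (auto simp: linear_between_def Vector_Spaces.linear_iff)
  have free: "bialgebra A C R fscale F.X (free_op A sV V) (coF V)" by (rule free_bialgebra[OF V])
  hence hom: "algebra_hom A fscale F.X (free_op A sV V) s H opn (F.eval s opn g)"
    by (intro F.algebra_hom_eval alg g') (simp add: bialgebra_def)
  interpret T: algebra_hom_of_bialgebras A C fscale F.X "free_op A sV V" "coF V" s H opn coop "F.eval s opn g"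
    by (rule algebra_hom_of_bialgebras.intro)
      (use conn hom bialg free in \<open>simp_all add: bialgebra_def\<close>)
  have eval: "F.eval s opn g (F.gen x) = g x" if "x \<in> set xs" for x
    using F.eval_sym_cls[OF alg g', of "oone A" "[x]"] H.opn_one[of "g x"] gxs yH xV that
    by (force simp: F.gen_def)
  hence ev: "map (F.eval s opn g) (map F.gen xs) = ys" using gxs by (auto simp: list_eq_iff_nth_eq)
  have \<mu>A: "\<mu> \<in> ops A (length xs)" using \<mu> xs(1) by (simp add: primitive_ops_def)
  have "F.cls (Poly_Mapping.single (\<mu>, xs) 1) \<in> primitive_part C fscale F.X (coF V)"
    using \<mu> xs unfolding primitive_ops_def V_def by (simp add: Let_def)
  hence "free_op A sV V \<mu> (map F.gen xs) \<in> primitive_part C fscale F.X (coF V)"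
    by (simp add: F.free_op_gen[OF \<mu>A xV] F.sym_cls_def)
  moreover have "set (map F.gen xs) \<subseteq> primitive_part C fscale F.X (coF V)"
    using gen_primitive[OF V] xV by auto
  moreover have "F.eval s opn g ` set (map F.gen xs) = set ys" using ev by (metis set_map)
  ultimately show ?thesis
    using T.opn_primitive_transfer[OF H0 free bialg, of \<mu> "map F.gen xs"] \<mu>A ys ev by simp
qed

text \<open>Converse of \<open>opn_primitive\<close>: the generic element is \<open>\<mu>\<close>
  evaluated at generators of a free algebra, and these are primitive.\<close>

lemma primitive_opsI:
  assumes \<mu>: "\<mu> \<in> ops A n"
    and prim: "\<And>H opn (coop :: nat \<Rightarrow> 'c \<Rightarrow> ('k, 'a, 'v) free \<Rightarrow> _) ys.
      \<lbrakk>bialgebra A C R fscale H opn coop; length ys = n; set ys \<subseteq> primitive_part C fscale H coop\<rbrakk> \<Longrightarrow>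
      opn \<mu> ys \<in> primitive_part C fscale H coop"
  shows "\<mu> \<in> primitive_ops A C sV coF n"
  unfolding primitive_ops_def Let_def
proof (intro CollectI conjI \<mu> allI impI, elim conjE)
  fix xs :: "'v list" assume len: "length xs = n"
  interpret W: vector_space sV by (rule sV)
  let ?V = "W.span (set xs)"
  have V: "W.subspace ?V" by simp
  have xV: "set xs \<subseteq> ?V" by (rule W.span_superset)
  interpret F: free_algebra A sV ?V by (rule free_algebra[OF V])
  have "free_op A sV ?V \<mu> (map F.gen xs) \<in> primitive_part C fscale F.X (coF ?V)"
    using gen_primitive[OF V] xV len by (intro prim free_bialgebra V) auto
  thus "F.cls (Poly_Mapping.single (\<mu>, xs) 1) \<in> primitive_part C fscale F.X (coF ?V)"
    using F.free_op_gen[of \<mu> xs] \<mu> len xV by (simp add: F.sym_cls_def)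
qed

text \<open>By \<open>primitive_opsI\<close> and \<open>opn_primitive\<close>, membership means
  preservation of primitive parts; each closure condition then follows from the matching algebra
  axiom.\<close>

lemma suboperad_primitive_ops: "suboperad (primitive_ops A C sV coF) A"
proof (rule suboperadI[OF operad])
  interpret operad A by (rule operad)
  interpret ops: vector_space "oscale A" by (rule vector_space)
  let ?P = "primitive_ops A C sV coF"
  have alg: "operad_algebra A fscale H opn" and coalg: "operad_coalgebra C fscale H coop"
    if "bialgebra A C R fscale H opn coop"
    for H opn and coop :: "nat \<Rightarrow> 'c \<Rightarrow> ('k, 'a, 'v) free \<Rightarrow> _"
    using that by (simp_all add: bialgebra_def)
  have lin: "linear_between (oscale A) (ops A (length ys)) fscale H (\<lambda>\<mu>. opn \<mu> ys)"
    if "bialgebra A C R fscale H opn coop" "set ys \<subseteq> primitive_part C fscale H coop"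
    for H opn ys and coop :: "nat \<Rightarrow> 'c \<Rightarrow> ('k, 'a, 'v) free \<Rightarrow> _"
    using operad_algebra.opn_linear[OF alg[OF that(1)]] that(2) primitive_part_subset by blast
  interpret free: vector_space "fscale :: 'k \<Rightarrow> ('k, 'a, 'v) free \<Rightarrow> _" by (rule vector_space_fscale)
  show sub: "?P n \<subseteq> ops A n" for n by (auto simp: primitive_ops_def)
  show "ops.subspace (?P n)" for n
  proof (rule ops.subspaceI)
    show "0 \<in> ?P n"
    proof (rule primitive_opsI)
      fix H opn and coop :: "nat \<Rightarrow> 'c \<Rightarrow> ('k, 'a, 'v) free \<Rightarrow> _" and ys
      assume *: "bialgebra A C R fscale H opn coop" "length ys = n" "set ys \<subseteq> primitive_part C fscale H coop"
      \<comment> \<open>\<open>linear_between\<close> has no clause for zero, which is recovered as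
        0 times 0.\<close>
      have "opn (oscale A 0 0) ys = fscale 0 (opn 0 ys)"
        using lin[OF *(1,3)] ops.subspace_0[OF subspace] unfolding linear_between_def by blast
      thus "opn 0 ys \<in> primitive_part C fscale H coop"
        using free.subspace_0[OF subspace_primitive_part[OF coalg[OF *(1)]]] by simp
    qed (rule ops.subspace_0[OF subspace])
  next
    fix \<mu> \<nu> assume P: "\<mu> \<in> ?P n" "\<nu> \<in> ?P n"
    show "\<mu> + \<nu> \<in> ?P n"
    proof (rule primitive_opsI)
      fix H opn and coop :: "nat \<Rightarrow> 'c \<Rightarrow> ('k, 'a, 'v) free \<Rightarrow> _" and ys
      assume *: "bialgebra A C R fscale H opn coop" "length ys = n" "set ys \<subseteq> primitive_part C fscale H coop"
      have "opn (\<mu> + \<nu>) ys = opn \<mu> ys + opn \<nu> ys"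
        using lin[OF *(1,3)] P sub *(2) unfolding linear_between_def by blast
      thus "opn (\<mu> + \<nu>) ys \<in> primitive_part C fscale H coop"
        using free.subspace_add[OF subspace_primitive_part[OF coalg[OF *(1)]]]
          opn_primitive[OF *(1) _ *(3)] P *(2) by simp
    qed (use P sub ops.subspace_add[OF subspace] in blast)
  next
    fix a \<mu> assume P: "\<mu> \<in> ?P n"
    show "oscale A a \<mu> \<in> ?P n"
    proof (rule primitive_opsI)
      fix H opn and coop :: "nat \<Rightarrow> 'c \<Rightarrow> ('k, 'a, 'v) free \<Rightarrow> _" and ys
      assume *: "bialgebra A C R fscale H opn coop" "length ys = n" "set ys \<subseteq> primitive_part C fscale H coop"
      have "opn (oscale A a \<mu>) ys = fscale a (opn \<mu> ys)"
        using lin[OF *(1,3)] P sub *(2) unfolding linear_between_def by blast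
      thus "opn (oscale A a \<mu>) ys \<in> primitive_part C fscale H coop"
        using free.subspace_scale[OF subspace_primitive_part[OF coalg[OF *(1)]]]
          opn_primitive[OF *(1) _ *(3)] P *(2) by simp
    qed (use P sub ops.subspace_scale[OF subspace] in blast)
  qed
  show "oone A \<in> ?P 1"
  proof (rule primitive_opsI[OF one_mem])
    fix H opn and coop :: "nat \<Rightarrow> 'c \<Rightarrow> ('k, 'a, 'v) free \<Rightarrow> _" and ys
    assume *: "bialgebra A C R fscale H opn coop" "length ys = 1" "set ys \<subseteq> primitive_part C fscale H coop"
    then obtain y where "ys = [y]" by (auto simp: length_Suc_conv)
    thus "opn (oone A) ys \<in> primitive_part C fscale H coop"
      using operad_algebra.opn_one[OF alg[OF *(1)], of y] *(3) primitive_part_subset by fastforce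
  qed
  show "oact A n \<sigma> \<mu> \<in> ?P n" if \<sigma>: "\<sigma> permutes {..<n}" and P: "\<mu> \<in> ?P n" for n \<sigma> \<mu>
  proof (rule primitive_opsI)
    fix H opn and coop :: "nat \<Rightarrow> 'c \<Rightarrow> ('k, 'a, 'v) free \<Rightarrow> _" and ys
    assume *: "bialgebra A C R fscale H opn coop" "length ys = n" "set ys \<subseteq> primitive_part C fscale H coop"
    have "opn (oact A n \<sigma> \<mu>) ys = opn \<mu> (permute_list \<sigma> ys)"
      using operad_algebra.opn_act[OF alg[OF *(1)], of ys \<sigma> \<mu>] * P \<sigma> sub primitive_part_subset by blast
    moreover have "opn \<mu> (permute_list \<sigma> ys) \<in> primitive_part C fscale H coop"
      using *(2,3) P \<sigma> by (intro opn_primitive[OF *(1)]) (simp_all add: set_permute_list)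
    ultimately show "opn (oact A n \<sigma> \<mu>) ys \<in> primitive_part C fscale H coop" by simp
  qed (use act_linear[OF \<sigma>] P sub in \<open>auto simp: linear_between_def\<close>)
  show "ocomp A ks \<mu> \<nu>s \<in> ?P (sum_list ks)"
    if P: "\<mu> \<in> ?P (length ks)" and \<nu>s: "\<nu>s \<in> listset (map ?P ks)" for ks \<mu> \<nu>s
  proof (rule primitive_opsI)
    have \<nu>s': "\<nu>s \<in> listset (map (ops A) ks)" by (rule listset_mono[OF \<nu>s sub])
    show "ocomp A ks \<mu> \<nu>s \<in> ops A (sum_list ks)" using comp_mem[OF _ \<nu>s'] P sub by blast
    fix H opn and coop :: "nat \<Rightarrow> 'c \<Rightarrow> ('k, 'a, 'v) free \<Rightarrow> _" and ys
    assume *: "bialgebra A C R fscale H opn coop" "length ys = sum_list ks"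
      "set ys \<subseteq> primitive_part C fscale H coop"
    \<comment> \<open>The arguments are cut into blocks, one for each inner operation, so that
      \<open>opn_comp\<close> applies.\<close>
    obtain xss where xss: "map length xss = ks" "concat xss = ys"
      using split_list_by_lengths[OF *(2)] by blast
    have xss': "set xs \<subseteq> primitive_part C fscale H coop" if "xs \<in> set xss" for xs
      using that *(3) unfolding xss(2)[symmetric] set_concat by blast
    have "opn (ocomp A (map length xss) \<mu> \<nu>s) (concat xss) = opn \<mu> (map2 opn \<nu>s xss)"
    proof (rule operad_algebra.opn_comp[OF alg[OF *(1)]])
      show "\<mu> \<in> ops A (length xss)" using subsetD[OF sub P] unfolding xss(1)[symmetric] by simp
      show "\<nu>s \<in> listset (map (\<lambda>xs. ops A (length xs)) xss)"
        using \<nu>s' unfolding xss(1)[symmetric] by (simp add: comp_def)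
      show "set xs \<subseteq> H" if "xs \<in> set xss" for xs
        using xss'[OF that] primitive_part_subset by blast
    qed
    \<comment> \<open>The inner values are primitive, hence admissible arguments for the primitive
      operation \<open>\<mu>\<close>.\<close>
    moreover have "set (map2 opn \<nu>s xss) \<subseteq> primitive_part C fscale H coop"
    proof -
      have "list_all2 (\<lambda>\<nu> xs. \<nu> \<in> ?P (length xs)) \<nu>s xss"
        using \<nu>s unfolding listset_iff xss(1)[symmetric] list_all2_map2 .
      hence "opn \<nu> xs \<in> primitive_part C fscale H coop" if "(\<nu>, xs) \<in> set (zip \<nu>s xss)" for \<nu> xs
        using that xss' set_zip_rightD[OF that]
        by (intro opn_primitive[OF *(1)]) (auto simp: list_all2_iff)
      thus ?thesis by auto
    qed
    moreover have "length (map2 opn \<nu>s xss) = length ks"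
      using \<nu>s xss(1) by (auto simp: listset_iff dest: list_all2_lengthD)
    ultimately show "opn (ocomp A ks \<mu> \<nu>s) ys \<in> primitive_part C fscale H coop"
      using opn_primitive[OF *(1), of \<mu> "map2 opn \<nu>s xss"] P by (simp add: xss)
  qed
qed

end

theorem theorem2p2p3:
  fixes A :: "('k::field_char_0, 'a::ab_group_add) operad_data"
    and C :: "('k, 'c::ab_group_add) operad_data"
    and R :: "(('k, 'a, 'c) expr \<times> ('k, 'a, 'c) expr) set"
    and sV :: "'k \<Rightarrow> 'v::ab_group_add \<Rightarrow> 'v"
    and coF :: "'v set \<Rightarrow> nat \<Rightarrow> 'c \<Rightarrow> ('k, 'a, 'v) free \<Rightarrow> (('k, 'a, 'v) free list \<Rightarrow>\<^sub>0 'k)"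
  assumes type: "bialgebra_type A C R"
    and universe: "vector_space sV" "\<exists>B. infinite B \<and> \<not> module.dependent sV B"
    and H0: "all_distributive A C R"
    and H1: "functorial_free_bialgebra A C R sV coF"
  shows "suboperad (primitive_ops A C sV coF) A \<and>
    (\<forall>(s :: 'k \<Rightarrow> 'h::ab_group_add \<Rightarrow> 'h) H opn coop. bialgebra A C R s H opn coop \<longrightarrow>
       (let P = restrict_ops A (primitive_ops A C sV coF); PrimH = primitive_part C s H coop in
        \<exists>opP. operad_algebra P s PrimH opP \<and> algebra_hom P s PrimH opP s H opn (\<lambda>x. x)))"
proof (intro conjI allI impI)
  interpret generalized_bialgebras A C R sV coF
    by (rule generalized_bialgebras.intro) fact+
  show sub: "suboperad (primitive_ops A C sV coF) A" by (rule suboperad_primitive_ops)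
  fix s :: "'k \<Rightarrow> 'h \<Rightarrow> 'h" and H opn coop
  assume bialg: "bialgebra A C R s H opn coop"
  let ?P = "restrict_ops A (primitive_ops A C sV coF)" and ?Q = "primitive_part C s H coop"
  have alg: "operad_algebra A s H opn" using bialg by (simp add: bialgebra_def)
  \<comment> \<open>The witness for \<open>opP\<close> is \<open>opn\<close> itself, so that the
    inclusion commutes with operations trivially.\<close>
  have "operad_algebra ?P s ?Q opn"
    using bialg
    by (intro operad_algebra_restrict[OF alg sub] opn_primitive[OF bialg] subspace_primitive_part
        primitive_part_subset) (simp_all add: bialgebra_def)
  moreover have "operad_algebra ?P s H opn"
    using sub
    by (intro operad_algebra_restrict[OF alg sub] opn_mem[OF alg] operad_algebra.alg_subspace[OF alg])
      (auto simp: suboperad_def)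
  ultimately have "algebra_hom ?P s ?Q opn s H opn (\<lambda>x. x)"
    using primitive_part_subset[of C s H coop] by (auto simp: algebra_hom_def linear_between_def)
  thus "let P = ?P; PrimH = ?Q in
      \<exists>opP. operad_algebra P s PrimH opP \<and> algebra_hom P s PrimH opP s H opn (\<lambda>x. x)"
    unfolding Let_def algebra_hom_def by blast
qed

end
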